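(* Let $\Bbbk$ be an infinite field, $n$ a positive integer, $S=\Bbbk[x_1,\ldots,x_n]$ a polynomial ring, and $\mathfrak m=(x_1,\ldots,x_n)$. Let $G$ be the complete graph on $n$ vertices and let $I(G)=(x_ix_j\mid 1\le i<j\le n)\subset S$ be its edge ideal. Put $R=S_{\mathfrak m}$ and $\mathfrak a=I(G)R$. Then: (1) $\mathfrak a$ is unmixed and $R/\mathfrak a^{(k)}$ is Cohen-Macaulay for all $k\ge 1$; (2) the symbolic Rees algebra $\mathcal R_s(\mathfrak a)$ is Noetherian; (3) $\mathfrak a$ is a set-theoretic complete intersection.
   Context: For an ideal $\mathfrak a$ of a Noetherian ring $R$, the $n$-th symbolic power is $\mathfrak a^{(n)}=\bigcap_{\mathfrak p\in \operatorname{Ass}(R/\mathfrak a)}(\mathfrak a^nR_{\mathfrak p}\cap R)$, and the symbolic Rees algebra is $\mathcal R_s(\mathfrak a)=\bigoplus_{n\ge 0}\mathfrak a^{(n)}t^n\subseteq R[t]$. An ideal is unmixed if all its associated primes have the same height. An ideal $\mathfrak a$ of height $h$ in a local ring $(R,\mathfrak m_R)$ is called a set-theoretic complete intersection if there exist $f_1,\ldots,f_h\in\mathfrak m_R$ with $\sqrt{\mathfrak a}=\sqrt{(f_1,\ldots,f_h)}$. *)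

theory Defs
  imports
    "HOL-Algebra.Algebra"
    "HOL-Algebra.Algebraic_Closure_Type"
    "HOL-Library.Poly_Mapping"
    "HOL-Library.Extended_Nat"
begin

section \<open>Heights, dimension, depth, Cohen-Macaulay rings\<close>

definition prime_chain :: "('a, 'b) ring_scheme \<Rightarrow> 'a set list \<Rightarrow> bool" where
  "prime_chain R Ps \<longleftrightarrow> (\<forall>P \<in> set Ps. primeideal P R) \<and> sorted_wrt (\<subset>) Ps"

definition prime_height :: "('a, 'b) ring_scheme \<Rightarrow> 'a set \<Rightarrow> enat" where
  "prime_height R P = Sup {enat k | k. \<exists>Ps. prime_chain R Ps \<and> length Ps = Suc k \<and> last Ps = P}"

definition ideal_height :: "('a, 'b) ring_scheme \<Rightarrow> 'a set \<Rightarrow> enat" where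
  "ideal_height R I = Inf {prime_height R P | P. primeideal P R \<and> I \<subseteq> P}"

definition krull_dim :: "('a, 'b) ring_scheme \<Rightarrow> enat" where
  "krull_dim R = Sup {enat k | k. \<exists>Ps. prime_chain R Ps \<and> length Ps = Suc k}"

definition local_ring :: "('a, 'b) ring_scheme \<Rightarrow> bool" where
  "local_ring R \<longleftrightarrow> cring R \<and> (\<exists>!M. maximalideal M R)"

text \<open>Only meaningful for rings satisfying \<^const>\<open>local_ring\<close>.\<close>

definition the_max_ideal :: "('a, 'b) ring_scheme \<Rightarrow> 'a set" where
  "the_max_ideal R = (THE M. maximalideal M R)"

text \<open>
  The first clause says that the element at position \<open>i\<close> is a nonzerodivisor on the
  quotient of \<open>R\<close> by the ideal generated by the elements before it.
\<close>

definition regular_sequence :: "('a, 'b) ring_scheme \<Rightarrow> 'a list \<Rightarrow> bool" where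
  "regular_sequence R xs \<longleftrightarrow>
     set xs \<subseteq> carrier R \<and>
     (\<forall>i < length xs. \<forall>r \<in> carrier R.
        xs ! i \<otimes>\<^bsub>R\<^esub> r \<in> genideal R (set (take i xs)) \<longrightarrow> r \<in> genideal R (set (take i xs))) \<and>
     genideal R (set xs) \<noteq> carrier R"

definition local_depth :: "('a, 'b) ring_scheme \<Rightarrow> enat" where
  "local_depth R =
     Sup {enat (length xs) | xs. set xs \<subseteq> the_max_ideal R \<and> regular_sequence R xs}"

definition cohen_macaulay_local :: "('a, 'b) ring_scheme \<Rightarrow> bool" where
  "cohen_macaulay_local R \<longleftrightarrow>
     noetherian_ring R \<and> local_ring R \<and> local_depth R = krull_dim R"


section \<open>Localization\<close>

definition loc_rel :: "('a, 'b) ring_scheme \<Rightarrow> 'a set \<Rightarrow> (('a \<times> 'a) \<times> ('a \<times> 'a)) set" where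
  "loc_rel R U = {((a, s), (b, t)). a \<in> carrier R \<and> s \<in> U \<and> b \<in> carrier R \<and> t \<in> U \<and>
     (\<exists>u \<in> U. u \<otimes>\<^bsub>R\<^esub> (t \<otimes>\<^bsub>R\<^esub> a) = u \<otimes>\<^bsub>R\<^esub> (s \<otimes>\<^bsub>R\<^esub> b))}"

definition loc_frac :: "('a, 'b) ring_scheme \<Rightarrow> 'a set \<Rightarrow> 'a \<Rightarrow> 'a \<Rightarrow> ('a \<times> 'a) set" where
  "loc_frac R U a s = loc_rel R U `` {(a, s)}"

text \<open>
  The unions range over all representatives; for a multiplicatively closed set \<open>U\<close> all the
  resulting classes coincide (see \<open>UN_equiv_class2\<close>).
\<close>

definition localization :: "('a, 'b) ring_scheme \<Rightarrow> 'a set \<Rightarrow> ('a \<times> 'a) set ring" where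
  "localization R U =
     \<lparr> carrier = (carrier R \<times> U) // loc_rel R U,
       monoid.mult = (\<lambda>p q. \<Union>(a, s) \<in> p. \<Union>(b, t) \<in> q. loc_frac R U (a \<otimes>\<^bsub>R\<^esub> b) (s \<otimes>\<^bsub>R\<^esub> t)),
       monoid.one = loc_frac R U \<one>\<^bsub>R\<^esub> \<one>\<^bsub>R\<^esub>,
       ring.zero = loc_frac R U \<zero>\<^bsub>R\<^esub> \<one>\<^bsub>R\<^esub>,
       ring.add = (\<lambda>p q. \<Union>(a, s) \<in> p. \<Union>(b, t) \<in> q.
               loc_frac R U (t \<otimes>\<^bsub>R\<^esub> a \<oplus>\<^bsub>R\<^esub> s \<otimes>\<^bsub>R\<^esub> b) (s \<otimes>\<^bsub>R\<^esub> t)) \<rparr>"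

abbreviation localize_at :: "('a, 'b) ring_scheme \<Rightarrow> 'a set \<Rightarrow> ('a \<times> 'a) set ring" where
  "localize_at R P \<equiv> localization R (carrier R - P)"

definition to_loc :: "('a, 'b) ring_scheme \<Rightarrow> 'a set \<Rightarrow> 'a \<Rightarrow> ('a \<times> 'a) set" where
  "to_loc R P r = loc_frac R (carrier R - P) r \<one>\<^bsub>R\<^esub>"

text \<open>The extension \<open>I R\<^sub>P\<close> and the contraction \<open>J \<inter> R\<close> along the canonical map.\<close>

definition extend_loc :: "('a, 'b) ring_scheme \<Rightarrow> 'a set \<Rightarrow> 'a set \<Rightarrow> ('a \<times> 'a) set set" where
  "extend_loc R P I = genideal (localize_at R P) (to_loc R P ` I)"

definition contract_loc :: "('a, 'b) ring_scheme \<Rightarrow> 'a set \<Rightarrow> ('a \<times> 'a) set set \<Rightarrow> 'a set" where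
  "contract_loc R P J = {r \<in> carrier R. to_loc R P r \<in> J}"


section \<open>Associated primes, symbolic powers, set-theoretic complete intersections\<close>

text \<open>\<open>assoc_primes R I\<close> is \<open>Ass(R/I)\<close>: the primes that are annihilators of some residue class
  \<open>x + I\<close>.\<close>

definition assoc_primes :: "('a, 'b) ring_scheme \<Rightarrow> 'a set \<Rightarrow> 'a set set" where
  "assoc_primes R I =
     {P. primeideal P R \<and> (\<exists>x \<in> carrier R. P = {r \<in> carrier R. r \<otimes>\<^bsub>R\<^esub> x \<in> I})}"

definition unmixed :: "('a, 'b) ring_scheme \<Rightarrow> 'a set \<Rightarrow> bool" where
  "unmixed R I \<longleftrightarrow>
     (\<forall>P \<in> assoc_primes R I. \<forall>Q \<in> assoc_primes R I. prime_height R P = prime_height R Q)"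

primrec ideal_power :: "('a, 'b) ring_scheme \<Rightarrow> 'a set \<Rightarrow> nat \<Rightarrow> 'a set" where
  "ideal_power R I 0 = carrier R"
| "ideal_power R I (Suc k) = ideal_prod R (ideal_power R I k) I"

text \<open>Intersecting with \<open>carrier R\<close> only matters if there are no associated primes.\<close>

definition symbolic_power :: "('a, 'b) ring_scheme \<Rightarrow> 'a set \<Rightarrow> nat \<Rightarrow> 'a set" where
  "symbolic_power R I k =
     carrier R \<inter> (\<Inter>P \<in> assoc_primes R I. contract_loc R P (extend_loc R P (ideal_power R I k)))"

definition symbolic_rees_algebra ::
    "('a, 'b) ring_scheme \<Rightarrow> 'a set \<Rightarrow> ('a, nat \<Rightarrow> 'a) up_ring" where
  "symbolic_rees_algebra R I =
     (UP R)\<lparr>carrier :=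
       {f \<in> carrier (UP R). \<forall>k. UnivPoly.coeff (UP R) f k \<in> symbolic_power R I k}\<rparr>"

definition ideal_radical :: "('a, 'b) ring_scheme \<Rightarrow> 'a set \<Rightarrow> 'a set" where
  "ideal_radical R I = {r \<in> carrier R. \<exists>k::nat. r [^]\<^bsub>R\<^esub> k \<in> I}"

definition set_theoretic_ci :: "('a, 'b) ring_scheme \<Rightarrow> 'a set \<Rightarrow> bool" where
  "set_theoretic_ci R I \<longleftrightarrow>
     local_ring R \<and>
     (\<exists>fs. set fs \<subseteq> the_max_ideal R \<and> ideal_height R I = enat (length fs) \<and>
        ideal_radical R I = ideal_radical R (genideal R (set fs)))"


section \<open>Polynomial rings and edge ideals\<close>

text \<open>
  A polynomial is a finitely supported map from exponent vectors \<open>nat \<Rightarrow>\<^sub>0 nat\<close> to coefficients;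
  \<open>poly_ring_upto n\<close> is the polynomial ring in the variables with indices \<open>1, \<dots>, n\<close>.
\<close>

definition poly_ring_upto :: "nat \<Rightarrow> ((nat \<Rightarrow>\<^sub>0 nat) \<Rightarrow>\<^sub>0 'k::field) ring" where
  "poly_ring_upto n =
     ring_of_type_algebra\<lparr>carrier := {p. \<forall>e \<in> Poly_Mapping.keys p. Poly_Mapping.keys e \<subseteq> {1..n}}\<rparr>"

definition mvar :: "nat \<Rightarrow> ((nat \<Rightarrow>\<^sub>0 nat) \<Rightarrow>\<^sub>0 'k::field)" where
  "mvar i = Poly_Mapping.single (Poly_Mapping.single i 1) 1"

definition vars_ideal :: "nat \<Rightarrow> ((nat \<Rightarrow>\<^sub>0 nat) \<Rightarrow>\<^sub>0 'k::field) set" where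
  "vars_ideal n = genideal (poly_ring_upto n) (mvar ` {1..n})"

definition complete_graph_edges :: "nat \<Rightarrow> nat set set" where
  "complete_graph_edges n = {{i, j} | i j. 1 \<le> i \<and> i < j \<and> j \<le> n}"

definition edge_ideal :: "nat \<Rightarrow> nat set set \<Rightarrow> ((nat \<Rightarrow>\<^sub>0 nat) \<Rightarrow>\<^sub>0 'k::field) set" where
  "edge_ideal n E =
     genideal (poly_ring_upto n) {mvar i * mvar j | i j. i < j \<and> {i, j} \<in> E}"

end

theory Submission
  imports Defs
begin

text \<open>
  Write \<open>S = k[x\<^sub>1, \<dots>, x\<^sub>n]\<close> and \<open>P\<^sub>A = (x\<^sub>j | j \<in> A)\<close>. The edge ideal of the complete graph is
  the ideal of the union of the coordinate axes: it is the intersection of the primes \<open>P\<^sub>A\<close> where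
  \<open>A\<close> omits a single index. The argument rests on one observation. The power \<open>P\<^sub>A\<^sup>k\<close>
  consists of the polynomials all of whose monomials have degree at least \<open>k\<close> in the variables from
  \<open>A\<close>, and the least such degree is additive under multiplication of polynomials, because in a
  product some monomial of the least possible degree survives (\<open>min_key_product\<close>). Hence \<open>P\<^sub>A\<^sup>k\<close> is \<open>P\<^sub>A\<close>-primary
  (\<open>coord_power_primary\<close>), and the \<open>k\<close>-th symbolic power of the edge ideal is the monomial ideal
  \<open>edge_symbolic n k\<close>, the intersection of the \<open>k\<close>-th powers of the primes of the axes. Nothing
  changes on localizing at the origin, since the primes concerned contain no polynomial with
  nonzero constant term (\<open>assoc_primes_edge_loc\<close>, \<open>symbolic_power_edge_loc\<close>).

  Unmixedness. All associated primes have height \<open>n - 1\<close> (\<open>height_axis_prime\<close>). Adjoining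
  one variable at a time gives chains of that length. They cannot be longer because \<open>n + 1\<close>
  polynomials in \<open>n\<close> variables are algebraically dependent, and reading a dependence relation from
  its lexicographically lowest term contradicts a chain of \<open>n + 2\<close> primes
  (\<open>no_long_prime_chain\<close>).

  Cohen-Macaulayness. A polynomial that does not vanish on the \<open>i\<close>-th axis is
  \<open>x\<^sub>i\<^sup>c h + q\<close> with \<open>h\<close> invertible at the origin and \<open>q\<close> vanishing on the axis
  (\<open>axis_decomposition\<close>). So a prime of the local ring that strictly contains the prime of an axis contains every
  variable, and the quotients have dimension one (\<open>no_three_primes\<close>). The sum of the variables
  vanishes on no axis, so it is a nonzerodivisor. Modulo any nonzerodivisor of such a quotient a power of
  the maximal ideal vanishes, so no regular sequence has length two (\<open>no_regular_pair\<close>).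

  The symbolic Rees algebra. Up to denominators it is the algebra of the monoid of all
  \<open>x\<^sup>e t\<^sup>k\<close> with \<open>x\<^sup>e\<close> in the \<open>k\<close>-th symbolic power. This monoid is cut out by finitely many
  linear inequalities, so Dickson's lemma holds for divisibility inside the monoid, and the usual
  argument with leading terms shows that its algebra is Noetherian (\<open>mon_ring_noetherian\<close>). A ring all of whose
  elements are, up to units, in the image of a Noetherian ring is itself Noetherian
  (\<open>noetherian_transfer\<close>).

  Set-theoretic complete intersection. The elementary symmetric polynomials
  \<open>e\<^sub>2, \<dots>, e\<^sub>n\<close> suffice. If \<open>x\<^sub>A\<close> is the product of the \<open>d\<close> variables from \<open>A\<close>, then
  \<open>x\<^sub>A e\<^sub>d\<close> is \<open>x\<^sub>A\<^sup>2\<close> plus multiples of products of more than \<open>d\<close> distinct variables, so descending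
  induction on \<open>d\<close> puts every \<open>x\<^sub>A\<close> with \<open>d \<ge> 2\<close> into the radical (\<open>xprod_in_rad\<close>).
\<close>

section \<open>Polynomials with exponents in a given set\<close>

type_synonym expo = "nat \<Rightarrow>\<^sub>0 nat"
type_synonym 'k mpoly = "expo \<Rightarrow>\<^sub>0 'k"

abbreviation supp :: "('a \<Rightarrow>\<^sub>0 'b::zero) \<Rightarrow> 'a set" where
  "supp \<equiv> Poly_Mapping.keys"

abbreviation cf :: "('a \<Rightarrow>\<^sub>0 'b::zero) \<Rightarrow> 'a \<Rightarrow> 'b" where
  "cf \<equiv> Poly_Mapping.lookup"

abbreviation mon :: "'a \<Rightarrow> 'b::zero \<Rightarrow> ('a \<Rightarrow>\<^sub>0 'b)" where
  "mon \<equiv> Poly_Mapping.single"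

definition poly_on :: "'a set \<Rightarrow> ('a \<Rightarrow>\<^sub>0 'b::zero) set" where
  "poly_on M = {p. supp p \<subseteq> M}"

lemma poly_onD: "p \<in> poly_on M \<Longrightarrow> e \<in> supp p \<Longrightarrow> e \<in> M"
  by (auto simp: poly_on_def)

lemma poly_on_mono: "M \<subseteq> N \<Longrightarrow> poly_on M \<subseteq> poly_on N"
  by (auto simp: poly_on_def)

lemma zero_in_poly_on [simp]: "0 \<in> poly_on M"
  by (simp add: poly_on_def)

lemma mon_in_poly_on: "e \<in> M \<Longrightarrow> mon e c \<in> poly_on M"
  by (simp add: poly_on_def)

lemma one_in_poly_on: "0 \<in> M \<Longrightarrow> (1 :: 'a::zero \<Rightarrow>\<^sub>0 'b::zero_neq_one) \<in> poly_on M"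
  by (simp add: poly_on_def)

lemma add_in_poly_on: "p \<in> poly_on M \<Longrightarrow> q \<in> poly_on M \<Longrightarrow> p + q \<in> poly_on M"
  using Poly_Mapping.keys_add[of p q] by (auto simp: poly_on_def)

lemma uminus_in_poly_on: "p \<in> poly_on M \<Longrightarrow> - p \<in> poly_on M"
  for p :: "'a \<Rightarrow>\<^sub>0 'b::ab_group_add"
  by (auto simp: poly_on_def in_keys_iff)

lemma sum_in_poly_on: "(\<And>i. i \<in> I \<Longrightarrow> f i \<in> poly_on M) \<Longrightarrow> sum f I \<in> poly_on M"
  by (induction I rule: infinite_finite_induct) (auto intro: add_in_poly_on)

lemma mult_in_poly_on:
  fixes p :: "'a::monoid_add \<Rightarrow>\<^sub>0 'b::semiring_0"
  assumes "p \<in> poly_on M" "q \<in> poly_on N" "\<And>e f. e \<in> M \<Longrightarrow> f \<in> N \<Longrightarrow> e + f \<in> L"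
  shows "p * q \<in> poly_on L"
  using Poly_Mapping.keys_mult[of p q] assms by (fastforce simp: poly_on_def)

lemma poly_eq_sum_monomials: "p = (\<Sum>e\<in>supp p. mon e (cf p e))"
proof (rule poly_mapping_eqI)
  fix f
  show "cf p f = cf (\<Sum>e\<in>supp p. mon e (cf p e)) f"
    by (simp add: lookup_sum lookup_single "when_def" in_keys_iff)
qed

lemma poly_on_induct [consumes 1, case_names zero add mon]:
  fixes p :: "'a \<Rightarrow>\<^sub>0 'b::comm_monoid_add"
  assumes p: "p \<in> poly_on M"
    and "P 0"
    and "\<And>p q. p \<in> poly_on M \<Longrightarrow> q \<in> poly_on M \<Longrightarrow> P p \<Longrightarrow> P q \<Longrightarrow> P (p + q)"
    and "\<And>e c. e \<in> M \<Longrightarrow> P (mon e c)"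
  shows "P p"
proof -
  have "P (\<Sum>e\<in>E. mon e (cf p e)) \<and> (\<Sum>e\<in>E. mon e (cf p e)) \<in> poly_on M"
    if "finite E" "E \<subseteq> supp p" for E
    using that
  proof (induction E)
    case empty
    then show ?case by (simp add: assms)
  next
    case (insert e E)
    then have "e \<in> M" using p by (auto simp: poly_on_def)
    then show ?case using insert assms
      by (auto intro!: add_in_poly_on mon_in_poly_on)
  qed
  from this[of "supp p"] show ?thesis
    using poly_eq_sum_monomials[of p] by simp
qed

text \<open>
  This is how a monomial of a product is shown to survive: if it arises from only one pair of
  monomials of the factors, then no cancellation can occur.
\<close>
lemma cf_mult_unique:
  fixes p q :: "'a::comm_monoid_add \<Rightarrow>\<^sub>0 'b::comm_semiring_0"
  assumes u: "\<And>e' f'. e' \<in> supp p \<Longrightarrow> f' \<in> supp q \<Longrightarrow> e' + f' = e + f \<Longrightarrow> e' = e \<and> f' = f"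
  shows "cf (p * q) (e + f) = cf p e * cf q f"
proof -
  have "p * q = (\<Sum>e'\<in>supp p. \<Sum>f'\<in>supp q. mon (e' + f') (cf p e' * cf q f'))"
    by (subst poly_eq_sum_monomials[of p], subst poly_eq_sum_monomials[of q])
      (simp add: sum_product mult_single)
  then have "cf (p * q) (e + f) =
      (\<Sum>e'\<in>supp p. \<Sum>f'\<in>supp q. if e' = e \<and> f' = f then cf p e' * cf q f' else 0)"
    by (auto simp: lookup_sum lookup_single "when_def" intro!: sum.cong dest: u)
  also have "\<dots> = (\<Sum>e'\<in>supp p. if e' = e then cf p e * cf q f else 0)"
    by (intro sum.cong refl) (auto simp: in_keys_iff)
  also have "\<dots> = cf p e * cf q f"
    by (auto simp: in_keys_iff)
  finally show ?thesis .
qed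

section \<open>Dickson's lemma and Noetherian monoid algebras\<close>

text \<open>
  Allowing arbitrary functions in place of the coordinates of \<open>\<nat>\<^sup>r\<close> makes the lemma apply at once to
  monoids cut out by linear inequalities, where the slacks of the inequalities serve as further
  coordinates.
\<close>
lemma dickson:
  fixes s :: "nat \<Rightarrow> 'a" and H :: "('a \<Rightarrow> nat) set"
  assumes "finite H"
  shows "\<exists>r :: nat \<Rightarrow> nat. strict_mono r \<and>
    (\<forall>h\<in>H. \<forall>i j. i \<le> j \<longrightarrow> h (s (r i)) \<le> h (s (r j)))"
  using assms
proof (induction H)
  case empty
  show ?case by (rule exI[of _ id]) (auto simp: strict_mono_def)
next
  case (insert h H)
  obtain r :: "nat \<Rightarrow> nat" where r: "strict_mono r" "\<And>h i j. h \<in> H \<Longrightarrow> i \<le> j \<Longrightarrow> h (s (r i)) \<le> h (s (r j))"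
    using insert.IH by blast
  obtain q where q: "strict_mono q" "monoseq (\<lambda>n. h (s (r (q n))))"
    using seq_monosub[of "\<lambda>n. h (s (r n))"] by auto
  define g where "g n = h (s (r (q n)))" for n
  obtain N where N: "\<And>i j. N \<le> i \<Longrightarrow> i \<le> j \<Longrightarrow> g i \<le> g j"
  proof (cases "\<forall>m. \<forall>n\<ge>m. g m \<le> g n")
    case True
    then show thesis by (intro that[of 0]) auto
  next
    case False
    then have dec: "\<And>m n. m \<le> n \<Longrightarrow> g n \<le> g m" using q(2) by (auto simp: monoseq_def g_def)
    \<comment> \<open>a decreasing sequence of naturals is eventually constant\<close>
    obtain N where "\<And>i. g N \<le> g i"
      using ex_has_least_nat[of "\<lambda>_. True" 0 g] by auto
    then show thesis using dec by (intro that[of N]) (meson order.trans)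
  qed
  show ?case
  proof (intro exI conjI ballI allI impI)
    show "strict_mono (\<lambda>n. r (q (N + n)))"
      using r(1) q(1) by (auto simp: strict_mono_def)
    show "h' (s (r (q (N + i)))) \<le> h' (s (r (q (N + j))))" if "h' \<in> insert h H" "i \<le> j" for h' i j
    proof (cases "h' = h")
      case True
      then show ?thesis using N[of "N + i" "N + j"] that by (simp add: g_def)
    next
      case False
      moreover have "q (N + i) \<le> q (N + j)" using q(1) that by (simp add: strict_mono_less_eq)
      ultimately show ?thesis using r(2) that by auto
    qed
  qed
qed

text \<open>
  The quotient \<open>d\<close> is required to lie in \<open>M\<close>, so the order in question is divisibility inside the
  monoid, which is in general stronger than the componentwise comparison of exponents.
\<close>
definition dickson_monoid :: "'a::monoid_add set \<Rightarrow> bool" where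
  "dickson_monoid M \<longleftrightarrow> 0 \<in> M \<and> (\<forall>e\<in>M. \<forall>f\<in>M. e + f \<in> M) \<and>
     (\<forall>s::nat \<Rightarrow> 'a. range s \<subseteq> M \<longrightarrow> (\<exists>i j. i < j \<and> (\<exists>d\<in>M. s j = s i + d)))"

lemma dickson_monoid_finite_basis:
  assumes M: "dickson_monoid M" and L: "L \<subseteq> M"
  shows "\<exists>B. finite B \<and> B \<subseteq> L \<and> (\<forall>e\<in>L. \<exists>b\<in>B. \<exists>d\<in>M. e = b + d)"
proof (rule ccontr)
  assume contr: "\<not> ?thesis"
  have none: "\<exists>e\<in>L. \<forall>b\<in>B. \<forall>d\<in>M. e \<noteq> b + d" if "finite B" "B \<subseteq> L" for B
    using contr that by auto
  have "\<exists>s. \<forall>n::nat. s n \<in> L \<and> (\<forall>i<n. \<forall>d\<in>M. s n \<noteq> s i + d)"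
  proof (rule dependent_wellorder_choice)
    fix r :: "nat \<Rightarrow> 'a" and n
    assume "\<And>y. y < n \<Longrightarrow> r y \<in> L \<and> (\<forall>i<y. \<forall>d\<in>M. r y \<noteq> r i + d)"
    then show "\<exists>x. x \<in> L \<and> (\<forall>i<n. \<forall>d\<in>M. x \<noteq> r i + d)"
      using none[of "r ` {..<n}"] by blast
  qed auto
  then obtain s :: "nat \<Rightarrow> 'a" where s: "\<And>n. s n \<in> L" "\<And>n i d. i < n \<Longrightarrow> d \<in> M \<Longrightarrow> s n \<noteq> s i + d"
    by blast
  then have "range s \<subseteq> M" using L by auto
  then show False using M s(2) unfolding dickson_monoid_def by blast
qed

text \<open>
  The lexicographic order on all exponents is not well-founded, since there are infinitely many
  variables. On \<open>M\<close> it is, because it extends divisibility.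
\<close>
lemma dickson_monoid_wf:
  fixes M :: "expo set"
  assumes M: "dickson_monoid M"
  shows "wf {(e, f). e \<in> M \<and> f \<in> M \<and> e < f}"
  unfolding wf_iff_no_infinite_down_chain
proof
  assume "\<exists>s. \<forall>i. (s (Suc i), s i) \<in> {(e, f). e \<in> M \<and> f \<in> M \<and> e < f}"
  then obtain s where s: "\<And>i. s i \<in> M" "\<And>i. s (Suc i) < s i" by blast
  obtain i j d where "i < j" "s j = s i + d" 
    using M s(1) unfolding dickson_monoid_def by blast
  moreover have "s j < s i" using \<open>i < j\<close> s(2) lift_Suc_mono_less[of "\<lambda>i. s i"]
    by (induction j) (auto simp: less_Suc_eq intro: order.strict_trans)
  moreover have "0 \<le> d"
    by transfer (auto simp: less_fun_def fun_eq_iff, metis gr0I wellorder_Least_lemma not_less_Least)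
  ultimately show False using add_left_mono[of 0 d "s i"] by simp
qed

text \<open>For a submonoid \<open>M\<close> this is the monoid algebra of \<open>M\<close>.\<close>
definition mon_ring :: "'a set \<Rightarrow> ('a::comm_monoid_add \<Rightarrow>\<^sub>0 'k::field) ring" where
  "mon_ring M = ring_of_type_algebra\<lparr>carrier := poly_on M\<rparr>"

lemma mon_ring_simps [simp]:
  "carrier (mon_ring M) = poly_on M"
  "p \<otimes>\<^bsub>mon_ring M\<^esub> q = p * q"
  "p \<oplus>\<^bsub>mon_ring M\<^esub> q = p + q"
  "\<one>\<^bsub>mon_ring M\<^esub> = 1"
  "\<zero>\<^bsub>mon_ring M\<^esub> = 0"
  by (simp_all add: mon_ring_def ring_of_type_algebra_def)

lemma mon_ring_cring:
  assumes "0 \<in> M" "\<And>e f. e \<in> M \<Longrightarrow> f \<in> M \<Longrightarrow> e + f \<in> M"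
  shows "cring (mon_ring M)"
proof (intro cringI abelian_groupI comm_monoidI)
  show "\<exists>y\<in>carrier (mon_ring M). y \<oplus>\<^bsub>mon_ring M\<^esub> x = \<zero>\<^bsub>mon_ring M\<^esub>"
    if "x \<in> carrier (mon_ring M)" for x
    using that by (intro bexI[of _ "- x"]) (auto intro: uminus_in_poly_on)
qed (auto simp: algebra_simps intro!: add_in_poly_on mult_in_poly_on one_in_poly_on assms)

lemma mon_ring_a_inv [simp]:
  fixes p :: "'a::comm_monoid_add \<Rightarrow>\<^sub>0 'k::field"
  assumes "cring (mon_ring M :: ('a \<Rightarrow>\<^sub>0 'k) ring)" "p \<in> poly_on M"
  shows "\<ominus>\<^bsub>mon_ring M\<^esub> p = - p"
proof -
  interpret cring "mon_ring M :: ('a \<Rightarrow>\<^sub>0 'k) ring" by fact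
  show ?thesis using minus_equality[of "- p" p] assms(2) uminus_in_poly_on[of p M] by auto
qed

text \<open>
  Hilbert's basis theorem by leading terms: finitely many leading exponents of an ideal divide all
  the others, and polynomials with these leading exponents generate the ideal, because subtracting a
  multiple of one of them lowers the leading exponent of any other element.
\<close>
lemma mon_ring_noetherian:
  fixes M :: "expo set"
  assumes M: "dickson_monoid M"
  shows "noetherian_ring (mon_ring M :: ('k::field) mpoly ring)"
proof -
  let ?K = "mon_ring M :: 'k mpoly ring"
  have M0: "0 \<in> M" and Ma: "\<And>e f. e \<in> M \<Longrightarrow> f \<in> M \<Longrightarrow> e + f \<in> M"
    using M by (auto simp: dickson_monoid_def)
  interpret cring ?K by (rule mon_ring_cring) (auto simp: M0 Ma)
  show ?thesis
  proof (intro noetherian_ring.intro noetherian_ring_axioms.intro)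
    show "ring ?K" by (rule ring_axioms)
    fix J assume J: "ideal J ?K"
    interpret J: ideal J ?K by fact
    have JM: "p \<in> J \<Longrightarrow> p \<in> poly_on M" for p using J.Icarr[of p] by simp
    define lead :: "'k mpoly \<Rightarrow> expo" where "lead p = Max (supp p)" for p
    have lead_in: "lead p \<in> supp p" and lead_le: "e \<in> supp p \<Longrightarrow> e \<le> lead p" if "p \<noteq> 0" for p e
      using that by (auto simp: lead_def)
    have "lead ` (J - {0}) \<subseteq> M" using lead_in JM by (auto dest: poly_onD)
    then obtain B where B: "finite B" "B \<subseteq> lead ` (J - {0})"
      "\<And>e. e \<in> lead ` (J - {0}) \<Longrightarrow> \<exists>b\<in>B. \<exists>d\<in>M. e = b + d"
      using dickson_monoid_finite_basis[OF M] by (metis (no_types, lifting))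
    obtain G where G: "finite G" "G \<subseteq> J - {0}" "B = lead ` G"
      using finite_subset_image[OF B(1,2)] by blast
    have Gc: "G \<subseteq> carrier ?K" using G JM by auto
    interpret G: ideal "Idl\<^bsub>?K\<^esub> G" ?K by (rule genideal_ideal[OF Gc])
    have "p \<in> Idl\<^bsub>?K\<^esub> G" if "p \<in> J" "p \<noteq> 0" for p
      using that
    proof (induction "lead p" arbitrary: p rule: wf_induct_rule[OF dickson_monoid_wf[OF M]])
      case (1 p)
      obtain g d where g: "g \<in> G" "d \<in> M" "lead p = lead g + d"
        using B(3) G(3) 1(2,3) by blast
      have g0: "g \<noteq> 0" and gJ: "g \<in> J" using g G by auto
      \<comment> \<open>the multiple of \<open>g\<close> that cancels the leading term of \<open>p\<close>\<close>
      define m where "m = mon d (cf p (lead p) / cf g (lead g))"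
      have m: "m \<in> poly_on M" using g by (auto simp: m_def intro: mon_in_poly_on)
      have mg: "m * g \<in> Idl\<^bsub>?K\<^esub> G"
        using G.I_l_closed[of g m] genideal_self[OF Gc] g(1) m by auto
      have mgJ: "m * g \<in> J" using J.I_l_closed[OF gJ, of m] m by simp
      define r where "r = p - m * g"
      have rJ: "r \<in> J"
        using J.a_closed[OF 1(2) J.a_inv_closed[OF mgJ]] mgJ JM is_cring by (simp add: r_def)
      have keysmg: "e \<le> lead p" if "e \<in> supp (m * g)" for e
      proof -
        obtain e' f' where "e' \<in> supp m" "f' \<in> supp g" "e = e' + f'"
          using Poly_Mapping.keys_mult[of m g] \<open>e \<in> supp (m * g)\<close> by auto
        then have "e = d + f'" "f' \<le> lead g" using g0 lead_le by (auto simp: m_def split: if_splits)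
        then show ?thesis using g(3) add_left_mono[of f' "lead g" d] by (simp add: add.commute)
      qed
      have r_keys: "e < lead p" if "e \<in> supp r" for e
      proof -
        have "e \<in> supp p \<or> e \<in> supp (m * g)"
          using that Poly_Mapping.keys_diff[of p "m * g"] by (auto simp: r_def)
        then have "e \<le> lead p" using keysmg lead_le 1(3) by auto
        moreover have "cf r (lead p) = 0"
        proof -
          have "cf (m * g) (d + lead g) = cf m d * cf g (lead g)"
            by (rule cf_mult_unique) (auto simp: m_def split: if_splits)
          then have "cf (m * g) (lead p) = cf p (lead p)"
            using g(3) lead_in[OF g0] by (simp add: m_def add.commute in_keys_iff)
          then show ?thesis by (simp add: r_def lookup_minus)
        qed
        ultimately show ?thesis using that by (auto simp: in_keys_iff less_le)
      qed
      have "r \<in> Idl\<^bsub>?K\<^esub> G"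
      proof (cases "r = 0")
        case True
        then show ?thesis using G.zero_closed by simp
      next
        case False
        then have "lead r < lead p" "lead r \<in> M" "lead p \<in> M"
          using r_keys lead_in JM rJ 1(2,3) by (auto dest: poly_onD)
        then show ?thesis using 1(1) rJ False by auto
      qed
      then have "r \<oplus>\<^bsub>?K\<^esub> (m * g) \<in> Idl\<^bsub>?K\<^esub> G" using mg by (intro G.a_closed)
      then show ?case by (simp add: r_def)
    qed
    then have "J \<subseteq> Idl\<^bsub>?K\<^esub> G" using G.zero_closed by auto
    moreover have "Idl\<^bsub>?K\<^esub> G \<subseteq> J" using genideal_minimal[OF J] G(2) by auto
    ultimately show "\<exists>A\<subseteq>carrier ?K. finite A \<and> J = Idl\<^bsub>?K\<^esub> A"
      using G(1) Gc by blast
  qed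
qed

section \<open>The polynomial ring and the powers of its coordinate primes\<close>

definition expos :: "nat \<Rightarrow> expo set" where
  "expos n = {e. supp e \<subseteq> {1..n}}"

definition weight :: "nat set \<Rightarrow> expo \<Rightarrow> nat" where
  "weight A e = (\<Sum>j\<in>A. cf e j)"

lemma weight_add: "weight A (e + f) = weight A e + weight A f"
  by (simp add: weight_def lookup_add sum.distrib)

lemma weight_zero [simp]: "weight A 0 = 0"
  by (simp add: weight_def)

lemma weight_single: "finite A \<Longrightarrow> weight A (mon i c) = (if i \<in> A then c else 0)"
  by (simp add: weight_def lookup_single "when_def")

lemma zero_in_expos [simp]: "0 \<in> expos n"
  by (simp add: expos_def)

lemma add_in_expos: "e \<in> expos n \<Longrightarrow> f \<in> expos n \<Longrightarrow> e + f \<in> expos n"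
  using Poly_Mapping.keys_add[of e f] by (auto simp: expos_def)

lemma single_in_expos: "i \<in> {1..n} \<Longrightarrow> mon i c \<in> expos n"
  by (auto simp: expos_def)

lemma add_in_expos_iff: "e + f \<in> expos n \<longleftrightarrow> e \<in> expos n \<and> f \<in> expos n"
proof
  assume "e + f \<in> expos n"
  then show "e \<in> expos n \<and> f \<in> expos n"
    by (auto simp: expos_def in_keys_iff lookup_add subset_iff)
qed (auto intro: add_in_expos)

lemma poly_ring_upto_eq: "poly_ring_upto n = (mon_ring (expos n) :: ('k::field) mpoly ring)"
  by (simp add: poly_ring_upto_def mon_ring_def poly_on_def expos_def subset_iff Ball_def)

abbreviation polys :: "nat \<Rightarrow> ('k::field) mpoly set" where
  "polys n \<equiv> poly_on (expos n)"

lemma poly_ring_cring: "cring (mon_ring (expos n) :: ('k::field) mpoly ring)"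
  by (rule mon_ring_cring) (auto intro: add_in_expos)

lemma polys_mult: "p \<in> polys n \<Longrightarrow> q \<in> polys n \<Longrightarrow> p * q \<in> polys n"
  by (rule mult_in_poly_on) (auto intro: add_in_expos)

lemma polys_one [simp]: "1 \<in> polys n"
  by (rule one_in_poly_on) simp

lemma polys_power: "p \<in> polys n \<Longrightarrow> p ^ m \<in> polys n"
  by (induction m) (auto intro: polys_mult)

lemma polys_prod: "(\<And>i. i \<in> I \<Longrightarrow> f i \<in> polys n) \<Longrightarrow> prod f I \<in> polys n"
  by (induction I rule: infinite_finite_induct) (auto intro: polys_mult)

text \<open>
  In the applications \<open>H\<close> consists of the coordinates and of the slacks of the inequalities that
  define the monoid.
\<close>
lemma dickson_monoidI:
  assumes "finite H" "0 \<in> M" "\<And>e f. e \<in> M \<Longrightarrow> f \<in> M \<Longrightarrow> e + f \<in> M"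
    and diff: "\<And>e f. e \<in> M \<Longrightarrow> f \<in> M \<Longrightarrow> (\<And>h. h \<in> H \<Longrightarrow> (h e :: nat) \<le> h f) \<Longrightarrow> \<exists>d\<in>M. f = e + d"
  shows "dickson_monoid M"
  unfolding dickson_monoid_def
proof (intro conjI ballI allI impI)
  fix s :: "nat \<Rightarrow> 'a" assume s: "range s \<subseteq> M"
  obtain r :: "nat \<Rightarrow> nat" where r: "strict_mono r" "\<And>h i j. h \<in> H \<Longrightarrow> i \<le> j \<Longrightarrow> h (s (r i)) \<le> h (s (r j))"
    using dickson[OF assms(1), of s] by blast
  have "\<exists>d\<in>M. s (r 1) = s (r 0) + d" using s r(2) by (intro diff) auto
  moreover have "r 0 < r 1" using r(1) by (simp add: strict_mono_def)
  ultimately show "\<exists>i j. i < j \<and> (\<exists>d\<in>M. s j = s i + d)" by blast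
qed (use assms in auto)

lemma expo_diff: "(\<And>i. cf e i \<le> cf f i) \<Longrightarrow> f = e + (f - e)" for e f :: expo
  by (rule poly_mapping_eqI) (simp add: lookup_add lookup_minus)

lemma dickson_monoid_expos: "dickson_monoid (expos n)"
proof (rule dickson_monoidI[where H = "(\<lambda>j e. cf e j) ` {1..n}"])
  fix e f assume ef: "e \<in> expos n" "f \<in> expos n"
    and le: "\<And>h. h \<in> (\<lambda>j e. cf e j) ` {1..n} \<Longrightarrow> h e \<le> h f"
  have "cf e i \<le> cf f i" for i
  proof (cases "i \<in> {1..n}")
    case True
    then show ?thesis by (intro le) (rule imageI)
  next
    case False
    then have "i \<notin> supp e" using ef unfolding expos_def by blast
    then show ?thesis by (simp add: in_keys_iff)
  qed
  then have "f = e + (f - e)" by (rule expo_diff)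
  then show "\<exists>d\<in>expos n. f = e + d" using ef add_in_expos_iff by metis
qed (auto intro: add_in_expos)

text \<open>
  The index 0, which is not used by the polynomial ring, stands for the variable \<open>t\<close> of the Rees
  algebra. The inequalities say that \<open>x\<^sup>e\<close> lies in the \<open>k\<close>-th power of the prime of each axis, where
  \<open>k\<close> is the exponent of \<open>t\<close>.
\<close>
definition rees_expos :: "nat \<Rightarrow> expo set" where
  "rees_expos n = {e. supp e \<subseteq> {0..n} \<and> (\<forall>i\<in>{1..n}. cf e 0 \<le> weight ({1..n} - {i}) e)}"

lemma dickson_monoid_rees: "dickson_monoid (rees_expos n)"
proof (rule dickson_monoidI[where H = "(\<lambda>j e. cf e j) ` {0..n} \<union> (\<lambda>i e. weight ({1..n} - {i}) e - cf e 0) ` {1..n}"])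
  fix e f assume ef: "e \<in> rees_expos n" "f \<in> rees_expos n"
    and le: "\<And>h. h \<in> (\<lambda>j e. cf e j) ` {0..n} \<union> (\<lambda>i e. weight ({1..n} - {i}) e - cf e 0) ` {1..n} \<Longrightarrow> h e \<le> h f"
  have *: "cf e i \<le> cf f i" for i
  proof (cases "i \<in> {0..n}")
    case True
    then show ?thesis by (intro le UnI1) (rule imageI)
  next
    case False
    then have "i \<notin> supp e" using ef unfolding rees_expos_def by blast
    then show ?thesis by (simp add: in_keys_iff)
  qed
  define d where "d = f - e"
  have d: "f = e + d" using expo_diff[OF *] by (simp add: d_def)
  have "supp d \<subseteq> {0..n}"
    using ef by (auto simp: d_def rees_expos_def in_keys_iff lookup_minus subset_iff)
  moreover have "cf d 0 \<le> weight ({1..n} - {i}) d" if "i \<in> {1..n}" for i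
  proof -
    have "weight ({1..n} - {i}) e - cf e 0 \<le> weight ({1..n} - {i}) f - cf f 0"
      by (rule le[of "\<lambda>e. weight ({1..n} - {i}) e - cf e 0"], rule UnI2, rule imageI, fact)
    moreover have "cf e 0 \<le> weight ({1..n} - {i}) e" "cf f 0 \<le> weight ({1..n} - {i}) f"
      using ef that by (auto simp: rees_expos_def)
    ultimately show ?thesis unfolding d by (simp add: weight_add lookup_add)
  qed
  ultimately show "\<exists>d\<in>rees_expos n. f = e + d" using d by (auto simp: rees_expos_def)
next
  fix e f assume "e \<in> rees_expos n" "f \<in> rees_expos n"
  then show "e + f \<in> rees_expos n"
    using Poly_Mapping.keys_add[of e f]
    by (auto simp: rees_expos_def weight_add lookup_add intro!: add_mono)
qed (auto simp: rees_expos_def)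

text \<open>
  The \<open>k\<close>-th power of the prime ideal \<open>(x\<^sub>j | j \<in> A)\<close>, described by its monomials. In this form
  membership can be read off the support, and it makes sense for \<open>k = 0\<close> as well.
\<close>
definition coord_power :: "nat \<Rightarrow> nat set \<Rightarrow> nat \<Rightarrow> ('k::field) mpoly set" where
  "coord_power n A k = poly_on {e \<in> expos n. k \<le> weight A e}"

lemma coord_power_subset: "coord_power n A k \<subseteq> polys n"
  unfolding coord_power_def by (rule poly_on_mono) auto

lemma coord_power_0: "coord_power n A 0 = polys n"
  by (simp add: coord_power_def)

lemma coord_power_mult: "p \<in> coord_power n A k \<Longrightarrow> q \<in> coord_power n A l \<Longrightarrow> p * q \<in> coord_power n A (k + l)"
  unfolding coord_power_def by (erule (1) mult_in_poly_on) (auto simp: weight_add intro: add_in_expos)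

lemma coord_power_mult_polys: "p \<in> coord_power n A k \<Longrightarrow> q \<in> polys n \<Longrightarrow> p * q \<in> coord_power n A k"
  using coord_power_mult[of p n A k q 0] by (simp add: coord_power_0)

lemma coord_power_power: "p \<in> coord_power n A 1 \<Longrightarrow> p ^ k \<in> coord_power n A k"
proof (induction k)
  case 0
  then show ?case by (simp add: coord_power_0)
next
  case (Suc k)
  then show ?case using coord_power_mult[of p n A 1 "p ^ k" k] by simp
qed

text \<open>
  Ideals of the polynomial ring in terms of the operations of the type, where the ring methods and
  the binomial theorem are available.
\<close>
lemma poly_ideal_iff:
  "ideal J (mon_ring (expos n)) \<longleftrightarrow>
    J \<subseteq> polys n \<and> 0 \<in> J \<and> (\<forall>p\<in>J. \<forall>q\<in>J. p + q \<in> J) \<and> (\<forall>p\<in>J. \<forall>q\<in>polys n. p * q \<in> J)"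
  (is "_ \<longleftrightarrow> ?R") for J :: "('k::field) mpoly set"
proof
  interpret cring "mon_ring (expos n) :: 'k mpoly ring" by (rule poly_ring_cring)
  show ?R if "ideal J (mon_ring (expos n))"
  proof -
    interpret ideal J "mon_ring (expos n)" by fact
    show ?thesis using zero_closed a_closed I_r_closed Icarr by auto
  qed
  show "ideal J (mon_ring (expos n))" if R: ?R
  proof (rule idealI)
    show "subgroup J (add_monoid (mon_ring (expos n)))"
    proof (rule add.subgroupI)
      fix p assume p: "p \<in> J"
      have "p * (- 1) \<in> J" using R p uminus_in_poly_on[OF polys_one] by blast
      then show "\<ominus>\<^bsub>mon_ring (expos n)\<^esub> p \<in> J"
        using mon_ring_a_inv[OF poly_ring_cring, of p n] p R by auto
    qed (use R in auto)
  qed (use R ring_axioms in \<open>auto simp: mult.commute\<close>)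
qed

lemma coord_power_ideal: "ideal (coord_power n A k) (mon_ring (expos n))"
  unfolding poly_ideal_iff using coord_power_subset coord_power_mult_polys
  by (auto simp: coord_power_def intro: add_in_poly_on)

lemma poly_ideal_diff:
  assumes "ideal J (mon_ring (expos n))" "p \<in> J" "q \<in> J"
  shows "p - q \<in> J"
proof -
  have "p + q * (- 1) \<in> J"
    using assms uminus_in_poly_on[OF polys_one] unfolding poly_ideal_iff by blast
  then show ?thesis by simp
qed

lemma poly_ideal_uminus:
  assumes "ideal J (mon_ring (expos n))" "p \<in> J"
  shows "- p \<in> J"
  using poly_ideal_diff[OF assms(1) _ assms(2), of 0] assms(1) unfolding poly_ideal_iff by auto

lemma poly_ideal_sum:
  assumes "ideal J (mon_ring (expos n))" "\<And>i. i \<in> I \<Longrightarrow> f i \<in> J"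
  shows "sum f I \<in> J"
  using assms(2) assms(1)[unfolded poly_ideal_iff]
  by (induction I rule: infinite_finite_induct) auto

lemma exists_min_key:
  assumes "p \<noteq> 0"
  shows "\<exists>e\<in>supp p. \<forall>e'\<in>supp p. weight A e < weight A e' \<or> weight A e = weight A e' \<and> e \<le> e'"
proof -
  define m where "m = Min (weight A ` supp p)"
  define E where "E = {e \<in> supp p. weight A e = m}"
  have ne: "supp p \<noteq> {}" using assms by simp
  have "m \<in> weight A ` supp p" unfolding m_def by (rule Min_in) (use ne in auto)
  then have "E \<noteq> {}" "finite E" by (auto simp: E_def)
  then have "Min E \<in> E" "\<And>e. e \<in> E \<Longrightarrow> Min E \<le> e" by auto
  moreover have "m \<le> weight A e" if "e \<in> supp p" for e using that by (simp add: m_def)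
  ultimately show ?thesis by (intro bexI[of _ "Min E"]) (auto simp: E_def le_less)
qed

text \<open>
  The weight is not a total order on monomials, so several monomials of a factor may have minimal
  weight. Breaking ties by the lexicographic order singles out one of them in each factor, and their product cannot cancel.
\<close>
lemma min_key_product:
  fixes p q :: "('k::field) mpoly"
  assumes "p \<noteq> 0" "q \<noteq> 0"
  obtains e f where "e \<in> supp p" "f \<in> supp q" "e + f \<in> supp (p * q)"
    "\<And>e'. e' \<in> supp p \<Longrightarrow> weight A e \<le> weight A e'" "\<And>f'. f' \<in> supp q \<Longrightarrow> weight A f \<le> weight A f'"
proof -
  obtain e where e: "e \<in> supp p" "\<And>e'. e' \<in> supp p \<Longrightarrow> weight A e < weight A e' \<or> weight A e = weight A e' \<and> e \<le> e'"
    using exists_min_key[OF assms(1)] by blast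
  obtain f where f: "f \<in> supp q" "\<And>e'. e' \<in> supp q \<Longrightarrow> weight A f < weight A e' \<or> weight A f = weight A e' \<and> f \<le> e'"
    using exists_min_key[OF assms(2)] by blast
  have "cf (p * q) (e + f) = cf p e * cf q f"
  proof (rule cf_mult_unique)
    fix e' f' assume *: "e' \<in> supp p" "f' \<in> supp q" "e' + f' = e + f"
    have "weight A e' + weight A f' = weight A e + weight A f" using *(3) by (metis weight_add)
    then have "e \<le> e'" "f \<le> f'" using e(2)[OF *(1)] f(2)[OF *(2)] by auto
    then show "e' = e \<and> f' = f" using *(3)
      by (metis add_le_cancel_right add_left_cancel add_mono antisym add_right_cancel add_le_cancel_left)
  qed
  then have "e + f \<in> supp (p * q)" using e(1) f(1) by (simp add: in_keys_iff)
  moreover have "weight A e \<le> weight A e'" if "e' \<in> supp p" for e' using e(2)[OF that] by auto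
  moreover have "weight A f \<le> weight A f'" if "f' \<in> supp q" for f' using f(2)[OF that] by auto
  ultimately show thesis using that e(1) f(1) by blast
qed

text \<open>
  The weight of the lowest monomials is additive, and it is 0 for \<open>s\<close>. So multiplication by \<open>s\<close>
  does not raise the least weight of \<open>r\<close>.
\<close>
lemma coord_power_primary:
  assumes s: "s \<in> polys n" "s \<notin> coord_power n A 1" and r: "r \<in> polys n" and sr: "s * r \<in> coord_power n A k"
  shows "r \<in> coord_power n A k"
proof (rule ccontr)
  assume r': "r \<notin> coord_power n A k"
  then have "r \<noteq> 0" "s \<noteq> 0" using s by (auto simp: coord_power_def)
  then obtain e f where ef: "e \<in> supp s" "f \<in> supp r" "e + f \<in> supp (s * r)"
    "\<And>e'. e' \<in> supp s \<Longrightarrow> weight A e \<le> weight A e'" "\<And>f'. f' \<in> supp r \<Longrightarrow> weight A f \<le> weight A f'"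
    using min_key_product[of s r A] by metis
  obtain e' where e': "e' \<in> supp s" "weight A e' = 0"
    using s by (fastforce simp: coord_power_def poly_on_def Suc_le_eq)
  obtain f' where f': "f' \<in> supp r" "weight A f' < k"
    using r r' by (fastforce simp: coord_power_def poly_on_def not_le[symmetric])
  have "weight A (e + f) < k" using ef(4)[OF e'(1)] ef(5)[OF f'(1)] e' f' by (simp add: weight_add)
  then show False using sr ef(3) by (auto simp: coord_power_def poly_on_def)
qed

lemma one_notin_coord_power: "k > 0 \<Longrightarrow> (1 :: ('k::field) mpoly) \<notin> coord_power n A k"
  by (auto simp: coord_power_def poly_on_def)

lemma coord_power_prime: "primeideal (coord_power n A 1) (mon_ring (expos n) :: ('k::field) mpoly ring)"
proof (rule primeidealI)
  show "carrier (mon_ring (expos n)) \<noteq> (coord_power n A 1 :: 'k mpoly set)"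
    using one_notin_coord_power[of 1 n A] polys_one[of n] by auto
  show "a \<in> coord_power n A 1 \<or> b \<in> coord_power n A 1"
    if "a \<in> carrier (mon_ring (expos n))" "b \<in> carrier (mon_ring (expos n))"
      "a \<otimes>\<^bsub>mon_ring (expos n)\<^esub> b \<in> coord_power n A 1" for a b :: "'k mpoly"
    using that coord_power_primary[of a n A b 1] by auto
qed (use coord_power_ideal poly_ring_cring in auto)

lemma mvar_power: "mvar i ^ c = mon (mon i c) 1"
  by (induction c) (auto simp: mvar_def mult_single simp flip: single_add)

lemma mvar_in: "i \<in> {1..n} \<Longrightarrow> mvar i \<in> polys n"
  by (auto simp: mvar_def intro!: mon_in_poly_on single_in_expos)

lemma mvar_power_in_coord_power:
  assumes "i \<in> {1..n}" "finite A"
  shows "mvar i ^ c \<in> coord_power n A k \<longleftrightarrow> k \<le> (if i \<in> A then c else 0)"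
  using assms by (auto simp: mvar_power coord_power_def poly_on_def weight_single single_in_expos)

lemma mvar_in_coord_power:
  assumes "i \<in> {1..n}" "finite A"
  shows "(mvar i :: ('k::field) mpoly) \<in> coord_power n A 1 \<longleftrightarrow> i \<in> A"
  using mvar_power_in_coord_power[OF assms, of 1 1] by (simp split: if_splits)

text \<open>
  Restricted to the \<open>i\<close>-th axis, \<open>p\<close> becomes a nonzero polynomial in \<open>x\<^sub>i\<close> alone. Splitting off its
  order of vanishing at the origin leaves a factor \<open>h\<close> with nonzero constant term. This says that the
  local ring of the axis at the origin is a discrete valuation ring.
\<close>
lemma axis_decomposition:
  fixes p :: "('k::field) mpoly"
  assumes p: "p \<in> polys n" "p \<notin> coord_power n ({1..n} - {i}) 1" and i: "i \<in> {1..n}"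
  obtains c h q where "p = mvar i ^ c * h + q" "h \<in> polys n" "cf h 0 \<noteq> 0" "q \<in> coord_power n ({1..n} - {i}) 1"
proof -
  define E where "E = {e \<in> supp p. weight ({1..n} - {i}) e = 0}"
  have E: "e = mon i (cf e i)" if "e \<in> E" for e
  proof (rule poly_mapping_eqI)
    fix j
    show "cf e j = cf (mon i (cf e i)) j"
      using that p(1) by (cases "j \<in> {1..n}")
        (auto simp: E_def weight_def lookup_single "when_def" poly_on_def expos_def in_keys_iff subset_iff)
  qed
  have "E \<noteq> {}" using p by (auto simp: E_def coord_power_def poly_on_def)
  moreover have "finite E" by (simp add: E_def)
  ultimately obtain e0 where e0: "e0 \<in> E" "\<And>e. e \<in> E \<Longrightarrow> cf e0 i \<le> cf e i"
    using arg_min_if_finite[of E "\<lambda>e. cf e i"] by (metis not_le)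
  \<comment> \<open>the order of vanishing at the origin of the restriction of \<open>p\<close> to the axis\<close>
  define c where "c = cf e0 i"
  define h where "h = (\<Sum>e\<in>E. mon (mon i (cf e i - c)) (cf p e))"
  have 1: "mvar i ^ c * h = (\<Sum>e\<in>E. mon e (cf p e))"
    unfolding h_def sum_distrib_left mvar_power mult_single
    using e0(2) E by (intro sum.cong refl) (auto simp: c_def simp flip: single_add)
  have "p = (\<Sum>e\<in>supp p. mon e (cf p e))" by (rule poly_eq_sum_monomials)
  also have "\<dots> = (\<Sum>e\<in>E. mon e (cf p e)) + (\<Sum>e\<in>supp p - E. mon e (cf p e))"
    by (subst add.commute, rule sum.subset_diff) (auto simp: E_def)
  finally have "p = mvar i ^ c * h + (\<Sum>e\<in>supp p - E. mon e (cf p e))" using 1 by simp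
  moreover have "(\<Sum>e\<in>supp p - E. mon e (cf p e)) \<in> coord_power n ({1..n} - {i}) 1"
    unfolding coord_power_def using p(1) by (intro sum_in_poly_on mon_in_poly_on) (auto simp: E_def poly_on_def)
  moreover have "h \<in> polys n"
    unfolding h_def using i by (intro sum_in_poly_on mon_in_poly_on single_in_expos)
  moreover have "cf h 0 = cf p e0"
  proof -
    have "cf h 0 = (\<Sum>e\<in>E. if e = e0 then cf p e0 else 0)"
      unfolding h_def lookup_sum
    proof (intro sum.cong refl)
      fix e assume e: "e \<in> E"
      have "mon i (cf e i - c) = 0 \<longleftrightarrow> cf e i = cf e0 i"
        using e0(2)[OF e] by (metis c_def single_zero single_diff diff_is_0_eq lookup_single_eq lookup_zero le_antisym diff_self_eq_0)
      also have "\<dots> \<longleftrightarrow> e = e0" using E[OF e] E[OF e0(1)] by metis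
      finally show "cf (mon (mon i (cf e i - c)) (cf p e)) 0 = (if e = e0 then cf p e0 else 0)"
        by (auto simp: lookup_single "when_def")
    qed
    then show ?thesis using e0(1) \<open>finite E\<close> by simp
  qed
  ultimately show thesis using that e0(1) by (auto simp: E_def in_keys_iff)
qed

section \<open>Chains of primes in the polynomial ring\<close>

lemma poly_ideal_prime_iff:
  "primeideal J (mon_ring (expos n)) \<longleftrightarrow> ideal J (mon_ring (expos n)) \<and> 1 \<notin> J \<and>
    (\<forall>p\<in>polys n. \<forall>q\<in>polys n. p * q \<in> J \<longrightarrow> p \<in> J \<or> q \<in> J)" for J :: "('k::field) mpoly set"
proof
  assume "primeideal J (mon_ring (expos n))"
  then interpret primeideal J "mon_ring (expos n)" .
  have "1 \<notin> J" using one_imp_carrier I_notcarr by auto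
  then show "ideal J (mon_ring (expos n)) \<and> 1 \<notin> J \<and>
    (\<forall>p\<in>polys n. \<forall>q\<in>polys n. p * q \<in> J \<longrightarrow> p \<in> J \<or> q \<in> J)"
    using is_ideal I_prime by auto
next
  assume R: "ideal J (mon_ring (expos n)) \<and> 1 \<notin> J \<and>
    (\<forall>p\<in>polys n. \<forall>q\<in>polys n. p * q \<in> J \<longrightarrow> p \<in> J \<or> q \<in> J)"
  show "primeideal J (mon_ring (expos n))"
  proof (rule primeidealI)
    show "carrier (mon_ring (expos n)) \<noteq> J" using R polys_one[of n] by auto
  qed (use R poly_ring_cring in auto)
qed

lemma (in vector_space) linear_relation:
  assumes "finite I" "finite T" "card T < card I" "f ` I \<subseteq> span T"
  shows "\<exists>c. (\<Sum>i\<in>I. scale (c i) (f i)) = 0 \<and> (\<exists>i\<in>I. c i \<noteq> 0)"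
proof (cases "inj_on f I")
  case True
  have "\<not> independent (f ` I)"
  proof
    assume "independent (f ` I)"
    then have "card (f ` I) \<le> card T" using independent_span_bound[OF assms(2) _ assms(4)] by auto
    then show False using card_image[OF True] assms(3) by simp
  qed
  then obtain u v where u: "v \<in> f ` I" "u v \<noteq> 0" "(\<Sum>v\<in>f ` I. scale (u v) v) = 0"
    using dependent_finite[of "f ` I"] assms(1) by auto
  have "(\<Sum>i\<in>I. scale (u (f i)) (f i)) = 0"
    using u(3) sum.reindex[OF True, of "\<lambda>v. scale (u v) v"] by simp
  then show ?thesis using u(1,2) by (intro exI[of _ "\<lambda>i. u (f i)"]) auto
next
  case False
  then obtain i j where ij: "i \<in> I" "j \<in> I" "i \<noteq> j" "f i = f j" by (auto simp: inj_on_def)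
  define c where "c l = (if l = i then 1 else if l = j then - 1 else (0 :: 'a))" for l
  have "(\<Sum>l\<in>I. scale (c l) (f l)) = (\<Sum>l\<in>{i, j}. scale (c l) (f l))"
    by (rule sum.mono_neutral_right) (use assms(1) ij in \<open>auto simp: c_def\<close>)
  also have "\<dots> = 0" using ij by (simp add: c_def)
  finally show ?thesis using ij(1) by (intro exI[of _ c]) (auto simp: c_def)
qed

definition box :: "nat \<Rightarrow> nat \<Rightarrow> expo set" where
  "box n D = {e \<in> expos n. \<forall>i. cf e i \<le> D}"

lemma box_card: "finite (box n D)" "card (box n D) \<le> (D + 1) ^ n"
proof -
  let ?F = "PiE {1..n} (\<lambda>_. {..D})"
  let ?r = "\<lambda>e. restrict (cf e) {1..n}"
  have inj: "inj_on ?r (box n D)"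
  proof (rule inj_onI, rule poly_mapping_eqI)
    fix e f i assume e: "e \<in> box n D" and f: "f \<in> box n D" and r: "?r e = ?r f"
    show "cf e i = cf f i"
    proof (cases "i \<in> {1..n}")
      case True
      then show ?thesis using fun_cong[OF r, of i] by simp
    next
      case False
      then have "i \<notin> supp e" "i \<notin> supp f" using e f unfolding box_def expos_def by blast+
      then show ?thesis by (simp add: in_keys_iff)
    qed
  qed
  have sub: "?r ` box n D \<subseteq> ?F" by (auto simp: box_def)
  have fin: "finite ?F" by (rule finite_PiE) auto
  show "finite (box n D)" using inj sub fin by (rule inj_on_finite)
  have "card (box n D) \<le> card ?F" by (rule card_inj_on_le[OF inj sub fin])
  also have "card ?F = (D + 1) ^ n" by (simp add: card_PiE)
  finally show "card (box n D) \<le> (D + 1) ^ n" .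
qed

lemma box_mult: "p \<in> poly_on (box n D) \<Longrightarrow> q \<in> poly_on (box n D') \<Longrightarrow> p * q \<in> poly_on (box n (D + D'))"
  by (erule (1) mult_in_poly_on) (auto simp: box_def lookup_add intro: add_in_expos add_mono)

lemma box_mono: "D \<le> D' \<Longrightarrow> poly_on (box n D) \<subseteq> poly_on (box n D')"
  by (rule poly_on_mono) (auto simp: box_def intro: order_trans)

lemma box_one: "1 \<in> poly_on (box n D)"
  by (rule one_in_poly_on) (simp add: box_def)

lemma box_power: "p \<in> poly_on (box n D) \<Longrightarrow> p ^ m \<in> poly_on (box n (m * D))"
  by (induction m) (auto intro: box_one box_mult)

lemma box_prod: "(\<And>i. i \<in> I \<Longrightarrow> f i \<in> poly_on (box n D)) \<Longrightarrow> prod f I \<in> poly_on (box n (card I * D))"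
  by (induction I rule: infinite_finite_induct) (auto intro: box_one box_mult)

lemma in_some_box:
  assumes "p \<in> polys n"
  shows "\<exists>D. p \<in> poly_on (box n D)"
  using assms
proof (induction rule: poly_on_induct)
  case (add p q)
  then obtain D D' where "p \<in> poly_on (box n D)" "q \<in> poly_on (box n D')" by blast
  then have "p + q \<in> poly_on (box n (max D D'))"
    using box_mono[of D "max D D'" n] box_mono[of D' "max D D'" n] by (intro add_in_poly_on) auto
  then show ?case by blast
next
  case (mon e c)
  have "cf e i \<le> (\<Sum>j\<in>supp e. cf e j)" for i
    by (cases "i \<in> supp e") (auto intro: member_le_sum simp: in_keys_iff)
  then show ?case using mon
    by (intro exI[of _ "\<Sum>j\<in>supp e. cf e j"] mon_in_poly_on) (simp add: box_def)
qed auto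

text \<open>
  By counting: there are \<open>N\<^sup>n\<^sup>+\<^sup>1\<close> products of the \<open>a\<^sub>i\<close> with all exponents below \<open>N\<close>, while their monomials
  lie in a box whose size grows only like \<open>N\<^sup>n\<close>. The relation is given by
  a finite set \<open>E\<close> of exponent functions, which are only compared on \<open>{0..n}\<close>.
\<close>
lemma algebraic_dependence:
  fixes a :: "nat \<Rightarrow> ('k::field) mpoly"
  assumes a: "\<And>i. i \<le> n \<Longrightarrow> a i \<in> polys n"
  shows "\<exists>E c. finite E \<and> E \<noteq> {} \<and> inj_on (\<lambda>e. restrict e {0..n}) E \<and> (\<forall>e\<in>E. c e \<noteq> 0) \<and>
    (\<Sum>e\<in>E. mon 0 (c e) * (\<Prod>i\<in>{0..n}. a i ^ e i)) = 0"
proof -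
  interpret V: vector_space "\<lambda>c p. mon 0 c * p :: 'k mpoly"
    by unfold_locales (auto simp: algebra_simps single_add mult_single)
  have "\<exists>D. \<forall>i\<le>n. a i \<in> poly_on (box n (D i))" using in_some_box[OF a] by metis
  then obtain D where D: "\<And>i. i \<le> n \<Longrightarrow> a i \<in> poly_on (box n (D i))" by blast
  define d where "d = Max (D ` {0..n})"
  have d: "a i \<in> poly_on (box n d)" if "i \<le> n" for i
    using D[OF that] box_mono[of "D i" d n] that by (auto simp: d_def)
  \<comment> \<open>chosen so that the box below has at most \<open>N\<^sup>n K < N\<^sup>n\<^sup>+\<^sup>1\<close> elements\<close>
  define K where "K = ((n + 1) * d + 1) ^ n"
  define N where "N = K + 1"
  define B where "B = (n + 1) * (N * d)"
  define I where "I = PiE {0..n} (\<lambda>_. {..<N})"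
  define T where "T = (\<lambda>e. mon e (1 :: 'k)) ` box n B"
  have "card T \<le> (B + 1) ^ n"
    unfolding T_def using box_card card_image_le order_trans by blast
  also have "\<dots> \<le> (N * ((n + 1) * d + 1)) ^ n"
    by (intro power_mono) (auto simp: B_def N_def algebra_simps)
  also have "\<dots> = N ^ n * K" by (simp only: power_mult_distrib K_def)
  also have "\<dots> < N ^ n * N" by (intro mult_strict_left_mono) (auto simp: N_def)
  also have "\<dots> = card I" by (simp add: I_def card_PiE)
  finally have card: "card T < card I" .
  define f where "f e = (\<Prod>i\<in>{0..n}. a i ^ e i)" for e :: "nat \<Rightarrow> nat"
  have "f e \<in> V.span T" if "e \<in> I" for e
  proof -
    have "a i ^ e i \<in> poly_on (box n (N * d))" if "i \<in> {0..n}" for i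
    proof -
      have "e i \<le> N" using PiE_mem[of e "{0..n}" "\<lambda>_. {..<N}" i] \<open>e \<in> I\<close> that by (simp add: I_def)
      then have "poly_on (box n (e i * d)) \<subseteq> poly_on (box n (N * d))" by (intro box_mono) simp
      then show ?thesis using box_power[OF d, of i "e i"] that by auto
    qed
    then have "f e \<in> poly_on (box n B)"
      unfolding f_def B_def using box_prod[of "{0..n}" "\<lambda>i. a i ^ e i" n "N * d"] by simp
    then show ?thesis
    proof (induction rule: poly_on_induct)
      case (mon e c)
      have "mon e c = mon 0 c * mon e 1" by (simp add: mult_single)
      then show ?case using mon V.span_scale[OF V.span_base[of "mon e 1" T], of c]
        by (simp add: T_def)
    qed (auto intro: V.span_zero V.span_add)
  qed
  then have "f ` I \<subseteq> V.span T" by blast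
  moreover have finI: "finite I" by (auto simp: I_def intro: finite_PiE)
  moreover have "finite T" using box_card by (simp add: T_def)
  ultimately obtain c where c: "(\<Sum>e\<in>I. mon 0 (c e) * f e) = 0" "\<exists>e\<in>I. c e \<noteq> 0"
    using V.linear_relation[of I T f] card by blast
  define E where "E = {e \<in> I. c e \<noteq> 0}"
  have "(\<Sum>e\<in>E. mon 0 (c e) * f e) = 0"
    using c(1) sum.mono_neutral_left[OF finI, of E "\<lambda>e. mon 0 (c e) * f e"] by (auto simp: E_def)
  moreover have "inj_on (\<lambda>e. restrict e {0..n}) E"
    by (rule inj_onI) (metis (no_types, lifting) E_def I_def PiE_restrict mem_Collect_eq)
  moreover have "finite E" "E \<noteq> {}" "\<forall>e\<in>E. c e \<noteq> 0" using c(2) finI by (auto simp: E_def)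
  ultimately show ?thesis unfolding f_def by blast
qed

text \<open>
  Choose \<open>a\<^sub>j\<close> in the \<open>(j + 1)\<close>-st prime but not in the \<open>j\<close>-th, and take an algebraic relation among the
  \<open>a\<^sub>j\<close>. The lowest power of \<open>a\<^sub>0\<close> can be cancelled modulo the first prime, and modulo the second only
  the terms that had this lowest power remain. Repeating this with \<open>a\<^sub>1, \<dots>, a\<^sub>n\<close> leaves a nonzero
  constant in the last prime.
\<close>
lemma no_long_prime_chain:
  fixes P :: "nat \<Rightarrow> ('k::field) mpoly set"
  assumes P: "\<And>j. j \<le> n + 1 \<Longrightarrow> primeideal (P j) (mon_ring (expos n))"
    and strict: "\<And>j. j \<le> n \<Longrightarrow> P j \<subset> P (Suc j)"
  shows False
proof -
  have "\<exists>x. x \<in> P (Suc j) \<and> x \<notin> P j" if "j \<le> n" for j using strict[OF that] by blast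
  then obtain a where a: "\<And>j. j \<le> n \<Longrightarrow> a j \<in> P (Suc j) \<and> a j \<notin> P j" by metis
  have id: "ideal (P j) (mon_ring (expos n))" if "j \<le> n + 1" for j
    using P[OF that] by (simp add: poly_ideal_prime_iff)
  have aS: "a j \<in> polys n" if "j \<le> n" for j
    using a[OF that] id[of "Suc j"] that by (auto simp: poly_ideal_iff)
  have C: "mon 0 c \<in> polys n" for c :: 'k by (intro mon_in_poly_on) simp
  define Q where "Q j E c = (\<Sum>e\<in>E. mon 0 (c e) * (\<Prod>i\<in>{j..n}. a i ^ e i))" for j E and c :: "(nat \<Rightarrow> nat) \<Rightarrow> 'k"
  define good where "good j E c \<longleftrightarrow> finite E \<and> E \<noteq> {} \<and> inj_on (\<lambda>e. restrict e {j..n}) E \<and>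
    (\<forall>e\<in>E. c e \<noteq> 0)" for j and E :: "(nat \<Rightarrow> nat) set" and c :: "(nat \<Rightarrow> nat) \<Rightarrow> 'k"
  \<comment> \<open>injectivity on \<open>{j..n}\<close> keeps the remaining exponents distinct, so the shorter relation stays nontrivial\<close>
  have step: "\<exists>E c. good j E c \<and> Q j E c \<in> P j" if "j \<le> n + 1" for j
    using that
  proof (induction j)
    case 0
    obtain E and c :: "(nat \<Rightarrow> nat) \<Rightarrow> 'k" where "finite E" "E \<noteq> {}" "inj_on (\<lambda>e. restrict e {0..n}) E" "\<forall>e\<in>E. c e \<noteq> 0"
      "(\<Sum>e\<in>E. mon 0 (c e) * (\<Prod>i\<in>{0..n}. a i ^ e i)) = 0"
      using algebraic_dependence[of n a] aS by blast
    moreover have "0 \<in> P 0" using id[of 0] by (auto simp: poly_ideal_iff)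
    ultimately show ?case unfolding good_def Q_def
      by (intro exI[of _ E] exI[of _ c]) simp
  next
    case (Suc j)
    then have j: "j \<le> n" by simp
    obtain E c where E: "good j E c" and QE: "Q j E c \<in> P j" using Suc by auto
    define d where "d = Min ((\<lambda>e. e j) ` E)"
    have dle: "d \<le> e j" if "e \<in> E" for e using that E by (simp add: d_def good_def)
    define F where "F = {e \<in> E. e j = d}"
    have "d \<in> (\<lambda>e. e j) ` E" unfolding d_def by (rule Min_in) (use E in \<open>auto simp: good_def\<close>)
    then have "F \<noteq> {}" by (auto simp: F_def)
    moreover have "inj_on (\<lambda>e. restrict e {Suc j..n}) F"
    proof (rule inj_onI)
      fix e f assume ef: "e \<in> F" "f \<in> F" and eq: "restrict e {Suc j..n} = restrict f {Suc j..n}"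
      have "restrict e {j..n} i = restrict f {j..n} i" for i
      proof (cases "i \<in> {Suc j..n}")
        case True
        then show ?thesis using fun_cong[OF eq, of i] by simp
      next
        case False
        then show ?thesis using ef by (cases "i = j") (auto simp: F_def)
      qed
      then have "restrict e {j..n} = restrict f {j..n}" by blast
      then show "e = f" using E ef by (auto simp: good_def F_def dest: inj_onD)
    qed
    ultimately have F: "good (Suc j) F c" using E by (auto simp: good_def F_def)
    define r where "r = (\<Sum>e\<in>E - F. mon 0 (c e) * (a j ^ (e j - d - 1) * (\<Prod>i\<in>{Suc j..n}. a i ^ e i)))"
    have rS: "r \<in> polys n" unfolding r_def
      using aS j by (intro sum_in_poly_on polys_mult C polys_power polys_prod) auto
    have FS: "Q (Suc j) F c \<in> polys n" unfolding Q_def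
      using aS by (intro sum_in_poly_on polys_mult C polys_power polys_prod) auto
    have split: "(\<Prod>i\<in>{j..n}. a i ^ e i) = a j ^ e j * (\<Prod>i\<in>{Suc j..n}. a i ^ e i)" for e
      using j by (rule prod.atLeast_Suc_atMost)
    have "Q j E c = (\<Sum>e\<in>F. mon 0 (c e) * (\<Prod>i\<in>{j..n}. a i ^ e i))
        + (\<Sum>e\<in>E - F. mon 0 (c e) * (\<Prod>i\<in>{j..n}. a i ^ e i))"
      unfolding Q_def
      by (subst add.commute, rule sum.subset_diff) (use E in \<open>auto simp: F_def good_def\<close>)
    also have "(\<Sum>e\<in>F. mon 0 (c e) * (\<Prod>i\<in>{j..n}. a i ^ e i)) = a j ^ d * Q (Suc j) F c"
      unfolding Q_def sum_distrib_left split by (intro sum.cong refl) (auto simp: F_def)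
    also have "(\<Sum>e\<in>E - F. mon 0 (c e) * (\<Prod>i\<in>{j..n}. a i ^ e i)) = a j ^ d * (a j * r)"
      unfolding r_def sum_distrib_left split
    proof (intro sum.cong refl)
      fix e assume "e \<in> E - F"
      then have "e j = d + (1 + (e j - d - 1))" using dle[of e] by (auto simp: F_def)
      then have "a j ^ e j = a j ^ d * (a j * a j ^ (e j - d - 1))"
        by (metis power_add power_one_right)
      then show "mon 0 (c e) * (a j ^ e j * (\<Prod>i\<in>{Suc j..n}. a i ^ e i)) =
        a j ^ d * (a j * (mon 0 (c e) * (a j ^ (e j - d - 1) * (\<Prod>i\<in>{Suc j..n}. a i ^ e i))))"
        by (simp add: algebra_simps)
    qed
    finally have "a j ^ d * (Q (Suc j) F c + a j * r) \<in> P j" using QE by (simp add: algebra_simps)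
    moreover have "x \<in> P j" if "a j ^ m * x \<in> P j" "x \<in> polys n" for m x
      using that(1)
    proof (induction m)
      case (Suc m)
      have "a j * (a j ^ m * x) \<in> P j" using Suc.prems by (simp add: mult.assoc)
      then have "a j ^ m * x \<in> P j"
        using P[of j] j a[OF j] aS[OF j] that(2) unfolding poly_ideal_prime_iff
        by (meson polys_mult polys_power le_add1 order_trans)
      then show ?case by (rule Suc.IH)
    qed simp
    moreover have "a j * r \<in> polys n" using aS[OF j] rS by (rule polys_mult)
    ultimately have "Q (Suc j) F c + a j * r \<in> P j" using FS by (blast intro: add_in_poly_on)
    then have "Q (Suc j) F c + a j * r \<in> P (Suc j)" using strict[OF j] by blast
    moreover have "a j * r \<in> P (Suc j)" using a[OF j] rS id[of "Suc j"] j by (auto simp: poly_ideal_iff)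
    ultimately have "Q (Suc j) F c + a j * r - a j * r \<in> P (Suc j)"
      using id[of "Suc j"] j by (intro poly_ideal_diff) auto
    then show ?case using F by auto
  qed
  obtain E c where E: "good (n + 1) E c" "Q (n + 1) E c \<in> P (n + 1)" using step[of "n + 1"] by auto
  then obtain e where "e \<in> E" by (auto simp: good_def)
  have "f = e" if "f \<in> E" for f
    using E(1) that \<open>e \<in> E\<close> by (auto simp: good_def restrict_def dest: inj_onD)
  then have "E = {e}" using \<open>e \<in> E\<close> by blast
  then have "mon 0 (c e) \<in> P (n + 1)" "c e \<noteq> 0" using E by (auto simp: Q_def good_def)
  then have "mon 0 (c e) * mon 0 (inverse (c e)) \<in> P (n + 1)"
    using id[of "n + 1"] C by (auto simp: poly_ideal_iff)
  then have "1 \<in> P (n + 1)" using \<open>c e \<noteq> 0\<close> by (simp add: mult_single)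
  then show False using P[of "n + 1"] by (simp add: poly_ideal_prime_iff)
qed

section \<open>Elementary symmetric polynomials\<close>

definition xprod :: "nat set \<Rightarrow> ('k::field) mpoly" where
  "xprod A = (\<Prod>i\<in>A. mvar i)"

definition esym :: "nat \<Rightarrow> nat \<Rightarrow> ('k::field) mpoly" where
  "esym n d = (\<Sum>A | A \<subseteq> {1..n} \<and> card A = d. xprod A)"

lemma xprod_in: "A \<subseteq> {1..n} \<Longrightarrow> xprod A \<in> polys n"
  unfolding xprod_def by (intro polys_prod mvar_in) blast

definition poly_radical :: "nat \<Rightarrow> ('k::field) mpoly set \<Rightarrow> 'k mpoly set" where
  "poly_radical n J = {p \<in> polys n. \<exists>N. p ^ N \<in> J}"

lemma poly_radical_ideal:
  assumes J: "ideal J (mon_ring (expos n))"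
  shows "ideal (poly_radical n J) (mon_ring (expos n))"
  unfolding poly_ideal_iff
proof (intro conjI ballI)
  note J' = J[unfolded poly_ideal_iff]
  show "poly_radical n J \<subseteq> polys n" by (auto simp: poly_radical_def)
  show "0 \<in> poly_radical n J" using J' by (auto simp: poly_radical_def intro: exI[of _ 1])
  fix p q assume p: "p \<in> poly_radical n J" 
  then obtain a where a: "p \<in> polys n" "p ^ a \<in> J" by (auto simp: poly_radical_def)
  show "p * q \<in> poly_radical n J" if q: "q \<in> polys n"
  proof -
    have "(p * q) ^ a \<in> J" using a q J' polys_power[OF q, of a] by (simp add: power_mult_distrib)
    then show ?thesis using a q by (auto simp: poly_radical_def intro: polys_mult)
  qed
  show "p + q \<in> poly_radical n J" if q: "q \<in> poly_radical n J"
  proof -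
    obtain b where b: "q \<in> polys n" "q ^ b \<in> J" using q by (auto simp: poly_radical_def)
    have "(p + q) ^ (a + b) = (\<Sum>k\<le>a + b. of_nat (a + b choose k) * p ^ k * q ^ (a + b - k))"
      by (rule binomial_ring)
    also have "\<dots> \<in> J"
    proof (rule poly_ideal_sum[OF J])
      fix k
      have on: "of_nat m \<in> polys n" for m
        by (induction m) (auto intro: add_in_poly_on)
      show "of_nat (a + b choose k) * p ^ k * q ^ (a + b - k) \<in> J"
      proof (cases "a \<le> k")
        case True
        then have "p ^ k = p ^ a * p ^ (k - a)" by (simp flip: power_add)
        then have "of_nat (a + b choose k) * p ^ k * q ^ (a + b - k) =
          p ^ a * (of_nat (a + b choose k) * p ^ (k - a) * q ^ (a + b - k))"
          by (simp add: algebra_simps)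
        also have "\<dots> \<in> J"
          using J' a(2) polys_mult[OF polys_mult[OF on polys_power[OF a(1)]] polys_power[OF b(1)]] by simp
        finally show ?thesis .
      next
        case False
        then have "q ^ (a + b - k) = q ^ b * q ^ (a - k)" by (simp flip: power_add add: add.commute)
        then have "of_nat (a + b choose k) * p ^ k * q ^ (a + b - k) =
          q ^ b * (of_nat (a + b choose k) * p ^ k * q ^ (a - k))"
          by (simp add: algebra_simps)
        also have "\<dots> \<in> J"
          using J' b(2) polys_mult[OF polys_mult[OF on polys_power[OF a(1)]] polys_power[OF b(1)]] by simp
        finally show ?thesis .
      qed
    qed
    finally show ?thesis using a(1) b(1) by (auto simp: poly_radical_def intro: add_in_poly_on)
  qed
qed

lemma poly_radical_power: "p \<in> polys n \<Longrightarrow> p ^ m \<in> poly_radical n J \<Longrightarrow> p \<in> poly_radical n J"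
  by (auto simp: poly_radical_def simp flip: power_mult)

text \<open>
  Descending induction on the size \<open>d\<close> of \<open>A\<close>. Two different sets of size \<open>d\<close> have a union of size
  greater than \<open>d\<close>, so in \<open>x\<^sub>A e\<^sub>d = x\<^sub>A\<^sup>2 + \<Sum>\<^sub>B x\<^sub>A x\<^sub>B\<close> all terms of the last sum lie in the radical by
  induction, and therefore so does \<open>x\<^sub>A\<^sup>2\<close>.
\<close>
lemma xprod_in_rad:
  fixes J :: "('k::field) mpoly set"
  assumes J: "ideal J (mon_ring (expos n))"
    and e: "\<And>d. 2 \<le> d \<Longrightarrow> d \<le> n \<Longrightarrow> esym n d \<in> J"
    and A: "A \<subseteq> {1..n}" "2 \<le> card A"
  shows "xprod A \<in> poly_radical n J"
  using A
proof (induction "n - card A" arbitrary: A rule: less_induct)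
  case less
  note R = poly_radical_ideal[OF J, unfolded poly_ideal_iff]
  let ?d = "card A"
  have An: "card A \<le> n" using card_mono[OF _ less.prems(1)] by simp
  let ?S = "{B. B \<subseteq> {1..n} \<and> card B = ?d}"
  have finS: "finite ?S" by (rule finite_subset[of _ "Pow {1..n}"]) auto
  have JR: "J \<subseteq> poly_radical n J"
    using J unfolding poly_ideal_iff poly_radical_def by (auto intro: exI[of _ 1])
  have "xprod A * xprod B \<in> poly_radical n J" if B: "B \<in> ?S - {A}" for B
  proof -
    have fin: "finite A" "finite B" using less.prems(1) B by (auto intro: finite_subset)
    have "\<not> B \<subseteq> A" using card_subset_eq[OF fin(1)] B by auto
    then have lt: "card A < card (A \<union> B)" using fin by (intro psubset_card_mono) auto
    have sub: "A \<union> B \<subseteq> {1..n}" using less.prems(1) B by auto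
    have "card (A \<union> B) \<le> n" using card_mono[OF _ sub] by simp
    then have "xprod (A \<union> B) \<in> poly_radical n J"
      using less.hyps[of "A \<union> B"] lt sub less.prems(2) by auto
    moreover have "xprod (A \<inter> B) \<in> polys n" using less.prems(1) by (intro xprod_in) auto
    ultimately have "xprod (A \<union> B) * xprod (A \<inter> B) \<in> poly_radical n J" using R by auto
    then show ?thesis unfolding xprod_def using prod.union_inter[OF fin] by metis
  qed
  then have 1: "(\<Sum>B\<in>?S - {A}. xprod A * xprod B) \<in> poly_radical n J"
    by (rule poly_ideal_sum[OF poly_radical_ideal[OF J]])
  have "esym n ?d \<in> poly_radical n J" using e[OF less.prems(2) An] JR by auto
  then have 2: "esym n ?d * xprod A \<in> poly_radical n J" using R xprod_in[OF less.prems(1)] by auto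
  define T :: "'k mpoly" where "T = (\<Sum>B\<in>?S - {A}. xprod B)"
  have "esym n ?d = xprod A + T"
    unfolding T_def esym_def using finS less.prems(1) by (intro sum.remove) auto
  then have "(xprod A :: 'k mpoly) ^ 2 = esym n ?d * xprod A - xprod A * T"
    by (simp add: power2_eq_square algebra_simps)
  also have "xprod A * T = (\<Sum>B\<in>?S - {A}. xprod A * xprod B)"
    by (simp add: T_def sum_distrib_left)
  finally have "(xprod A :: 'k mpoly) ^ 2 = esym n ?d * xprod A - (\<Sum>B\<in>?S - {A}. xprod A * xprod B)" .
  then have "xprod A ^ 2 \<in> poly_radical n J" using poly_ideal_diff[OF poly_radical_ideal[OF J] 2 1] by simp
  then show ?case using poly_radical_power[OF xprod_in[OF less.prems(1)]] by blast
qed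

section \<open>Localization\<close>

locale multiplicative_subset = cring R for R (structure) +
  fixes U :: "'a set"
  assumes U_sub: "U \<subseteq> carrier R" and U_one: "\<one> \<in> U"
    and U_mult: "\<lbrakk>s \<in> U; t \<in> U\<rbrakk> \<Longrightarrow> s \<otimes> t \<in> U"
begin

lemma U_carr [simp]: "s \<in> U \<Longrightarrow> s \<in> carrier R"
  using U_sub by auto

declare U_one [simp] U_mult [simp]

abbreviation frac :: "'a \<Rightarrow> 'a \<Rightarrow> ('a \<times> 'a) set" where
  "frac a s \<equiv> loc_frac R U a s"

abbreviation Loc :: "('a \<times> 'a) set ring" where
  "Loc \<equiv> localization R U"

lemma loc_relI:
  assumes "a \<in> carrier R" "s \<in> U" "b \<in> carrier R" "t \<in> U" "u \<in> U"
    "u \<otimes> (t \<otimes> a) = u \<otimes> (s \<otimes> b)"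
  shows "((a, s), (b, t)) \<in> loc_rel R U"
  using assms by (auto simp: loc_rel_def)

lemma loc_rel_equiv: "equiv (carrier R \<times> U) (loc_rel R U)"
proof (rule equivI)
  show "refl_on (carrier R \<times> U) (loc_rel R U)"
    by (auto simp: refl_on_def intro!: loc_relI[of _ _ _ _ \<one>])
  show "loc_rel R U \<subseteq> (carrier R \<times> U) \<times> (carrier R \<times> U)"
    by (auto simp: loc_rel_def)
  show "sym (loc_rel R U)"
    by (rule symI) (clarsimp simp: loc_rel_def, metis)
  show "trans (loc_rel R U)"
  proof (rule transI, clarsimp simp: loc_rel_def)
    fix a s b t c v u w
    assume c: "a \<in> carrier R" "s \<in> U" "b \<in> carrier R" "t \<in> U" "c \<in> carrier R" "v \<in> U" "u \<in> U" "w \<in> U"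
      and 1: "u \<otimes> (t \<otimes> a) = u \<otimes> (s \<otimes> b)" and 2: "w \<otimes> (v \<otimes> b) = w \<otimes> (t \<otimes> c)"
    have "(u \<otimes> w \<otimes> t) \<otimes> (v \<otimes> a) = (w \<otimes> v) \<otimes> (u \<otimes> (t \<otimes> a))" using c by (simp add: m_ac)
    also have "\<dots> = (u \<otimes> s) \<otimes> (w \<otimes> (v \<otimes> b))" unfolding 1 using c by (simp add: m_ac)
    also have "\<dots> = (u \<otimes> w \<otimes> t) \<otimes> (s \<otimes> c)" unfolding 2 using c by (simp add: m_ac)
    finally show "\<exists>x\<in>U. x \<otimes> (v \<otimes> a) = x \<otimes> (s \<otimes> c)" using c by (intro bexI[of _ "u \<otimes> w \<otimes> t"]) auto
  qed
qed

lemma frac_eq_iff: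
  assumes "a \<in> carrier R" "s \<in> U" "b \<in> carrier R" "t \<in> U"
  shows "frac a s = frac b t \<longleftrightarrow> (\<exists>u\<in>U. u \<otimes> (t \<otimes> a) = u \<otimes> (s \<otimes> b))"
proof -
  have "frac a s = frac b t \<longleftrightarrow> ((a, s), (b, t)) \<in> loc_rel R U"
    unfolding loc_frac_def by (rule eq_equiv_class_iff[OF loc_rel_equiv]) (use assms in auto)
  then show ?thesis using assms by (auto simp: loc_rel_def)
qed

lemma frac_eqI:
  assumes "a \<in> carrier R" "s \<in> U" "b \<in> carrier R" "t \<in> U" "t \<otimes> a = s \<otimes> b"
  shows "frac a s = frac b t"
  using assms by (subst frac_eq_iff) (auto intro: bexI[of _ \<one>])

lemma frac_mem: "p \<in> frac a s \<Longrightarrow> \<exists>b t. p = (b, t) \<and> b \<in> carrier R \<and> t \<in> U \<and>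
    (\<exists>u\<in>U. u \<otimes> (t \<otimes> a) = u \<otimes> (s \<otimes> b))"
  by (auto simp: loc_frac_def loc_rel_def)

lemma frac_self: "a \<in> carrier R \<Longrightarrow> s \<in> U \<Longrightarrow> (a, s) \<in> frac a s"
  by (auto simp: loc_frac_def intro!: loc_relI[of _ _ _ _ \<one>])

lemma frac_closed [simp]: "a \<in> carrier R \<Longrightarrow> s \<in> U \<Longrightarrow> frac a s \<in> carrier Loc"
  by (auto simp: localization_def loc_frac_def intro: quotientI)

lemma frac_cases:
  assumes "x \<in> carrier Loc"
  obtains a s where "a \<in> carrier R" "s \<in> U" "x = frac a s"
  using assms by (auto simp: localization_def loc_frac_def elim!: quotientE)

text \<open>
  The ring operations of a localization are unions over all representatives. Once all members of
  the union are known to agree, such a union equals any one of them.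
\<close>
lemma UN_UN_const:
  assumes "p0 \<in> A" "q0 \<in> B" "\<And>a s b t. (a, s) \<in> A \<Longrightarrow> (b, t) \<in> B \<Longrightarrow> F a s b t = C"
  shows "(\<Union>(a, s) \<in> A. \<Union>(b, t) \<in> B. F a s b t) = C"
  using assms by (cases p0; cases q0) fastforce

lemma frac_mult [simp]:
  assumes c: "a \<in> carrier R" "s \<in> U" "b \<in> carrier R" "t \<in> U"
  shows "frac a s \<otimes>\<^bsub>Loc\<^esub> frac b t = frac (a \<otimes> b) (s \<otimes> t)"
proof -
  have "frac (a' \<otimes> b') (s' \<otimes> t') = frac (a \<otimes> b) (s \<otimes> t)"
    if m1: "(a', s') \<in> frac a s" and m2: "(b', t') \<in> frac b t" for a' s' b' t'
  proof -
    obtain u where u: "a' \<in> carrier R" "s' \<in> U" "u \<in> U" "u \<otimes> (s' \<otimes> a) = u \<otimes> (s \<otimes> a')"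
      using frac_mem[OF m1] by blast
    obtain w where w: "b' \<in> carrier R" "t' \<in> U" "w \<in> U" "w \<otimes> (t' \<otimes> b) = w \<otimes> (t \<otimes> b')"
      using frac_mem[OF m2] by blast
    have "(u \<otimes> w) \<otimes> ((s \<otimes> t) \<otimes> (a' \<otimes> b')) = (u \<otimes> (s \<otimes> a')) \<otimes> (w \<otimes> (t \<otimes> b'))"
      using c u(1-3) w(1-3) by (simp add: m_ac)
    also have "\<dots> = (u \<otimes> (s' \<otimes> a)) \<otimes> (w \<otimes> (t' \<otimes> b))" using u(4) w(4) by simp
    also have "\<dots> = (u \<otimes> w) \<otimes> ((s' \<otimes> t') \<otimes> (a \<otimes> b))"
      using c u(1-3) w(1-3) by (simp add: m_ac)
    finally show ?thesis using c u(1-3) w(1-3) by (subst frac_eq_iff) auto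
  qed
  note UN_UN_const[OF frac_self[OF c(1,2)] frac_self[OF c(3,4)] this]
  then show ?thesis by (simp only: localization_def monoid.select_convs)
qed

lemma frac_add [simp]:
  assumes c: "a \<in> carrier R" "s \<in> U" "b \<in> carrier R" "t \<in> U"
  shows "frac a s \<oplus>\<^bsub>Loc\<^esub> frac b t = frac (t \<otimes> a \<oplus> s \<otimes> b) (s \<otimes> t)"
proof -
  have "frac (t' \<otimes> a' \<oplus> s' \<otimes> b') (s' \<otimes> t') = frac (t \<otimes> a \<oplus> s \<otimes> b) (s \<otimes> t)"
    if m1: "(a', s') \<in> frac a s" and m2: "(b', t') \<in> frac b t" for a' s' b' t'
  proof -
    obtain u where u: "a' \<in> carrier R" "s' \<in> U" "u \<in> U" "u \<otimes> (s' \<otimes> a) = u \<otimes> (s \<otimes> a')"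
      using frac_mem[OF m1] by blast
    obtain w where w: "b' \<in> carrier R" "t' \<in> U" "w \<in> U" "w \<otimes> (t' \<otimes> b) = w \<otimes> (t \<otimes> b')"
      using frac_mem[OF m2] by blast
    have "(u \<otimes> w) \<otimes> ((s \<otimes> t) \<otimes> (t' \<otimes> a' \<oplus> s' \<otimes> b'))
        = (w \<otimes> t \<otimes> t') \<otimes> (u \<otimes> (s \<otimes> a')) \<oplus> (u \<otimes> s \<otimes> s') \<otimes> (w \<otimes> (t \<otimes> b'))"
      using c u(1-3) w(1-3) by (simp add: m_ac r_distr)
    also have "\<dots> = (w \<otimes> t \<otimes> t') \<otimes> (u \<otimes> (s' \<otimes> a)) \<oplus> (u \<otimes> s \<otimes> s') \<otimes> (w \<otimes> (t' \<otimes> b))"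
      using u(4) w(4) by simp
    also have "\<dots> = (u \<otimes> w) \<otimes> ((s' \<otimes> t') \<otimes> (t \<otimes> a \<oplus> s \<otimes> b))"
      using c u(1-3) w(1-3) by (simp add: m_ac r_distr)
    finally show ?thesis using c u(1-3) w(1-3) by (subst frac_eq_iff) auto
  qed
  note UN_UN_const[OF frac_self[OF c(1,2)] frac_self[OF c(3,4)] this]
  then show ?thesis by (simp only: localization_def ring.select_convs)
qed

lemma Loc_one [simp]: "\<one>\<^bsub>Loc\<^esub> = frac \<one> \<one>" and Loc_zero [simp]: "\<zero>\<^bsub>Loc\<^esub> = frac \<zero> \<one>"
  by (simp_all add: localization_def)

lemma Loc_cring: "cring Loc"
proof (intro cringI abelian_groupI comm_monoidI)
  fix x y assume xy: "x \<in> carrier Loc" "y \<in> carrier Loc"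
  obtain a s where a: "a \<in> carrier R" "s \<in> U" "x = frac a s" using xy(1) by (rule frac_cases)
  obtain b t where b: "b \<in> carrier R" "t \<in> U" "y = frac b t" using xy(2) by (rule frac_cases)
  show "x \<oplus>\<^bsub>Loc\<^esub> y \<in> carrier Loc" "x \<otimes>\<^bsub>Loc\<^esub> y \<in> carrier Loc" using a b by simp_all
  show "x \<oplus>\<^bsub>Loc\<^esub> y = y \<oplus>\<^bsub>Loc\<^esub> x" using a b by (simp add: m_comm a_comm)
  show "x \<otimes>\<^bsub>Loc\<^esub> y = y \<otimes>\<^bsub>Loc\<^esub> x" using a b by (simp add: m_comm)
  show "\<zero>\<^bsub>Loc\<^esub> \<oplus>\<^bsub>Loc\<^esub> x = x" "\<one>\<^bsub>Loc\<^esub> \<otimes>\<^bsub>Loc\<^esub> x = x" using a by simp_all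
  show "\<exists>y\<in>carrier Loc. y \<oplus>\<^bsub>Loc\<^esub> x = \<zero>\<^bsub>Loc\<^esub>"
    using a by (intro bexI[of _ "frac (\<ominus> a) s"])
      (simp_all add: r_minus l_neg, rule frac_eqI, simp_all)
  fix z assume z: "z \<in> carrier Loc"
  then obtain c v where c: "c \<in> carrier R" "v \<in> U" "z = frac c v" by (rule frac_cases)
  show "x \<otimes>\<^bsub>Loc\<^esub> y \<otimes>\<^bsub>Loc\<^esub> z = x \<otimes>\<^bsub>Loc\<^esub> (y \<otimes>\<^bsub>Loc\<^esub> z)"
    using a b c by (simp add: m_assoc)
  show "x \<oplus>\<^bsub>Loc\<^esub> y \<oplus>\<^bsub>Loc\<^esub> z = x \<oplus>\<^bsub>Loc\<^esub> (y \<oplus>\<^bsub>Loc\<^esub> z)"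
    using a b c by (simp add: m_ac r_distr a_ac)
  show "(x \<oplus>\<^bsub>Loc\<^esub> y) \<otimes>\<^bsub>Loc\<^esub> z = x \<otimes>\<^bsub>Loc\<^esub> z \<oplus>\<^bsub>Loc\<^esub> y \<otimes>\<^bsub>Loc\<^esub> z"
    using a b c by (simp, intro frac_eqI, simp_all add: m_ac r_distr)
qed auto

end

text \<open>
  The map \<open>f\<close> is, up to isomorphism, the canonical map from \<open>R\<close> to the localization of \<open>R / K\<close> at
  the image of \<open>U\<close>. This interface is shared by the local ring at the origin, by its quotients by symbolic
  powers, and by its own localizations, in all of which computations can thus be carried out in \<open>R\<close>.
\<close>
locale fraction_map = multiplicative_subset R U + K: ideal K R + L: cring L
  for R (structure) and U and K and L :: "('b, 'c) ring_scheme" +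
  fixes f
  assumes f_hom: "f \<in> ring_hom R L"
    and f_units: "s \<in> U \<Longrightarrow> f s \<in> Units L"
    and f_frac: "x \<in> carrier L \<Longrightarrow> \<exists>s\<in>U. \<exists>a\<in>carrier R. f s \<otimes>\<^bsub>L\<^esub> x = f a"
    and f_ker: "r \<in> carrier R \<Longrightarrow> f r = \<zero>\<^bsub>L\<^esub> \<longleftrightarrow> (\<exists>u\<in>U. u \<otimes> r \<in> K)"
begin

sublocale f: ring_hom_cring R L f
  by unfold_locales (rule f_hom)

lemma f_ring_hom_ring: "ring_hom_ring R L f"
  by (intro ring_hom_ringI2 ring_axioms L.ring_axioms f_hom)

text \<open>The extension \<open>I L\<close> of an ideal, see \<open>genideal_image\<close>.\<close>
definition ext :: "'a set \<Rightarrow> 'b set" where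
  "ext I = {x \<in> carrier L. \<exists>s\<in>U. \<exists>a\<in>I. f s \<otimes>\<^bsub>L\<^esub> x = f a}"

lemma extI:
  "\<lbrakk>x \<in> carrier L; s \<in> U; a \<in> I; f s \<otimes>\<^bsub>L\<^esub> x = f a\<rbrakk> \<Longrightarrow> x \<in> ext I"
  by (auto simp: ext_def)

lemma f_in_carr [simp]: "a \<in> carrier R \<Longrightarrow> f a \<in> carrier L"
  by (rule f.hom_closed)

lemma unit_cancel_ideal:
  assumes "ideal I L" "s \<in> U" "x \<in> carrier L" "f s \<otimes>\<^bsub>L\<^esub> x \<in> I"
  shows "x \<in> I"
proof -
  interpret I: ideal I L by fact
  obtain v where v: "v \<in> carrier L" "v \<otimes>\<^bsub>L\<^esub> f s = \<one>\<^bsub>L\<^esub>"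
    using f_units[OF assms(2)] by (auto simp: Units_def)
  have "v \<otimes>\<^bsub>L\<^esub> (f s \<otimes>\<^bsub>L\<^esub> x) = x"
    using v assms(2,3) by (simp add: L.m_assoc[symmetric])
  then show ?thesis using I.I_l_closed[OF assms(4) v(1)] by simp
qed

lemma ext_ideal:
  assumes "ideal I R"
  shows "ideal (ext I) L"
proof (rule idealI)
  interpret I: ideal I R by fact
  show "subgroup (ext I) (add_monoid L)"
  proof (rule L.add.subgroupI)
    show "ext I \<subseteq> carrier L" by (auto simp: ext_def)
    have "f \<one> \<otimes>\<^bsub>L\<^esub> \<zero>\<^bsub>L\<^esub> = f \<zero>" by simp
    then have "\<zero>\<^bsub>L\<^esub> \<in> ext I" unfolding ext_def using U_one I.zero_closed L.zero_closed by blast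
    then show "ext I \<noteq> {}" by blast
    fix x assume "x \<in> ext I"
    then obtain s a where x: "x \<in> carrier L" "s \<in> U" "a \<in> I" "f s \<otimes>\<^bsub>L\<^esub> x = f a" by (auto simp: ext_def)
    have "f s \<otimes>\<^bsub>L\<^esub> (\<ominus>\<^bsub>L\<^esub> x) = f (\<ominus> a)" using x I.Icarr by (simp add: L.r_minus)
    then show "\<ominus>\<^bsub>L\<^esub> x \<in> ext I" unfolding ext_def using x I.a_inv_closed by blast
    fix y assume "y \<in> ext I"
    then obtain t b where y: "y \<in> carrier L" "t \<in> U" "b \<in> I" "f t \<otimes>\<^bsub>L\<^esub> y = f b" by (auto simp: ext_def)
    have "f (s \<otimes> t) \<otimes>\<^bsub>L\<^esub> (x \<oplus>\<^bsub>L\<^esub> y) = f t \<otimes>\<^bsub>L\<^esub> (f s \<otimes>\<^bsub>L\<^esub> x) \<oplus>\<^bsub>L\<^esub> f s \<otimes>\<^bsub>L\<^esub> (f t \<otimes>\<^bsub>L\<^esub> y)"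
      using x(1-3) y(1-3) by (simp add: L.m_ac L.r_distr)
    also have "\<dots> = f t \<otimes>\<^bsub>L\<^esub> f a \<oplus>\<^bsub>L\<^esub> f s \<otimes>\<^bsub>L\<^esub> f b" by (simp only: x(4) y(4))
    also have "\<dots> = f (t \<otimes> a \<oplus> s \<otimes> b)" using x(2,3) y(2,3) I.Icarr by simp
    finally show "x \<oplus>\<^bsub>L\<^esub> y \<in> ext I"
      using x(1-3) y(1-3) I.I_l_closed I.a_closed by (intro extI[of _ "s \<otimes> t" "t \<otimes> a \<oplus> s \<otimes> b"]) simp_all
  qed
  fix x z assume "x \<in> ext I" and z: "z \<in> carrier L"
  then obtain s a where x: "x \<in> carrier L" "s \<in> U" "a \<in> I" "f s \<otimes>\<^bsub>L\<^esub> x = f a" by (auto simp: ext_def)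
  obtain t b where b: "t \<in> U" "b \<in> carrier R" "f t \<otimes>\<^bsub>L\<^esub> z = f b" using f_frac[OF z] by blast
  have "f (s \<otimes> t) \<otimes>\<^bsub>L\<^esub> (z \<otimes>\<^bsub>L\<^esub> x) = (f t \<otimes>\<^bsub>L\<^esub> z) \<otimes>\<^bsub>L\<^esub> (f s \<otimes>\<^bsub>L\<^esub> x)"
    using x(1-3) z b(1,2) by (simp add: L.m_ac)
  also have "\<dots> = f b \<otimes>\<^bsub>L\<^esub> f a" by (simp only: x(4) b(3))
  also have "\<dots> = f (b \<otimes> a)" using x(2,3) b(1,2) I.Icarr by simp
  finally show "z \<otimes>\<^bsub>L\<^esub> x \<in> ext I"
    using x(1-3) z b(1,2) I.I_l_closed by (intro extI[of _ "s \<otimes> t" "b \<otimes> a"]) simp_all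
  then show "x \<otimes>\<^bsub>L\<^esub> z \<in> ext I" using x z by (simp add: L.m_comm)
qed (rule L.ring_axioms)

lemma f_in_ext: "a \<in> I \<Longrightarrow> a \<in> carrier R \<Longrightarrow> f a \<in> ext I"
proof -
  assume a: "a \<in> I" "a \<in> carrier R"
  have "f \<one> \<otimes>\<^bsub>L\<^esub> f a = f a" using a by simp
  then show ?thesis unfolding ext_def using a U_one f_in_carr by blast
qed

lemma ext_mono: "I \<subseteq> I' \<Longrightarrow> ext I \<subseteq> ext I'"
  by (auto simp: ext_def)

lemma genideal_image:
  assumes "ideal I R"
  shows "genideal L (f ` I) = ext I"
proof
  interpret I: ideal I R by fact
  show "genideal L (f ` I) \<subseteq> ext I"
    using f_in_ext I.Icarr by (intro L.genideal_minimal ext_ideal assms) auto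
  have c: "f ` I \<subseteq> carrier L" using I.Icarr by auto
  show "ext I \<subseteq> genideal L (f ` I)"
  proof
    fix x assume "x \<in> ext I"
    then obtain s a where x: "x \<in> carrier L" "s \<in> U" "a \<in> I" "f s \<otimes>\<^bsub>L\<^esub> x = f a" by (auto simp: ext_def)
    then have "f s \<otimes>\<^bsub>L\<^esub> x \<in> genideal L (f ` I)" using L.genideal_self[OF c] by auto
    then show "x \<in> genideal L (f ` I)" using unit_cancel_ideal[OF L.genideal_ideal[OF c]] x by blast
  qed
qed

lemma f_in_ext_iff:
  assumes I: "ideal I R" "K \<subseteq> I" and r: "r \<in> carrier R"
  shows "f r \<in> ext I \<longleftrightarrow> (\<exists>u\<in>U. u \<otimes> r \<in> I)"
proof
  interpret I: ideal I R by fact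
  assume "f r \<in> ext I"
  then obtain s a where x: "s \<in> U" "a \<in> I" "f s \<otimes>\<^bsub>L\<^esub> f r = f a" by (auto simp: ext_def)
  have "f (s \<otimes> r \<ominus> a) = f s \<otimes>\<^bsub>L\<^esub> f r \<ominus>\<^bsub>L\<^esub> f a" using x r I.Icarr by (simp add: a_minus_def L.minus_eq)
  then have "f (s \<otimes> r \<ominus> a) = \<zero>\<^bsub>L\<^esub>" using x r I.Icarr by (simp add: L.minus_eq L.r_neg)
  then obtain u where u: "u \<in> U" "u \<otimes> (s \<otimes> r \<ominus> a) \<in> K" using f_ker[of "s \<otimes> r \<ominus> a"] x r I.Icarr by auto
  have "u \<otimes> (s \<otimes> r \<ominus> a) \<oplus> u \<otimes> a \<in> I"
    using u assms(2) I.I_l_closed[OF x(2)] by (intro I.a_closed) auto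
  also have "u \<otimes> (s \<otimes> r \<ominus> a) \<oplus> u \<otimes> a = (u \<otimes> s) \<otimes> r"
    using u x r I.Icarr by (simp add: minus_eq r_distr r_minus m_assoc a_assoc l_neg)
  finally show "\<exists>u\<in>U. u \<otimes> r \<in> I" using u x by (auto intro: bexI[of _ "u \<otimes> s"])
next
  interpret I: ideal I R by fact
  assume "\<exists>u\<in>U. u \<otimes> r \<in> I"
  then obtain u where "u \<in> U" "u \<otimes> r \<in> I" by blast
  then show "f r \<in> ext I" using r by (intro extI[of _ u "u \<otimes> r"]) simp_all
qed

lemma ext_prime:
  assumes P: "primeideal P R" "K \<subseteq> P" "P \<inter> U = {}"
  shows "primeideal (ext P) L" "\<And>r. r \<in> carrier R \<Longrightarrow> f r \<in> ext P \<longleftrightarrow> r \<in> P"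
proof -
  interpret P: primeideal P R by fact
  show iff: "f r \<in> ext P \<longleftrightarrow> r \<in> P" if r: "r \<in> carrier R" for r
    unfolding f_in_ext_iff[OF P.is_ideal P(2) r]
    using P.I_prime[OF U_carr r] P(3) P.I_l_closed[of r \<one>] r U_one by (auto intro: bexI[of _ \<one>])
  interpret E: ideal "ext P" L by (rule ext_ideal[OF P.is_ideal])
  show "primeideal (ext P) L"
  proof (rule primeidealI[OF E.is_ideal L.is_cring])
    have "f \<one> \<notin> ext P" using iff[of \<one>] P(3) U_one by blast
    then show "carrier L \<noteq> ext P" using f_in_carr[of \<one>] by blast
    fix x y assume x: "x \<in> carrier L" and y: "y \<in> carrier L" and xy: "x \<otimes>\<^bsub>L\<^esub> y \<in> ext P"
    obtain s a where a: "s \<in> U" "a \<in> carrier R" "f s \<otimes>\<^bsub>L\<^esub> x = f a" using f_frac[OF x] by blast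
    obtain t b where b: "t \<in> U" "b \<in> carrier R" "f t \<otimes>\<^bsub>L\<^esub> y = f b" using f_frac[OF y] by blast
    have "f (a \<otimes> b) = (f s \<otimes>\<^bsub>L\<^esub> f t) \<otimes>\<^bsub>L\<^esub> (x \<otimes>\<^bsub>L\<^esub> y)"
      using x y a b(1,2) by (simp add: a(3)[symmetric] b(3)[symmetric] L.m_ac del: f.hom_mult add: f.hom_mult)
    also have "\<dots> \<in> ext P" using E.I_l_closed[OF xy, of "f s \<otimes>\<^bsub>L\<^esub> f t"] a(1) b(1) by simp
    finally have "a \<in> P \<or> b \<in> P" using iff[of "a \<otimes> b"] P.I_prime a b by auto
    then show "x \<in> ext P \<or> y \<in> ext P"
    proof
      assume "a \<in> P"
      then have "x \<in> ext P" using x a unfolding ext_def by blast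
      then show ?thesis ..
    next
      assume "b \<in> P"
      then have "y \<in> ext P" using y b unfolding ext_def by blast
      then show ?thesis ..
    qed
  qed
qed

lemma contract_prime:
  assumes "primeideal Q L"
  shows "primeideal {r \<in> carrier R. f r \<in> Q} R" "K \<subseteq> {r \<in> carrier R. f r \<in> Q}"
proof -
  interpret Q: primeideal Q L by fact
  show "primeideal {r \<in> carrier R. f r \<in> Q} R"
    by (rule ring_hom_ring.primeideal_vimage[OF f_ring_hom_ring is_cring assms])
  show "K \<subseteq> {r \<in> carrier R. f r \<in> Q}"
  proof
    fix r assume "r \<in> K"
    then have "f r = \<zero>\<^bsub>L\<^esub>" "r \<in> carrier R" using f_ker[of r] K.Icarr by (auto intro!: bexI[of _ \<one>])
    then show "r \<in> {r \<in> carrier R. f r \<in> Q}" using Q.zero_closed by simp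
  qed
qed

lemma contract_strict:
  assumes Q: "ideal Q L" and Q': "ideal Q' L" and lt: "Q \<subset> Q'"
  shows "{r \<in> carrier R. f r \<in> Q} \<subset> {r \<in> carrier R. f r \<in> Q'}"
proof -
  interpret Q: ideal Q L by fact
  interpret Q': ideal Q' L by fact
  obtain x where x: "x \<in> Q'" "x \<notin> Q" using lt by blast
  then have xc: "x \<in> carrier L" using Q'.Icarr by blast
  obtain s a where a: "s \<in> U" "a \<in> carrier R" "f s \<otimes>\<^bsub>L\<^esub> x = f a" using f_frac[OF xc] by blast
  have "f a \<in> Q'" using Q'.I_l_closed[OF x(1), of "f s"] a by simp
  moreover have "f a \<notin> Q" using unit_cancel_ideal[OF Q a(1) xc] a(3) x(2) by auto
  ultimately show ?thesis using a(2) lt by blast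
qed

end

text \<open>
  This covers homomorphic images and localizations at the same time: the preimage of an ideal is
  finitely generated, and the images of its generators suffice because units can be cancelled.
\<close>
lemma noetherian_transfer:
  assumes A: "noetherian_ring A" and B: "cring B" and h: "h \<in> ring_hom A B"
    and frac: "\<And>b. b \<in> carrier B \<Longrightarrow> \<exists>u\<in>Units B. \<exists>a\<in>carrier A. u \<otimes>\<^bsub>B\<^esub> b = h a"
  shows "noetherian_ring B"
proof -
  interpret A: noetherian_ring A by fact
  interpret B: cring B by fact
  interpret h: ring_hom_ring A B h
    by (intro ring_hom_ringI2 A.ring_axioms B.ring_axioms h)
  show ?thesis
  proof (intro noetherian_ring.intro noetherian_ring_axioms.intro B.ring_axioms)
    fix J assume J: "ideal J B"
    interpret J: ideal J B by fact
    have "ideal {r \<in> carrier A. h r \<in> J} A" by (rule h.ideal_vimage[OF J])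
    then obtain G where G: "G \<subseteq> carrier A" "finite G" "{r \<in> carrier A. h r \<in> J} = genideal A G"
      using A.finetely_gen by blast
    have c: "h ` G \<subseteq> carrier B" using G(1) by auto
    interpret I: ideal "genideal B (h ` G)" B by (rule B.genideal_ideal[OF c])
    have "genideal A G \<subseteq> {r \<in> carrier A. h r \<in> genideal B (h ` G)}"
      by (rule A.genideal_minimal[OF h.ideal_vimage[OF I.is_ideal]])
        (use G(1) B.genideal_self[OF c] in auto)
    then have 1: "h a \<in> genideal B (h ` G)" if "a \<in> carrier A" "h a \<in> J" for a
      using that G(3) by blast
    have "J \<subseteq> genideal B (h ` G)"
    proof
      fix b assume b: "b \<in> J"
      then have bc: "b \<in> carrier B" by (rule J.Icarr)
      obtain u a where u: "u \<in> Units B" "a \<in> carrier A" "u \<otimes>\<^bsub>B\<^esub> b = h a" using frac[OF bc] by blast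
      have "h a \<in> J" using J.I_l_closed[OF b, of u] u by (simp add: B.Units_closed)
      then have "inv\<^bsub>B\<^esub> u \<otimes>\<^bsub>B\<^esub> h a \<in> genideal B (h ` G)"
        using 1 u(1,2) by (intro I.I_l_closed) auto
      moreover have "inv\<^bsub>B\<^esub> u \<otimes>\<^bsub>B\<^esub> h a = b"
        using u(1) bc by (simp add: u(3)[symmetric] B.m_assoc[symmetric] B.Units_closed)
      ultimately show "b \<in> genideal B (h ` G)" by simp
    qed
    moreover have "genideal B (h ` G) \<subseteq> J"
      by (rule B.genideal_minimal[OF J]) (use G(3) A.genideal_self[OF G(1)] in blast)
    ultimately show "\<exists>A\<subseteq>carrier B. finite A \<and> J = genideal B A"
      using G(2) c by blast
  qed
qed

lemma (in fraction_map) noetherian_frac: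
  assumes "noetherian_ring R"
  shows "noetherian_ring L"
proof (rule noetherian_transfer[OF assms L.is_cring f_hom])
  fix x assume "x \<in> carrier L"
  then show "\<exists>u\<in>Units L. \<exists>a\<in>carrier R. u \<otimes>\<^bsub>L\<^esub> x = f a"
    using f_frac f_units by meson
qed

lemma (in multiplicative_subset) fraction_map_localization:
  "fraction_map R U {\<zero>} Loc (\<lambda>r. frac r \<one>)"
proof -
  interpret L: cring Loc by (rule Loc_cring)
  interpret Z: ideal "{\<zero>}" R by (rule zeroideal)
  show ?thesis
  proof unfold_locales
    show "(\<lambda>r. frac r \<one>) \<in> ring_hom R Loc"
      by (rule ring_hom_memI) auto
    show "frac s \<one> \<in> Units Loc" if "s \<in> U" for s
    proof -
      have "frac s s = frac \<one> \<one>" by (rule frac_eqI) (use that in simp_all)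
      then show ?thesis using that by (simp add: Units_def) (intro bexI[of _ "frac \<one> s"], simp_all)
    qed
    show "\<exists>s\<in>U. \<exists>a\<in>carrier R. frac s \<one> \<otimes>\<^bsub>Loc\<^esub> x = frac a \<one>" if x: "x \<in> carrier Loc" for x
    proof -
      obtain a s where "a \<in> carrier R" "s \<in> U" "x = frac a s" using x by (rule frac_cases)
      moreover from this have "frac (s \<otimes> a) s = frac a \<one>" by (intro frac_eqI) simp_all
      ultimately show ?thesis by (intro bexI[of _ s] bexI[of _ a]) simp_all
    qed
    show "frac r \<one> = \<zero>\<^bsub>Loc\<^esub> \<longleftrightarrow> (\<exists>u\<in>U. u \<otimes> r \<in> {\<zero>})" if "r \<in> carrier R" for r
      using that by (auto simp: frac_eq_iff)
  qed
qed

lemma prime_multiplicative_subset: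
  assumes "primeideal P R"
  shows "multiplicative_subset R (carrier R - P)"
proof -
  interpret primeideal P R by fact
  show ?thesis
    by unfold_locales (use I_prime one_imp_carrier I_notcarr in auto)
qed

lemma to_loc_fraction_map:
  assumes "primeideal P R"
  shows "fraction_map R (carrier R - P) {\<zero>\<^bsub>R\<^esub>} (localize_at R P) (to_loc R P)"
  using multiplicative_subset.fraction_map_localization[OF prime_multiplicative_subset[OF assms]]
  unfolding to_loc_def .

text \<open>
  With this the ideals that are intersected in a symbolic power are described inside \<open>R\<close>.
\<close>
lemma contract_extend_loc:
  assumes P: "primeideal P R" and I: "ideal I R"
  shows "contract_loc R P (extend_loc R P I) = {r \<in> carrier R. \<exists>u\<in>carrier R - P. u \<otimes>\<^bsub>R\<^esub> r \<in> I}"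
proof -
  interpret fraction_map R "carrier R - P" "{\<zero>\<^bsub>R\<^esub>}" "localize_at R P" "to_loc R P"
    by (rule to_loc_fraction_map[OF P])
  interpret I: ideal I R by fact
  show ?thesis
    unfolding contract_loc_def extend_loc_def genideal_image[OF I]
    using f_in_ext_iff[OF I] I.zero_closed by auto
qed

lemma (in fraction_map) fraction_map_quotient:
  assumes J: "ideal J R" "K \<subseteq> J"
  shows "fraction_map R U J (L Quot (ext J)) (\<lambda>r. ext J +>\<^bsub>L\<^esub> f r)"
proof -
  interpret J: ideal J R by fact
  interpret E: ideal "ext J" L by (rule ext_ideal[OF J(1)])
  interpret Q: cring "L Quot (ext J)" by (rule E.quotient_is_cring[OF L.is_cring])
  have hom: "(\<lambda>x. ext J +>\<^bsub>L\<^esub> x) \<in> ring_hom L (L Quot (ext J))" by (rule E.rcos_ring_hom)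
  show ?thesis
  proof unfold_locales
    show "(\<lambda>r. ext J +>\<^bsub>L\<^esub> f r) \<in> ring_hom R (L Quot (ext J))"
      using ring_hom_trans[OF f_hom hom] by (simp add: comp_def)
    show "ext J +>\<^bsub>L\<^esub> f s \<in> Units (L Quot (ext J))" if s: "s \<in> U" for s
    proof -
      obtain v where v: "v \<in> carrier L" "v \<otimes>\<^bsub>L\<^esub> f s = \<one>\<^bsub>L\<^esub>" "f s \<otimes>\<^bsub>L\<^esub> v = \<one>\<^bsub>L\<^esub>"
        using f_units[OF s] by (auto simp: Units_def)
      show ?thesis unfolding Units_def
        using v s ring_hom_mult[OF hom] ring_hom_closed[OF hom] ring_hom_one[OF hom]
        by (auto intro!: bexI[of _ "ext J +>\<^bsub>L\<^esub> v"] simp flip: ring_hom_mult[OF hom])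
    qed
    show "\<exists>s\<in>U. \<exists>a\<in>carrier R. (ext J +>\<^bsub>L\<^esub> f s) \<otimes>\<^bsub>L Quot ext J\<^esub> y = ext J +>\<^bsub>L\<^esub> f a"
      if y: "y \<in> carrier (L Quot ext J)" for y
    proof -
      obtain x where x: "x \<in> carrier L" "y = ext J +>\<^bsub>L\<^esub> x"
        using y by (auto simp: FactRing_def A_RCOSETS_def RCOSETS_def a_r_coset_def)
      obtain s a where a: "s \<in> U" "a \<in> carrier R" "f s \<otimes>\<^bsub>L\<^esub> x = f a" using f_frac[OF x(1)] by blast
      then show ?thesis using x ring_hom_mult[OF hom, of "f s" x] by (metis U_carr f_in_carr)
    qed
    show "ext J +>\<^bsub>L\<^esub> f r = \<zero>\<^bsub>L Quot ext J\<^esub> \<longleftrightarrow> (\<exists>u\<in>U. u \<otimes> r \<in> J)" if r: "r \<in> carrier R" for r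
    proof -
      have "ext J +>\<^bsub>L\<^esub> f r = ext J \<longleftrightarrow> f r \<in> ext J"
        using E.rcos_const_imp_mem[of "f r"] L.a_rcos_zero[OF E.is_ideal] r by auto
      then show ?thesis unfolding f_in_ext_iff[OF J r, symmetric] by (simp add: FactRing_def)
    qed
  qed
qed

section \<open>The symbolic powers of the edge ideal\<close>

text \<open>
  Index sets such as \<open>{1..n}\<close> and the exponent 1 occur throughout. Without this declaration the
  simplifier rewrites them to successor form, where they no longer match the lemmas below.
\<close>
declare One_nat_def [simp del]

definition origin_units :: "nat \<Rightarrow> ('k::field) mpoly set" where
  "origin_units n = {p \<in> polys n. cf p 0 \<noteq> 0}"

abbreviation origin_ideal :: "nat \<Rightarrow> ('k::field) mpoly set" where
  "origin_ideal n \<equiv> coord_power n {1..n} 1"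

text \<open>The \<open>k\<close>-th power of the prime ideal of the \<open>i\<close>-th coordinate axis.\<close>
abbreviation axis_power :: "nat \<Rightarrow> nat \<Rightarrow> nat \<Rightarrow> ('k::field) mpoly set" where
  "axis_power n i k \<equiv> coord_power n ({1..n} - {i}) k"

text \<open>
  The intersection of the \<open>k\<close>-th powers of the primes of the axes (\<open>edge_symbolic_iff\<close>). For \<open>k = 1\<close>
  it is the edge ideal (\<open>edge_ideal_eq\<close>), and in the local ring at the origin it extends to the
  \<open>k\<close>-th symbolic power (\<open>symbolic_power_edge_loc\<close>).
\<close>
definition edge_symbolic :: "nat \<Rightarrow> nat \<Rightarrow> ('k::field) mpoly set" where
  "edge_symbolic n k = poly_on {e \<in> expos n. \<forall>i\<in>{1..n}. k \<le> weight ({1..n} - {i}) e}"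

lemma expos_weight_zero: "e \<in> expos n \<Longrightarrow> weight {1..n} e = 0 \<Longrightarrow> e = 0"
  by (rule poly_mapping_eqI) (fastforce simp: weight_def expos_def in_keys_iff)

lemma origin_ideal_eq: "origin_ideal n = {p \<in> polys n. cf p 0 = 0}"
proof -
  have "p \<in> origin_ideal n \<longleftrightarrow> p \<in> polys n \<and> cf p 0 = 0" for p :: "'a mpoly"
  proof -
    have "p \<in> origin_ideal n \<longleftrightarrow> p \<in> polys n \<and> 0 \<notin> supp p"
      using expos_weight_zero[of _ n] by (fastforce simp: coord_power_def poly_on_def Suc_le_eq)
    then show ?thesis by (simp add: in_keys_iff)
  qed
  then show ?thesis by blast
qed

lemma origin_units_eq: "origin_units n = carrier (mon_ring (expos n)) - origin_ideal n"
  by (auto simp: origin_units_def origin_ideal_eq)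

lemma origin_units_polys: "u \<in> origin_units n \<Longrightarrow> u \<in> polys n"
  by (simp add: origin_units_def)

lemma coord_power_mono_set: "finite B \<Longrightarrow> A \<subseteq> B \<Longrightarrow> coord_power n A k \<subseteq> coord_power n B k"
  unfolding coord_power_def by (rule poly_on_mono) (auto simp: weight_def intro: order_trans sum_mono2)

lemma coord_power_1_origin_units: "A \<subseteq> {1..n} \<Longrightarrow> coord_power n A 1 \<inter> origin_units n = {}"
  using coord_power_mono_set[of "{1..n}" A n 1] by (auto simp: origin_units_eq)

text \<open>
  All ideals in the sequel are saturated in this sense, which is why their extensions to the
  local ring at the origin contract back to them.
\<close>
lemma coord_power_saturated:
  assumes "A \<subseteq> {1..n}" "u \<in> origin_units n" "p \<in> polys n" "u * p \<in> coord_power n A k"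
  shows "p \<in> coord_power n A k"
  using coord_power_primary[of u n A p k] coord_power_1_origin_units[OF assms(1)] assms by (auto simp: origin_units_polys)

lemma edge_symbolic_iff:
  assumes "n > 0"
  shows "p \<in> edge_symbolic n k \<longleftrightarrow> (\<forall>i\<in>{1..n}. p \<in> axis_power n i k)"
  using assms by (fastforce simp: edge_symbolic_def coord_power_def poly_on_def)

lemma edge_symbolic_polys: "edge_symbolic n k \<subseteq> polys n"
  unfolding edge_symbolic_def by (rule poly_on_mono) auto

lemma edge_symbolic_0: "edge_symbolic n 0 = polys n"
  by (simp add: edge_symbolic_def)

lemma edge_symbolic_mult: "p \<in> edge_symbolic n k \<Longrightarrow> q \<in> edge_symbolic n l \<Longrightarrow> p * q \<in> edge_symbolic n (k + l)"
  unfolding edge_symbolic_def by (erule (1) mult_in_poly_on) (auto simp: weight_add intro: add_in_expos add_mono)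

lemma edge_symbolic_ideal: "ideal (edge_symbolic n k) (mon_ring (expos n))"
  unfolding poly_ideal_iff using edge_symbolic_polys edge_symbolic_mult[of _ n k _ 0]
  by (auto simp: edge_symbolic_def intro: add_in_poly_on)

lemma edge_symbolic_saturated:
  assumes "n > 0" "u \<in> origin_units n" "p \<in> polys n" "u * p \<in> edge_symbolic n k"
  shows "p \<in> edge_symbolic n k"
  using assms coord_power_saturated[of _ n u p k] by (auto simp: edge_symbolic_iff)

lemma coord_power_1_subset_ideal:
  assumes J: "ideal J (mon_ring (expos n))" and A: "finite A" "\<And>i. i \<in> A \<Longrightarrow> mvar i \<in> J"
  shows "coord_power n A 1 \<subseteq> (J :: ('k::field) mpoly set)"
proof
  note J' = J[unfolded poly_ideal_iff]
  fix p :: "'k mpoly" assume "p \<in> coord_power n A 1"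
  then show "p \<in> J" unfolding coord_power_def
  proof (induction rule: poly_on_induct)
    case (mon e c)
    then have "weight A e \<noteq> 0" by simp
    then obtain i where i: "i \<in> A" "cf e i \<noteq> 0" unfolding weight_def by (meson sum.neutral)
    then have e: "e = mon i 1 + (e - mon i 1)"
      by (intro expo_diff) (auto simp: lookup_single "when_def")
    then have "mon e c = mvar i * mon (e - mon i 1) c" by (simp add: mvar_def mult_single)
    moreover have "e - mon i 1 \<in> expos n" using mon e add_in_expos_iff by (metis (no_types, lifting) mem_Collect_eq)
    ultimately show ?case using J' A(2)[OF i(1)] mon_in_poly_on by metis
  qed (use J' in auto)
qed

lemma vars_ideal_eq: "vars_ideal n = (origin_ideal n :: ('k::field) mpoly set)"
proof -
  interpret cring "mon_ring (expos n) :: 'k mpoly ring" by (rule poly_ring_cring)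
  have c: "mvar ` {1..n} \<subseteq> carrier (mon_ring (expos n) :: 'k mpoly ring)" by (auto intro: mvar_in)
  have "genideal (mon_ring (expos n)) (mvar ` {1..n}) \<subseteq> (origin_ideal n :: 'k mpoly set)"
    by (intro genideal_minimal coord_power_ideal) (auto simp: mvar_in_coord_power)
  moreover have "origin_ideal n \<subseteq> genideal (mon_ring (expos n) :: 'k mpoly ring) (mvar ` {1..n})"
    using genideal_self[OF c] by (intro coord_power_1_subset_ideal genideal_ideal c) auto
  ultimately show ?thesis unfolding vars_ideal_def poly_ring_upto_eq by blast
qed

lemma two_variables:
  assumes "n > 0" "\<And>i. i \<in> {1..n} \<Longrightarrow> 1 \<le> weight ({1..n} - {i}) e"
  obtains a b where "a \<in> {1..n}" "b \<in> {1..n}" "a < b" "cf e a \<noteq> 0" "cf e b \<noteq> 0"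
proof -
  have ex: "\<exists>j\<in>{1..n} - {i}. cf e j \<noteq> 0" if i: "i \<in> {1..n}" for i
  proof (rule ccontr)
    assume "\<not> ?thesis"
    then have "weight ({1..n} - {i}) e = 0" unfolding weight_def by (intro sum.neutral) auto
    then show False using assms(2)[OF i] by simp
  qed
  have "1 \<in> {1..n}" using assms(1) by simp
  from ex[OF this] obtain a where a: "a \<in> {1..n}" "cf e a \<noteq> 0" by blast
  obtain b where b: "b \<in> {1..n}" "b \<noteq> a" "cf e b \<noteq> 0" using ex[OF a(1)] by blast
  show thesis using that[of a b] that[of b a] a b by (cases "a < b") auto
qed

lemma mvar_mult_in_edge_symbolic:
  assumes "a \<in> {1..n}" "b \<in> {1..n}" "a \<noteq> b"
  shows "mvar a ^ k * mvar b ^ k \<in> edge_symbolic n k"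
  unfolding edge_symbolic_def mvar_power mult_single
  using assms by (intro mon_in_poly_on) (auto simp: weight_add weight_single intro!: add_in_expos single_in_expos)

text \<open>
  A monomial lies in the primes of all axes iff it involves at least two distinct variables. For
  \<open>n = 1\<close> there are no edges, and the prime of the only axis is the zero ideal.
\<close>
lemma edge_ideal_eq:
  assumes n: "n > 0"
  shows "edge_ideal n (complete_graph_edges n) = (edge_symbolic n 1 :: ('k::field) mpoly set)"
proof -
  interpret cring "mon_ring (expos n) :: 'k mpoly ring" by (rule poly_ring_cring)
  let ?G = "{mvar i * mvar j | i j. i < j \<and> {i, j} \<in> complete_graph_edges n} :: 'k mpoly set"
  have G: "?G = {mvar i * mvar j | i j. 1 \<le> i \<and> i < j \<and> j \<le> n}"
    unfolding complete_graph_edges_def by (fastforce simp: doubleton_eq_iff)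
  have c: "?G \<subseteq> carrier (mon_ring (expos n))" unfolding G by (auto intro!: polys_mult mvar_in)
  have "genideal (mon_ring (expos n)) ?G \<subseteq> edge_symbolic n 1"
    unfolding G using mvar_mult_in_edge_symbolic[where k = 1 and n = n and ?'a = 'k]
    by (intro genideal_minimal edge_symbolic_ideal) auto
  moreover have "edge_symbolic n 1 \<subseteq> genideal (mon_ring (expos n)) ?G"
  proof
    note J' = genideal_ideal[OF c, unfolded poly_ideal_iff]
    fix p :: "'k mpoly" assume "p \<in> edge_symbolic n 1"
    then show "p \<in> genideal (mon_ring (expos n)) ?G" unfolding edge_symbolic_def
    proof (induction rule: poly_on_induct)
      case (mon e d)
      then have "\<And>i. i \<in> {1..n} \<Longrightarrow> 1 \<le> weight ({1..n} - {i}) e" by simp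
      then obtain a b where ab: "a \<in> {1..n}" "b \<in> {1..n}" "a < b" "cf e a \<noteq> 0" "cf e b \<noteq> 0"
        using two_variables[OF n, of e] by blast
      then have e: "e = (mon a 1 + mon b 1) + (e - (mon a 1 + mon b 1))"
        by (intro expo_diff) (auto simp: lookup_single lookup_add "when_def")
      then have "mon e d = mvar a * mvar b * mon (e - (mon a 1 + mon b 1)) d"
        by (simp add: mvar_def mult_single)
      moreover have "e - (mon a 1 + mon b 1) \<in> expos n"
        using mon e add_in_expos_iff by (metis (no_types, lifting) mem_Collect_eq)
      moreover have "mvar a * mvar b \<in> genideal (mon_ring (expos n)) ?G"
        by (rule set_mp[OF genideal_self[OF c]], unfold G) (use ab in auto)
      ultimately show ?case
        using J'[THEN conjunct2, THEN conjunct2, THEN conjunct2] by (simp add: mon_in_poly_on)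
    qed (use J' in auto)
  qed
  ultimately show ?thesis unfolding edge_ideal_def poly_ring_upto_eq by blast
qed

section \<open>Dimension and depth along the coordinate axes\<close>

lemma prime_power_mem:
  assumes "primeideal P (mon_ring (expos n))" "p \<in> polys n" "p ^ m \<in> P"
  shows "p \<in> P"
  using assms(3)
proof (induction m)
  case 0
  then show ?case using assms(1) by (simp add: poly_ideal_prime_iff)
next
  case (Suc m)
  then show ?case using assms(1,2) polys_power[OF assms(2)] by (auto simp: poly_ideal_prime_iff)
qed

text \<open>
  The symbolic power contains \<open>(x\<^sub>i x\<^sub>j)\<^sup>k\<close>, so a prime over it misses at most one variable.
\<close>
lemma prime_contains_axis:
  assumes P: "primeideal P (mon_ring (expos n) :: ('k::field) mpoly ring)" and n: "n > 0" and J: "edge_symbolic n k \<subseteq> P"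
  shows "\<exists>i\<in>{1..n}. axis_power n i 1 \<subseteq> P"
proof (cases "\<exists>i\<in>{1..n}. mvar i \<notin> P")
  case True
  then obtain i where i: "i \<in> {1..n}" "mvar i \<notin> P" by blast
  have "mvar j \<in> P" if j: "j \<in> {1..n} - {i}" for j
  proof -
    have "mvar i ^ k * mvar j ^ k \<in> P" using mvar_mult_in_edge_symbolic[of i n j k] i j J by auto
    then have "mvar i ^ k \<in> P \<or> mvar j ^ k \<in> P"
      using P polys_power mvar_in i j unfolding poly_ideal_prime_iff by blast
    then show ?thesis using prime_power_mem[OF P] mvar_in i j by blast
  qed
  then show ?thesis
    using i(1) P coord_power_1_subset_ideal[of P n "{1..n} - {i}"] by (auto simp: poly_ideal_prime_iff)
next
  case False
  then show ?thesis
    using n P coord_power_1_subset_ideal[of P n "{1..n} - {1}"]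
    by (intro bexI[of _ 1]) (auto simp: poly_ideal_prime_iff)
qed

text \<open>
  The smallest prime contains the prime of an axis. By the decomposition along this axis, the middle
  prime contains the remaining variable too, so it is already the ideal of the origin.
\<close>
lemma no_three_primes:
  assumes n: "n > 0"
    and P: "primeideal P0 (mon_ring (expos n))" "primeideal P1 (mon_ring (expos n))"
    and lt: "P0 \<subset> P1" "P1 \<subset> P2" and J: "edge_symbolic n k \<subseteq> P0" and U: "P2 \<subseteq> origin_ideal n"
  shows False
proof -
  obtain i where i: "i \<in> {1..n}" "axis_power n i 1 \<subseteq> P0" using prime_contains_axis[OF P(1) n J] by blast
  obtain p where p: "p \<in> P1" "p \<notin> P0" using lt by blast
  have pS: "p \<in> polys n" using p(1) P(2) by (auto simp: poly_ideal_prime_iff poly_ideal_iff)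
  obtain c h q where d: "p = mvar i ^ c * h + q" "h \<in> polys n" "cf h 0 \<noteq> 0" "q \<in> axis_power n i 1"
    using axis_decomposition[OF pS _ i(1)] i(2) p(2) by blast
  have "p - q \<in> P1" using poly_ideal_diff[of P1 n p q] p(1) P(2) d(4) i(2) lt by (auto simp: poly_ideal_prime_iff)
  then have "mvar i ^ c * h \<in> P1" using d(1) by simp
  moreover have "h \<notin> P1" using lt U d(3) by (auto simp: origin_ideal_eq)
  ultimately have "mvar i ^ c \<in> P1"
    using P(2) d(2) polys_power[OF mvar_in[OF i(1)]] unfolding poly_ideal_prime_iff by blast
  then have "mvar i \<in> P1" using prime_power_mem[OF P(2) mvar_in[OF i(1)]] by blast
  moreover have "mvar j \<in> P1" if "j \<in> {1..n} - {i}" for j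
    using that mvar_in_coord_power[of j n "{1..n} - {i}"] i(2) lt by auto
  ultimately have "mvar j \<in> P1" if "j \<in> {1..n}" for j using that by blast
  then have "origin_ideal n \<subseteq> P1" using P(2) by (intro coord_power_1_subset_ideal) (auto simp: poly_ideal_prime_iff)
  then show False using lt U by blast
qed

lemma axis_power_times:
  assumes "n > 0" "i \<in> {1..n}" "q \<in> axis_power n i k"
  shows "mvar i ^ k * q \<in> edge_symbolic n k"
  unfolding edge_symbolic_iff[OF assms(1)]
proof
  fix j assume j: "j \<in> {1..n}"
  have qS: "q \<in> polys n" using assms(3) coord_power_subset by blast
  show "mvar i ^ k * q \<in> axis_power n j k"
  proof (cases "j = i")
    case True
    then show ?thesis
      using coord_power_mult_polys[OF assms(3) polys_power[OF mvar_in[OF assms(2)]]] by (simp add: mult.commute)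
  next
    case False
    then show ?thesis using qS assms(2) j by (intro coord_power_mult_polys) (auto simp: mvar_power_in_coord_power)
  qed
qed

text \<open>
  In the application \<open>p1\<close> and \<open>p2\<close> represent the first two elements of a regular sequence in the quotient
  by the symbolic power, and \<open>g\<close> is the contraction of the ideal generated by the first. Being a
  nonzerodivisor, \<open>p1\<close> vanishes on no axis, so along each axis it generates
  a power of the variable. Hence \<open>g\<close> contains a power of every variable and with it a
  power of \<open>p2\<close>, which regularity of \<open>p2\<close> turns into 1.
\<close>
lemma no_regular_pair:
  fixes g :: "('k::field) mpoly set"
  assumes n: "n > 0" and k: "k > 0" and p1: "p1 \<in> polys n" and p2: "p2 \<in> origin_ideal n"
    and g: "ideal g (mon_ring (expos n))" "edge_symbolic n k \<subseteq> g" "p1 \<in> g"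
    and r1: "\<And>z. z \<in> polys n \<Longrightarrow> p1 * z \<in> edge_symbolic n k \<Longrightarrow> z \<in> edge_symbolic n k"
    and u: "\<And>h z. h \<in> origin_units n \<Longrightarrow> z \<in> polys n \<Longrightarrow> h * z \<in> g \<Longrightarrow> z \<in> g"
    and r2: "\<And>z. z \<in> polys n \<Longrightarrow> p2 * z \<in> g \<Longrightarrow> z \<in> g"
  shows "1 \<in> g"
proof -
  note g' = g(1)[unfolded poly_ideal_iff]
  have notin: "p1 \<notin> axis_power n i 1" if i: "i \<in> {1..n}" for i
  proof
    assume "p1 \<in> axis_power n i 1"
    then have "p1 ^ k \<in> axis_power n i k" by (rule coord_power_power)
    then have *: "p1 ^ k * mvar i ^ k \<in> edge_symbolic n k" using axis_power_times[OF n i] by (simp add: mult.commute)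
    have xS: "(mvar i ^ k :: 'k mpoly) \<in> polys n" using polys_power mvar_in[OF i] by blast
    have "z \<in> edge_symbolic n k" if "p1 ^ m * z \<in> edge_symbolic n k" "z \<in> polys n" for z m
      using that
    proof (induction m)
      case (Suc m)
      then show ?case
        using r1[OF polys_mult[OF polys_power[OF p1, of m] Suc.prems(2)]] by (simp add: mult.assoc)
    qed simp
    then have "(mvar i ^ k :: 'k mpoly) \<in> edge_symbolic n k" using * xS by blast
    then have "mvar i ^ k \<in> (axis_power n i k :: 'k mpoly set)" using edge_symbolic_iff[OF n] i by blast
    then show False using mvar_power_in_coord_power[of i n "{1..n} - {i}" k k] i k by auto
  qed
  have "\<exists>M. mvar i ^ M \<in> g" if i: "i \<in> {1..n}" for i
  proof -
    let ?x = "mvar i :: 'k mpoly"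
    have xS: "?x ^ m \<in> polys n" for m using polys_power mvar_in[OF i] by blast
    obtain c h q where d: "p1 = ?x ^ c * h + q" "h \<in> polys n" "cf h 0 \<noteq> 0" "q \<in> axis_power n i 1"
      using axis_decomposition[OF p1 notin[OF i] i] by blast
    have mq: "- q \<in> axis_power n i 1" using poly_ideal_uminus[OF coord_power_ideal d(4)] .
    have qS: "- q \<in> polys n" using mq coord_power_subset by blast
    \<comment> \<open>modulo \<open>p1\<close>, the element \<open>x\<^sub>i\<^sup>c h\<close> is \<open>- q\<close>, whose \<open>k\<close>-th power is taken into the symbolic power by \<open>x\<^sub>i\<^sup>k\<close>\<close>
    have "(?x ^ c * h) ^ m - (- q) ^ m \<in> g" for m
    proof (induction m)
      case 0
      then show ?case using g' by simp
    next
      case (Suc m)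
      have "(?x ^ c * h) ^ Suc m - (- q) ^ Suc m =
        p1 * (?x ^ c * h) ^ m + ((?x ^ c * h) ^ m - (- q) ^ m) * (- q)"
        unfolding d(1) by (simp add: algebra_simps)
      also have "\<dots> \<in> g"
        using Suc.IH g' g(3) qS polys_power[OF polys_mult[OF xS[of c] d(2)], of m] by blast
      finally show ?case .
    qed
    then have "((?x ^ c * h) ^ k - (- q) ^ k) * ?x ^ k + ?x ^ k * (- q) ^ k \<in> g"
      using g' xS axis_power_times[OF n i coord_power_power[OF mq]] g(2) by blast
    also have "((?x ^ c * h) ^ k - (- q) ^ k) * ?x ^ k + ?x ^ k * (- q) ^ k = h ^ k * ?x ^ (c * k + k)"
      by (simp add: algebra_simps power_mult_distrib power_add power_mult)
    finally have hk: "h ^ k * ?x ^ (c * k + k) \<in> g" .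
    have hU: "h \<in> origin_units n" using d by (simp add: origin_units_def)
    have "z \<in> g" if "h ^ m * z \<in> g" "z \<in> polys n" for m z
      using that
    proof (induction m)
      case (Suc m)
      then show ?case
        using u[OF _ polys_mult[OF polys_power[OF d(2), of m] Suc.prems(2)]] hU
        by (simp add: mult.assoc)
    qed simp
    then show ?thesis using hk xS by blast
  qed
  then obtain Mi where Mi: "\<And>i. i \<in> {1..n} \<Longrightarrow> mvar i ^ Mi i \<in> g" by metis
  define M where "M = (\<Sum>i\<in>{1..n}. Mi i)"
  have M: "mvar i ^ M \<in> g" if i: "i \<in> {1..n}" for i
  proof -
    have "Mi i \<le> M" unfolding M_def using i by (intro member_le_sum) auto
    then have "mvar i ^ M = mvar i ^ Mi i * (mvar i ^ (M - Mi i) :: 'k mpoly)" by (simp flip: power_add)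
    then show ?thesis using Mi[OF i] g' polys_power[OF mvar_in[OF i]] by metis
  qed
  \<comment> \<open>a monomial of degree above \<open>n M\<close> has some exponent at least \<open>M\<close>\<close>
  define N where "N = n * M + 1"
  have filg: "coord_power n {1..n} N \<subseteq> g"
  proof
    fix p :: "'k mpoly" assume "p \<in> coord_power n {1..n} N"
    then show "p \<in> g" unfolding coord_power_def
    proof (induction rule: poly_on_induct)
      case (mon e c)
      have "\<exists>i\<in>{1..n}. M \<le> cf e i"
      proof (rule ccontr)
        assume "\<not> ?thesis"
        then have "cf e j \<le> M" if "j \<in> {1..n}" for j using that by (meson nat_le_linear)
        then have "weight {1..n} e \<le> n * M"
          unfolding weight_def using sum_bounded_above[of "{1..n}" "\<lambda>j. cf e j" M] by simp
        then show False using mon by (simp add: N_def)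
      qed
      then obtain i where i: "i \<in> {1..n}" "M \<le> cf e i" by blast
      then have e: "e = mon i M + (e - mon i M)"
        by (intro expo_diff) (auto simp: lookup_single "when_def")
      then have "mon e c = mvar i ^ M * mon (e - mon i M) c" by (simp add: mvar_power mult_single)
      moreover have "e - mon i M \<in> expos n" using mon e add_in_expos_iff by (metis (no_types, lifting) mem_Collect_eq)
      ultimately show ?case using g' M[OF i(1)] mon_in_poly_on by metis
    qed (use g' in auto)
  qed
  have "p2 ^ N * 1 \<in> g" using coord_power_power[OF p2, of N] filg by auto
  moreover have "z \<in> g" if "p2 ^ m * z \<in> g" "z \<in> polys n" for m z
    using that
  proof (induction m)
    case (Suc m)
    have "p2 \<in> polys n" using p2 coord_power_subset by blast
    then show ?case
      using Suc r2[OF polys_mult[OF polys_power[of p2 n m] Suc.prems(2)]] by (simp add: mult.assoc)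
  qed simp
  ultimately show ?thesis using polys_one by blast
qed

section \<open>Quotients of the local ring at the origin\<close>

lemma local_ringI:
  assumes B: "cring B" and M: "ideal M B" "\<one>\<^bsub>B\<^esub> \<notin> M"
    and U: "\<And>x. x \<in> carrier B \<Longrightarrow> x \<notin> M \<Longrightarrow> x \<in> Units B"
  shows "local_ring B" "the_max_ideal B = M"
proof -
  interpret cring B by fact
  interpret M: ideal M B by fact
  have proper: "J \<subseteq> M" if J: "ideal J B" "\<one>\<^bsub>B\<^esub> \<notin> J" for J
  proof
    interpret J: ideal J B by fact
    fix x assume x: "x \<in> J"
    show "x \<in> M"
    proof (rule ccontr)
      assume "x \<notin> M"
      then have "x \<in> Units B" using U x J.Icarr by blast
      then have "inv\<^bsub>B\<^esub> x \<otimes>\<^bsub>B\<^esub> x = \<one>\<^bsub>B\<^esub>" "inv\<^bsub>B\<^esub> x \<in> carrier B" by auto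
      then show False using J.I_l_closed[OF x, of "inv\<^bsub>B\<^esub> x"] J(2) by simp
    qed
  qed
  have max: "maximalideal M B"
  proof (rule maximalidealI)
    show "carrier B \<noteq> M" using M(2) by blast
    show "J = M \<or> J = carrier B" if "ideal J B" "M \<subseteq> J" for J
      using proper[OF that(1)] that ideal.one_imp_carrier[OF that(1)] by blast
  qed (rule M(1))
  have uniq: "M' = M" if M': "maximalideal M' B" for M'
  proof -
    interpret M': maximalideal M' B by fact
    have "\<one>\<^bsub>B\<^esub> \<notin> M'" using M'.one_imp_carrier M'.I_notcarr by auto
    then have sub: "M' \<subseteq> M" by (rule proper[OF M'.is_ideal])
    have "M \<noteq> carrier B" using M(2) one_closed by metis
    then show ?thesis using M'.I_maximal[OF M(1) sub M.a_subset] by simp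
  qed
  show "local_ring B" unfolding local_ring_def
    by (intro conjI B ex1I[of _ M] max) (rule uniq)
  show "the_max_ideal B = M" unfolding the_max_ideal_def
    by (intro the_equality max) (rule uniq)
qed

context fraction_map
begin

lemma ext_iff:
  assumes x: "x \<in> carrier L" "s \<in> U" "p \<in> carrier R" "f s \<otimes>\<^bsub>L\<^esub> x = f p"
    and I: "ideal I R" "K \<subseteq> I" "\<And>u r. u \<in> U \<Longrightarrow> r \<in> carrier R \<Longrightarrow> u \<otimes> r \<in> I \<Longrightarrow> r \<in> I"
  shows "x \<in> ext I \<longleftrightarrow> p \<in> I"
proof
  interpret E: ideal "ext I" L by (rule ext_ideal[OF I(1)])
  show "p \<in> I" if "x \<in> ext I"
    using E.I_l_closed[OF that, of "f s"] x f_in_ext_iff[OF I(1,2) x(3)] I(3)[OF _ x(3)] by auto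
  show "x \<in> ext I" if "p \<in> I" using x that by (intro extI)
qed

lemma frac_local:
  assumes m: "primeideal m R" "K \<subseteq> m" and U: "U = carrier R - m"
  shows "local_ring L" "the_max_ideal L = ext m"
proof -
  interpret m: primeideal m R by fact
  have d: "m \<inter> U = {}" using U by auto
  interpret E: primeideal "ext m" L by (rule ext_prime(1)[OF m d])
  have 1: "\<one>\<^bsub>L\<^esub> \<notin> ext m" using E.one_imp_carrier E.I_notcarr by auto
  have 2: "x \<in> Units L" if x: "x \<in> carrier L" "x \<notin> ext m" for x
  proof -
    obtain s a where a: "s \<in> U" "a \<in> carrier R" "f s \<otimes>\<^bsub>L\<^esub> x = f a" using f_frac[OF x(1)] by blast
    then have "a \<in> U" using x extI U by blast
    then have "f s \<otimes>\<^bsub>L\<^esub> x \<in> Units L" using f_units a(3) by simp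
    then show ?thesis using a(1) x(1) L.unit_factor[of x "f s"] by (simp add: L.m_comm)
  qed
  show "local_ring L" "the_max_ideal L = ext m"
    using local_ringI[OF L.is_cring E.is_ideal 1 2] by auto
qed

lemma contract_disjoint:
  assumes "primeideal Q L"
  shows "{r \<in> carrier R. f r \<in> Q} \<inter> U = {}"
proof -
  interpret Q: primeideal Q L by fact
  have "False" if s: "s \<in> U" "f s \<in> Q" for s
  proof -
    obtain v where "v \<in> carrier L" "v \<otimes>\<^bsub>L\<^esub> f s = \<one>\<^bsub>L\<^esub>"
      using f_units[OF s(1)] by (auto simp: Units_def)
    then have "\<one>\<^bsub>L\<^esub> \<in> Q" using Q.I_l_closed[OF s(2), of v] by simp
    then show False using Q.one_imp_carrier Q.I_notcarr by auto
  qed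
  then show ?thesis by blast
qed

end

text \<open>
  Here \<open>L\<close> is the quotient of the local ring at the origin by the extension of the saturated
  ideal \<open>K\<close>.
\<close>
locale origin_quotient = fraction_map "mon_ring (expos n) :: ('k::field) mpoly ring" "origin_units n" K L f
  for n :: nat and K and L :: "('b, 'c) ring_scheme" and f +
  assumes n_pos: "n > 0"
    and K_origin_ideal: "K \<subseteq> origin_ideal n"
    and K_sat: "\<lbrakk>u \<in> origin_units n; p \<in> polys n; u * p \<in> K\<rbrakk> \<Longrightarrow> p \<in> K"
begin

lemma f_zero_iff: "p \<in> polys n \<Longrightarrow> f p = \<zero>\<^bsub>L\<^esub> \<longleftrightarrow> p \<in> K"
  using f_ker[of p] K_sat U_one by (auto intro!: bexI[of _ 1])

lemma origin_ideal_prime: "primeideal (origin_ideal n) (mon_ring (expos n))"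
  by (rule coord_power_prime)

lemma L_local: "local_ring L" "the_max_ideal L = ext (origin_ideal n)"
  using frac_local[OF origin_ideal_prime K_origin_ideal origin_units_eq] by auto

lemma L_noetherian: "noetherian_ring L"
  by (rule noetherian_frac[OF mon_ring_noetherian[OF dickson_monoid_expos]])

abbreviation contraction :: "'b set \<Rightarrow> 'k mpoly set" where
  "contraction Q \<equiv> {p \<in> polys n. f p \<in> Q}"

lemma contraction_prime:
  assumes "primeideal Q L"
  shows "primeideal (contraction Q) (mon_ring (expos n))" "K \<subseteq> contraction Q" "contraction Q \<subseteq> origin_ideal n"
  using contract_prime[OF assms] contract_disjoint[OF assms] origin_units_eq[of n] by auto

lemma contraction_ideal: "ideal Q L \<Longrightarrow> ideal (contraction Q) (mon_ring (expos n))"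
  using ring_hom_ring.ideal_vimage[OF f_ring_hom_ring] by simp

lemma contraction_strict:
  assumes "primeideal Q L" "primeideal Q' L" "Q \<subset> Q'"
  shows "contraction Q \<subset> contraction Q'"
  using contract_strict[OF _ _ assms(3)] assms(1,2) by (simp add: primeideal.axioms)

lemma chain_nth:
  assumes "prime_chain L Ps"
  shows "\<And>j. j < length Ps \<Longrightarrow> primeideal (Ps ! j) L" "\<And>i j. i < j \<Longrightarrow> j < length Ps \<Longrightarrow> Ps ! i \<subset> Ps ! j"
  using assms sorted_wrt_nth_less[of "(\<subset>)" Ps] unfolding prime_chain_def by auto

text \<open>Contraction to the polynomial ring preserves strict chains of primes.\<close>
lemma chain_length:
  assumes "prime_chain L Ps"
  shows "length Ps \<le> n + 1"
proof (rule ccontr)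
  assume l: "\<not> ?thesis"
  show False
  proof (rule no_long_prime_chain[of n "\<lambda>j. contraction (Ps ! j)"])
    show "primeideal (contraction (Ps ! j)) (mon_ring (expos n))" if "j \<le> n + 1" for j
      using l that chain_nth[OF assms] by (intro contraction_prime) auto
    show "contraction (Ps ! j) \<subset> contraction (Ps ! Suc j)" if "j \<le> n" for j
      using l that chain_nth[OF assms] by (intro contraction_strict) auto
  qed
qed

lemma coord_power_ext_prime:
  assumes "A \<subseteq> {1..n}" "K \<subseteq> coord_power n A 1"
  shows "primeideal (ext (coord_power n A 1)) L" "\<And>p. p \<in> polys n \<Longrightarrow> f p \<in> ext (coord_power n A 1) \<longleftrightarrow> p \<in> coord_power n A 1"
  using ext_prime[OF coord_power_prime assms(2) coord_power_1_origin_units[OF assms(1)]] by auto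

lemma coord_power_ext_strict:
  assumes "A \<subset> B" "B \<subseteq> {1..n}" "K \<subseteq> coord_power n A 1"
  shows "ext (coord_power n A 1) \<subset> ext (coord_power n B 1)"
proof -
  have sub': "A \<subseteq> {1..n}" using assms(1,2) by blast
  have fin: "A \<subseteq> {1..n}" "finite A" "finite B"
    using sub' finite_subset[OF sub'] finite_subset[OF assms(2)] by auto
  have sub: "coord_power n A 1 \<subseteq> coord_power n B 1" using fin(3) assms(1) by (intro coord_power_mono_set) auto
  obtain j where j: "j \<in> B" "j \<notin> A" using assms(1) by blast
  have j1: "j \<in> {1..n}" using j assms(2) by blast
  have "f (mvar j) \<in> ext (coord_power n B 1)" "f (mvar j) \<notin> ext (coord_power n A 1)"
    using coord_power_ext_prime(2)[of B "mvar j"] coord_power_ext_prime(2)[of A "mvar j"] j j1 fin assms sub mvar_in[OF j1]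
    by (auto simp: mvar_in_coord_power[OF j1])
  then show ?thesis using ext_mono[OF sub] by blast
qed

text \<open>
  Dimension and depth are both 1. The upper bounds are \<open>no_three_primes\<close> and \<open>no_regular_pair\<close>,
  applied to contractions to the polynomial ring. The dimension is attained by the prime of any axis and the
  maximal ideal, the depth by the sum of the variables.
\<close>
lemma cohen_macaulay:
  assumes K: "K = edge_symbolic n k" and k: "k > 0"
  shows "cohen_macaulay_local L"
proof -
  have n1: "1 \<in> {1..n}" using n_pos by simp
  have K1: "K \<subseteq> axis_power n i 1" if "i \<in> {1..n}" for i
  proof -
    have "(axis_power n i k :: 'k mpoly set) \<subseteq> axis_power n i 1" unfolding coord_power_def using k by (intro poly_on_mono) auto
    then show ?thesis unfolding K using edge_symbolic_iff[OF n_pos, of _ k] that by blast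
  qed
  have chain2: "length Ps \<le> 2" if Ps: "prime_chain L Ps" for Ps
  proof (rule ccontr)
    assume "\<not> ?thesis"
    then have l: "2 < length Ps" by simp
    note c = chain_nth[OF Ps]
    have p: "primeideal (Ps ! 0) L" "primeideal (Ps ! 1) L" "primeideal (Ps ! 2) L"
      by (rule c(1), use l in linarith)+
    have s: "Ps ! 0 \<subset> Ps ! 1" "Ps ! 1 \<subset> Ps ! 2" using c(2)[of 0 1] c(2)[of 1 2] l by auto
    show False
      using no_three_primes[OF n_pos contraction_prime(1)[OF p(1)] contraction_prime(1)[OF p(2)]
          contraction_strict[OF p(1,2) s(1)] contraction_strict[OF p(2,3) s(2)] _ contraction_prime(3)[OF p(3)], of k]
        contraction_prime(2)[OF p(1)] K by blast
  qed
  have "{1..n} - {1} \<subset> {1..n}" using n1 by blast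
  then have "ext (axis_power n 1 1) \<subset> ext (origin_ideal n)" using coord_power_ext_strict[OF _ _ K1[OF n1]] by simp
  then have "prime_chain L [ext (axis_power n 1 1), ext (origin_ideal n)]"
    unfolding prime_chain_def
    using coord_power_ext_prime(1)[of "{1..n} - {1}"] coord_power_ext_prime(1)[of "{1..n}"] K1[OF n1] K_origin_ideal by auto
  then have "\<exists>Ps. prime_chain L Ps \<and> length Ps = Suc 1" by (intro exI conjI) auto
  then have "enat 1 \<le> krull_dim L" unfolding krull_dim_def by (intro Sup_upper) blast
  moreover have "krull_dim L \<le> enat 1"
    unfolding krull_dim_def using chain2 by (intro Sup_least) (fastforce simp: One_nat_def)
  ultimately have dim: "krull_dim L = enat 1" by simp

  let ?l = "\<Sum>i\<in>{1..n}. mvar i :: 'k mpoly"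
  have lS: "?l \<in> polys n" by (intro sum_in_poly_on mvar_in)
  have lm: "?l \<in> origin_ideal n" by (intro poly_ideal_sum[OF coord_power_ideal]) (auto simp: mvar_in_coord_power)
  have lax: "?l \<notin> axis_power n i 1" if i: "i \<in> {1..n}" for i
  proof
    assume "?l \<in> axis_power n i 1"
    moreover have "(\<Sum>j\<in>{1..n} - {i}. mvar j) \<in> (axis_power n i 1 :: 'k mpoly set)"
      by (intro poly_ideal_sum[OF coord_power_ideal]) (auto simp: mvar_in_coord_power)
    moreover have "?l = mvar i + (\<Sum>j\<in>{1..n} - {i}. mvar j)" using i by (intro sum.remove) auto
    ultimately have "mvar i \<in> (axis_power n i 1 :: 'k mpoly set)"
      using poly_ideal_diff[OF coord_power_ideal, of ?l n _ _ "\<Sum>j\<in>{1..n} - {i}. mvar j"] by simp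
    then show False using i by (simp add: mvar_in_coord_power)
  qed
  have lreg: "z \<in> K" if "z \<in> polys n" "?l * z \<in> K" for z
    using that coord_power_primary[OF lS lax, of _ z k] unfolding K edge_symbolic_iff[OF n_pos] by blast
  have gen0: "genideal L {} = {\<zero>\<^bsub>L\<^esub>}"
    using L.genideal_minimal[OF L.zeroideal, of "{}"]
      additive_subgroup.zero_closed[OF ideal.axioms(1)[OF L.genideal_ideal[of "{}"]]] by auto
  have mprime: "primeideal (ext (origin_ideal n)) L" using coord_power_ext_prime(1)[of "{1..n}"] K_origin_ideal by simp
  have one_notin: "\<one>\<^bsub>L\<^esub> \<notin> ext (origin_ideal n)"
    using ideal.one_imp_carrier[OF primeideal.axioms(1)[OF mprime]] primeideal.I_notcarr[OF mprime] by auto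
  have fl: "f ?l \<in> ext (origin_ideal n)" using f_in_ext[OF lm] lS by simp
  have "regular_sequence L [f ?l]"
    unfolding regular_sequence_def
  proof (intro conjI allI impI ballI)
    show "set [f ?l] \<subseteq> carrier L" using lS by simp
    have "genideal L (set [f ?l]) \<subseteq> ext (origin_ideal n)"
      using fl by (intro L.genideal_minimal ext_ideal coord_power_ideal) auto
    then show "genideal L (set [f ?l]) \<noteq> carrier L" using one_notin by blast
    fix i r assume i: "i < length [f ?l]" and r: "r \<in> carrier L"
      and h: "[f ?l] ! i \<otimes>\<^bsub>L\<^esub> r \<in> genideal L (set (take i [f ?l]))"
    have i0: "i = 0" using i by simp
    then have h0: "f ?l \<otimes>\<^bsub>L\<^esub> r = \<zero>\<^bsub>L\<^esub>" using h gen0 by simp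
    obtain s a where a: "s \<in> origin_units n" "a \<in> polys n" "f s \<otimes>\<^bsub>L\<^esub> r = f a" using f_frac[OF r] by auto
    have sS: "s \<in> polys n" using a(1) origin_units_polys by blast
    have "f (?l * a) = f ?l \<otimes>\<^bsub>L\<^esub> f a" using f.hom_mult[of ?l a] lS a(2) by simp
    also have "\<dots> = f s \<otimes>\<^bsub>L\<^esub> (f ?l \<otimes>\<^bsub>L\<^esub> r)"
      unfolding a(3)[symmetric] using lS sS r by (intro L.m_lcomm) auto
    also have "\<dots> = \<zero>\<^bsub>L\<^esub>" using h0 sS by simp
    finally have "?l * a \<in> K" using f_zero_iff polys_mult[OF lS a(2)] by blast
    then have "f a = \<zero>\<^bsub>L\<^esub>" using lreg[OF a(2)] f_zero_iff a(2) by blast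
    then have "r \<in> {\<zero>\<^bsub>L\<^esub>}" using unit_cancel_ideal[OF L.zeroideal a(1) r] a(3) by simp
    then show "r \<in> genideal L (set (take i [f ?l]))" using i0 gen0 by simp
  qed
  then have "\<exists>xs. enat 1 = enat (length xs) \<and> set xs \<subseteq> the_max_ideal L \<and> regular_sequence L xs"
    using fl L_local(2) by (intro exI[of _ "[f ?l]"]) (auto simp: One_nat_def)
  then have depth1: "enat 1 \<le> local_depth L" unfolding local_depth_def by (intro Sup_upper) blast

  have "length xs \<le> 1" if xs: "set xs \<subseteq> ext (origin_ideal n)" "regular_sequence L xs" for xs
  proof (rule ccontr)
    assume "\<not> ?thesis"
    then have l: "0 < length xs" "1 < length xs" by auto
    note reg = xs(2)[unfolded regular_sequence_def]
    let ?y = "xs ! 0" and ?z = "xs ! 1"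
    have y: "?y \<in> carrier L" and z: "?z \<in> carrier L" and zm: "?z \<in> ext (origin_ideal n)"
      using reg xs(1) l nth_mem by blast+
    have t1: "take 0 xs = []" "take 1 xs = [?y]" using l by (auto simp: take_Suc_conv_app_nth One_nat_def)
    let ?G = "genideal L {?y}"
    have yc: "{?y} \<subseteq> carrier L" using y by simp
    have regy: "r = \<zero>\<^bsub>L\<^esub>" if "r \<in> carrier L" "?y \<otimes>\<^bsub>L\<^esub> r = \<zero>\<^bsub>L\<^esub>" for r
    proof -
      have "?y \<otimes>\<^bsub>L\<^esub> r \<in> genideal L (set (take 0 xs))" using that gen0 by simp
      then have "r \<in> genideal L (set (take 0 xs))" using reg l(1) that(1) by blast
      then show ?thesis using gen0 by simp
    qed
    have regz: "r \<in> ?G" if "r \<in> carrier L" "?z \<otimes>\<^bsub>L\<^esub> r \<in> ?G" for r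
    proof -
      have "?z \<otimes>\<^bsub>L\<^esub> r \<in> genideal L (set (take 1 xs))" using that t1 by simp
      then have "r \<in> genideal L (set (take 1 xs))" using reg l(2) that(1) by blast
      then show ?thesis using t1 by simp
    qed
    interpret G: ideal ?G L by (rule L.genideal_ideal[OF yc])
    obtain s1 p1 where p1: "s1 \<in> origin_units n" "p1 \<in> polys n" "f s1 \<otimes>\<^bsub>L\<^esub> ?y = f p1" using f_frac[OF y] by auto
    obtain s2 p2 where p2: "s2 \<in> origin_units n" "p2 \<in> polys n" "f s2 \<otimes>\<^bsub>L\<^esub> ?z = f p2" using f_frac[OF z] by auto
    have s1: "s1 \<in> polys n" and s2: "s2 \<in> polys n" using p1 p2 origin_units_polys by auto
    have "f p2 \<in> ext (origin_ideal n)"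
      using ideal.I_l_closed[OF primeideal.axioms(1)[OF mprime] zm, of "f s2"] s2 p2(3) by simp
    then have p2m: "p2 \<in> origin_ideal n" using coord_power_ext_prime(2)[of "{1..n}" p2] K_origin_ideal p2(2) by simp
    have "1 \<in> contraction ?G"
    proof (rule no_regular_pair[OF n_pos k p1(2) p2m])
      show "ideal (contraction ?G) (mon_ring (expos n))" by (rule contraction_ideal[OF G.is_ideal])
      show "edge_symbolic n k \<subseteq> contraction ?G"
      proof
        fix q :: "'k mpoly" assume q: "q \<in> edge_symbolic n k"
        then have "q \<in> polys n" using edge_symbolic_polys by blast
        moreover from this have "f q = \<zero>\<^bsub>L\<^esub>" using f_zero_iff[of q] q K by simp
        ultimately show "q \<in> contraction ?G" using G.zero_closed by simp
      qed
      have "?y \<in> ?G" using L.genideal_self[OF yc] by blast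
      then have "f p1 \<in> ?G" using G.I_l_closed[of ?y "f s1"] s1 p1(3) by simp
      then show "p1 \<in> contraction ?G" using p1(2) by simp
      show "q \<in> edge_symbolic n k" if q: "q \<in> polys n" "p1 * q \<in> edge_symbolic n k" for q
      proof -
        have "f p1 \<otimes>\<^bsub>L\<^esub> f q = \<zero>\<^bsub>L\<^esub>"
          using f_zero_iff[OF polys_mult[OF p1(2) q(1)]] q K f.hom_mult[of p1 q] p1(2) by simp
        then have "?y \<otimes>\<^bsub>L\<^esub> (f s1 \<otimes>\<^bsub>L\<^esub> f q) = \<zero>\<^bsub>L\<^esub>"
          using y s1 q(1) by (simp add: p1(3)[symmetric] L.m_ac)
        then have "f s1 \<otimes>\<^bsub>L\<^esub> f q = \<zero>\<^bsub>L\<^esub>" using regy s1 q(1) by simp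
        then have "f q \<in> {\<zero>\<^bsub>L\<^esub>}" using unit_cancel_ideal[OF L.zeroideal p1(1)] q(1) by simp
        then show ?thesis using f_zero_iff[OF q(1)] K by simp
      qed
      show "q \<in> contraction ?G" if q: "h \<in> origin_units n" "q \<in> polys n" "h * q \<in> contraction ?G" for h q
        using unit_cancel_ideal[OF G.is_ideal q(1), of "f q"] q f.hom_mult[of h q] origin_units_polys[OF q(1)] by simp
      show "q \<in> contraction ?G" if q: "q \<in> polys n" "p2 * q \<in> contraction ?G" for q
      proof -
        have "f p2 \<otimes>\<^bsub>L\<^esub> f q \<in> ?G" using q f.hom_mult[of p2 q] p2(2) by simp
        then have "?z \<otimes>\<^bsub>L\<^esub> (f s2 \<otimes>\<^bsub>L\<^esub> f q) \<in> ?G"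
          using z s2 q(1) by (simp add: p2(3)[symmetric] L.m_ac)
        then have "f s2 \<otimes>\<^bsub>L\<^esub> f q \<in> ?G" using regz s2 q(1) by simp
        then show ?thesis using unit_cancel_ideal[OF G.is_ideal p2(1)] q(1) by simp
      qed
    qed
    then have "\<one>\<^bsub>L\<^esub> \<in> ?G" using f.hom_one by simp
    moreover have sc: "set xs \<subseteq> carrier L" using reg by blast
    have "?y \<in> genideal L (set xs)" using L.genideal_self[OF sc] nth_mem[OF l(1)] by blast
    then have "?G \<subseteq> genideal L (set xs)" by (intro L.genideal_minimal[OF L.genideal_ideal[OF sc]]) simp
    ultimately have "\<one>\<^bsub>L\<^esub> \<in> genideal L (set xs)" by blast
    then have "genideal L (set xs) = carrier L"
      using ideal.one_imp_carrier[OF L.genideal_ideal[OF sc]] by simp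
    then show False using reg by blast
  qed
  then have "local_depth L \<le> enat 1"
    unfolding local_depth_def L_local(2) by (intro Sup_least) auto
  then have "local_depth L = krull_dim L" using depth1 dim by simp
  then show ?thesis unfolding cohen_macaulay_local_def using L_noetherian L_local(1) by blast
qed

end

section \<open>The edge ideal in the local ring at the origin\<close>

lemma (in fraction_map) ext_mult:
  assumes I: "I \<subseteq> carrier R" "J \<subseteq> carrier R" "\<And>a b. a \<in> I \<Longrightarrow> b \<in> J \<Longrightarrow> a \<otimes> b \<in> H"
    and xy: "x \<in> ext I" "y \<in> ext J"
  shows "x \<otimes>\<^bsub>L\<^esub> y \<in> ext H"
proof -
  obtain s a where x: "x \<in> carrier L" "s \<in> U" "a \<in> I" "f s \<otimes>\<^bsub>L\<^esub> x = f a" using xy by (auto simp: ext_def)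
  obtain t b where y: "y \<in> carrier L" "t \<in> U" "b \<in> J" "f t \<otimes>\<^bsub>L\<^esub> y = f b" using xy by (auto simp: ext_def)
  have ab: "a \<in> carrier R" "b \<in> carrier R" using x(3) y(3) I by auto
  have "f (s \<otimes> t) \<otimes>\<^bsub>L\<^esub> (x \<otimes>\<^bsub>L\<^esub> y) = (f s \<otimes>\<^bsub>L\<^esub> x) \<otimes>\<^bsub>L\<^esub> (f t \<otimes>\<^bsub>L\<^esub> y)"
    using x(1-3) y(1-3) by (simp add: L.m_ac)
  also have "\<dots> = f (a \<otimes> b)" unfolding x(4) y(4) using ab by simp
  finally show ?thesis using x(1-3) y(1-3) I(3) by (intro extI[of _ "s \<otimes> t" "a \<otimes> b"]) simp_all
qed

lemma (in ring) ideal_power_ideal: "ideal I R \<Longrightarrow> ideal (ideal_power R I k) R"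
  by (induction k) (auto intro: oneideal ideal_prod_is_ideal)

lemma prime_height_mono:
  assumes "primeideal Q R" "P \<subseteq> Q"
  shows "prime_height R P \<le> prime_height R Q"
proof (cases "P = Q")
  case False
  show ?thesis unfolding prime_height_def
  proof (rule Sup_least, clarsimp)
    fix k Ps assume Ps: "prime_chain R Ps" "length Ps = Suc k" "P = last Ps"
    have "P' \<subset> Q" if "P' \<in> set Ps" for P'
    proof -
      have "P' \<subseteq> last Ps"
        using that Ps unfolding prime_chain_def
        by (induction Ps rule: rev_induct) (auto simp: sorted_wrt_append)
      then show ?thesis using False assms Ps(3) by blast
    qed
    then have "prime_chain R (Ps @ [Q])"
      using Ps assms unfolding prime_chain_def by (auto simp: sorted_wrt_append)
    then have "\<exists>Ps'. prime_chain R Ps' \<and> length Ps' = Suc (Suc k) \<and> last Ps' = Q"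
      using Ps(2) by (intro exI[of _ "Ps @ [Q]"]) auto
    then have "enat (Suc k) \<le> Sup {enat k |k. \<exists>Ps. prime_chain R Ps \<and> length Ps = Suc k \<and> last Ps = Q}"
      by (intro Sup_upper) blast
    moreover have "enat k \<le> enat (Suc k)" by simp
    ultimately show "enat k \<le> Sup {enat k |k. \<exists>Ps. prime_chain R Ps \<and> length Ps = Suc k \<and> last Ps = Q}"
      by (rule order_trans[rotated])
  qed
qed simp

lemma edge_symbolic_subset_rad:
  assumes n: "n > 0" and J: "ideal J (mon_ring (expos n) :: ('k::field) mpoly ring)"
    and e: "\<And>d. 2 \<le> d \<Longrightarrow> d \<le> n \<Longrightarrow> esym n d \<in> J"
  shows "edge_symbolic n 1 \<subseteq> poly_radical n J"
proof -
  interpret cring "mon_ring (expos n) :: 'k mpoly ring" by (rule poly_ring_cring)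
  have "mvar i * mvar j \<in> poly_radical n J" if ij: "i < j" "{i, j} \<in> complete_graph_edges n" for i j
  proof -
    have "{i, j} \<subseteq> {1..n}" using ij(2) unfolding complete_graph_edges_def by (auto simp: doubleton_eq_iff)
    then have "xprod {i, j} \<in> poly_radical n J" using ij(1) by (intro xprod_in_rad[OF J e]) auto
    then show ?thesis using ij(1) by (simp add: xprod_def)
  qed
  then have "genideal (mon_ring (expos n)) {mvar i * mvar j |i j. i < j \<and> {i, j} \<in> complete_graph_edges n}
      \<subseteq> poly_radical n J"
    by (intro genideal_minimal poly_radical_ideal[OF J]) blast
  then show ?thesis
    by (simp only: edge_ideal_eq[OF n, symmetric] edge_ideal_def poly_ring_upto_eq)
qed

lemma esym_in_edge_symbolic:
  assumes "2 \<le> d"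
  shows "(esym n d :: ('k::field) mpoly) \<in> edge_symbolic n 1"
  unfolding esym_def
proof (rule poly_ideal_sum[OF edge_symbolic_ideal])
  fix A assume "A \<in> {A. A \<subseteq> {1..n} \<and> card A = d}"
  then have A: "A \<subseteq> {1..n}" "card A = d" by auto
  have fin: "finite A" using A(1) finite_subset by blast
  obtain a where a: "a \<in> A" using A(2) assms by fastforce
  then have "card (A - {a}) \<noteq> 0" using A(2) assms fin by simp
  then have "A - {a} \<noteq> {}" by (metis card.empty)
  then obtain b where b: "b \<in> A - {a}" by blast
  have "(xprod A :: 'k mpoly) = mvar a * mvar b * xprod (A - {a} - {b})"
    unfolding xprod_def using prod.remove[OF fin a, of "mvar :: nat \<Rightarrow> 'k mpoly"]
      prod.remove[of "A - {a}" b "mvar :: nat \<Rightarrow> 'k mpoly"] fin b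
    by (simp add: mult.assoc)
  moreover have "mvar a ^ 1 * mvar b ^ 1 \<in> (edge_symbolic n 1 :: 'k mpoly set)"
    by (rule mvar_mult_in_edge_symbolic) (use a b A in blast)+
  then have "mvar a * mvar b \<in> (edge_symbolic n 1 :: 'k mpoly set)" by simp
  moreover have "(xprod (A - {a} - {b}) :: 'k mpoly) \<in> polys n" using A by (intro xprod_in) auto
  ultimately show "(xprod A :: 'k mpoly) \<in> edge_symbolic n 1" using edge_symbolic_ideal[of n 1] unfolding poly_ideal_iff by metis
qed

locale origin_local_ring = origin_quotient n "{0}" L f for n :: nat and L :: "('b, 'c) ring_scheme" and f :: "('k::field) mpoly \<Rightarrow> 'b"
begin

abbreviation axis_prime :: "nat \<Rightarrow> 'b set" where
  "axis_prime i \<equiv> ext (axis_power n i 1)"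

abbreviation edge_loc :: "'b set" where
  "edge_loc \<equiv> ext (edge_symbolic n 1)"

lemma zero_sub: "ideal I (mon_ring (expos n)) \<Longrightarrow> {0} \<subseteq> I"
  by (auto simp: poly_ideal_iff)

lemma ext_coord_power_iff:
  assumes "x \<in> carrier L" "s \<in> origin_units n" "p \<in> polys n" "f s \<otimes>\<^bsub>L\<^esub> x = f p" "A \<subseteq> {1..n}"
  shows "x \<in> ext (coord_power n A k) \<longleftrightarrow> p \<in> coord_power n A k"
  using assms coord_power_saturated[OF assms(5)]
  by (intro ext_iff[OF assms(1,2) _ assms(4)] coord_power_ideal zero_sub) auto

lemma ext_edge_symbolic_iff:
  assumes "x \<in> carrier L" "s \<in> origin_units n" "p \<in> polys n" "f s \<otimes>\<^bsub>L\<^esub> x = f p"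
  shows "x \<in> ext (edge_symbolic n k) \<longleftrightarrow> p \<in> edge_symbolic n k"
  using assms edge_symbolic_saturated[OF n_pos]
  by (intro ext_iff[OF assms(1,2) _ assms(4)] edge_symbolic_ideal zero_sub) auto

lemma ext_edge_symbolic:
  assumes x: "x \<in> carrier L"
  shows "x \<in> ext (edge_symbolic n k) \<longleftrightarrow> (\<forall>i\<in>{1..n}. x \<in> ext (axis_power n i k))"
proof -
  obtain s p where p: "s \<in> origin_units n" "p \<in> polys n" "f s \<otimes>\<^bsub>L\<^esub> x = f p" using f_frac[OF x] by auto
  show ?thesis
    using ext_edge_symbolic_iff[OF x p] ext_coord_power_iff[OF x p, of "{1..n} - {_}"] edge_symbolic_iff[OF n_pos, of p k] by auto
qed

lemma axis_prime_is_prime: "primeideal (axis_prime i) L" "p \<in> polys n \<Longrightarrow> f p \<in> axis_prime i \<longleftrightarrow> p \<in> axis_power n i 1"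
  using coord_power_ext_prime[of "{1..n} - {i}"] zero_sub[OF coord_power_ideal] by auto

lemma edge_loc_ideal: "ideal edge_loc L"
  by (rule ext_ideal[OF edge_symbolic_ideal])

lemma x_in_axis_prime: "i \<in> {1..n} \<Longrightarrow> j \<in> {1..n} \<Longrightarrow> f (mvar i) \<in> axis_prime j \<longleftrightarrow> i \<noteq> j"
  using axis_prime_is_prime(2)[of "mvar i" j] by (auto simp: mvar_in mvar_in_coord_power)

lemma edge_loc_carr: "x \<in> edge_loc \<Longrightarrow> x \<in> carrier L"
  by (auto simp: ext_def)

lemma edge_loc_axis_prime: "i \<in> {1..n} \<Longrightarrow> edge_loc \<subseteq> axis_prime i"
  using ext_edge_symbolic edge_loc_carr by blast

lemma x_times_axis_prime:
  assumes i: "i \<in> {1..n}" and r: "r \<in> axis_prime i"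
  shows "r \<otimes>\<^bsub>L\<^esub> f (mvar i) \<in> edge_loc"
proof -
  interpret P: primeideal "axis_prime j" L for j by (rule axis_prime_is_prime)
  have rc: "r \<in> carrier L" using r P.Icarr by blast
  have xc: "f (mvar i) \<in> carrier L" using i by (simp add: mvar_in)
  have "r \<otimes>\<^bsub>L\<^esub> f (mvar i) \<in> axis_prime j" if j: "j \<in> {1..n}" for j
  proof (cases "j = i")
    case True
    then show ?thesis using P.I_r_closed[OF r xc] by simp
  next
    case False
    then show ?thesis using P.I_l_closed[OF _ rc, of "f (mvar i)" j] x_in_axis_prime[OF i j] by simp
  qed
  then show ?thesis using ext_edge_symbolic[of "r \<otimes>\<^bsub>L\<^esub> f (mvar i)" 1] rc xc by simp
qed

text \<open>
  The prime of the \<open>i\<close>-th axis is the annihilator of \<open>x\<^sub>i\<close>, which vanishes on all other axes. Conversely, let \<open>Q\<close>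
  be the annihilator of \<open>x\<close>, where \<open>x\<close> does not vanish on the \<open>i\<close>-th axis. Then
  \<open>Q\<close> contains the product of \<open>x\<^sub>i\<close> with the prime of this axis but not \<open>x\<^sub>i\<close>, so it contains the prime of this axis,
  and the reverse inclusion is clear.
\<close>
lemma assoc_primes_edge_loc: "assoc_primes L edge_loc = axis_prime ` {1..n}"
proof
  interpret P: primeideal "axis_prime j" L for j by (rule axis_prime_is_prime)
  interpret A: ideal edge_loc L by (rule edge_loc_ideal)
  show "axis_prime ` {1..n} \<subseteq> assoc_primes L edge_loc"
  proof
    fix Q assume "Q \<in> axis_prime ` {1..n}"
    then obtain i where i: "i \<in> {1..n}" "Q = axis_prime i" by blast
    have "axis_prime i = {r \<in> carrier L. r \<otimes>\<^bsub>L\<^esub> f (mvar i) \<in> edge_loc}"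
    proof (intro equalityI subsetI)
      show "r \<in> {r \<in> carrier L. r \<otimes>\<^bsub>L\<^esub> f (mvar i) \<in> edge_loc}" if "r \<in> axis_prime i" for r
        using that x_times_axis_prime[OF i(1) that] P.Icarr by blast
      show "r \<in> axis_prime i" if r: "r \<in> {r \<in> carrier L. r \<otimes>\<^bsub>L\<^esub> f (mvar i) \<in> edge_loc}" for r
      proof -
        have "r \<otimes>\<^bsub>L\<^esub> f (mvar i) \<in> axis_prime i" using r edge_loc_axis_prime[OF i(1)] by blast
        then show ?thesis using P.I_prime[of r "f (mvar i)" i] r x_in_axis_prime[OF i(1) i(1)] i(1)
          by (simp add: mvar_in)
      qed
    qed
    then have "Q = {r \<in> carrier L. r \<otimes>\<^bsub>L\<^esub> f (mvar i) \<in> edge_loc}" using i(2) by simp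
    moreover have "primeideal Q L" using i(2) axis_prime_is_prime(1) by simp
    moreover have "f (mvar i) \<in> carrier L" using i(1) by (simp add: mvar_in)
    ultimately show "Q \<in> assoc_primes L edge_loc" unfolding assoc_primes_def by blast
  qed
  show "assoc_primes L edge_loc \<subseteq> axis_prime ` {1..n}"
  proof
    fix Q assume "Q \<in> assoc_primes L edge_loc"
    then obtain x where Q: "primeideal Q L" and x: "x \<in> carrier L" "Q = {r \<in> carrier L. r \<otimes>\<^bsub>L\<^esub> x \<in> edge_loc}"
      unfolding assoc_primes_def by blast
    interpret Q: primeideal Q L by (rule Q)
    have "x \<notin> edge_loc"
    proof
      assume "x \<in> edge_loc"
      then have "Q = carrier L" using x A.I_l_closed by blast
      then show False using Q.I_notcarr by simp
    qed
    then obtain i where i: "i \<in> {1..n}" "x \<notin> axis_prime i" using ext_edge_symbolic[OF x(1)] by blast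
    let ?x = "f (mvar i)"
    have xc: "?x \<in> carrier L" using i by (simp add: mvar_in)
    have nx: "?x \<notin> Q"
    proof
      assume "?x \<in> Q"
      then have "?x \<otimes>\<^bsub>L\<^esub> x \<in> edge_loc" unfolding x(2) by simp
      then have "?x \<otimes>\<^bsub>L\<^esub> x \<in> axis_prime i" using edge_loc_axis_prime[OF i(1)] by blast
      from P.I_prime[OF xc x(1) this] show False using i(2) x_in_axis_prime[OF i(1) i(1)] by simp
    qed
    have "Q \<subseteq> axis_prime i"
    proof
      fix r assume "r \<in> Q"
      then have r: "r \<in> carrier L" and "r \<otimes>\<^bsub>L\<^esub> x \<in> edge_loc" unfolding x(2) by simp_all
      then have "r \<otimes>\<^bsub>L\<^esub> x \<in> axis_prime i" using edge_loc_axis_prime[OF i(1)] by blast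
      from P.I_prime[OF r x(1) this] show "r \<in> axis_prime i" using i(2) by simp
    qed
    moreover have "axis_prime i \<subseteq> Q"
    proof
      fix r assume r: "r \<in> axis_prime i"
      then have rc: "r \<in> carrier L" using P.Icarr by blast
      have "(r \<otimes>\<^bsub>L\<^esub> ?x) \<otimes>\<^bsub>L\<^esub> x \<in> edge_loc" using A.I_r_closed[OF x_times_axis_prime[OF i(1) r] x(1)] .
      then have "r \<otimes>\<^bsub>L\<^esub> ?x \<in> Q" unfolding x(2) using rc xc by simp
      from Q.I_prime[OF rc xc this] show "r \<in> Q" using nx by simp
    qed
    ultimately show "Q \<in> axis_prime ` {1..n}" using i(1) by blast
  qed
qed

lemma power_subset_ext_axis:
  assumes i: "i \<in> {1..n}"
  shows "ideal_power L edge_loc k \<subseteq> ext (axis_power n i k)"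
proof (induction k)
  case 0
  have "x \<in> ext (polys n)" if "x \<in> carrier L" for x using f_frac[OF that] that by (auto intro: extI)
  then show ?case by (auto simp: coord_power_0)
next
  case (Suc k)
  interpret E: ideal "ext (axis_power n i (Suc k))" L by (rule ext_ideal[OF coord_power_ideal])
  have "x \<in> ext (axis_power n i (Suc k))" if "x \<in> ideal_prod L (ideal_power L edge_loc k) edge_loc" for x
    using that
  proof (induction rule: ideal_prod.induct)
    case (prod x y)
    then have "x \<in> ext (axis_power n i k)" "y \<in> ext (axis_power n i 1)" using Suc edge_loc_axis_prime[OF i] by blast+
    then show ?case
    proof (rule ext_mult[of "axis_power n i k" "axis_power n i 1", rotated 3])
      show "axis_power n i k \<subseteq> carrier (mon_ring (expos n))" "axis_power n i 1 \<subseteq> carrier (mon_ring (expos n))"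
        using coord_power_subset by auto
      show "p \<otimes>\<^bsub>mon_ring (expos n)\<^esub> q \<in> axis_power n i (Suc k)"
        if "p \<in> axis_power n i k" "q \<in> axis_power n i 1" for p q
        using coord_power_mult[OF that] by (simp add: One_nat_def)
    qed
  next
    case (sum x y)
    then show ?case by (intro E.a_closed)
  qed
  then show ?case by auto
qed

text \<open>
  A monomial of weight at least \<open>k\<close> off the \<open>i\<close>-th axis has \<open>k\<close> factors \<open>x\<^sub>j\<close> with \<open>j \<noteq> i\<close>, and each of them can be
  paired with a factor \<open>x\<^sub>i\<close> to give a generator of the edge ideal.
\<close>
lemma axis_times_power_mem:
  assumes i: "i \<in> {1..n}" and p: "p \<in> axis_power n i k"
  shows "f (mvar i ^ k * p) \<in> ideal_power L edge_loc k"
  using p unfolding coord_power_def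
proof (induction rule: poly_on_induct)
  interpret I: ideal "ideal_power L edge_loc k" L by (rule L.ideal_power_ideal[OF edge_loc_ideal])
  have xS: "(mvar i ^ k :: 'k mpoly) \<in> polys n" using polys_power mvar_in[OF i] by blast
  case zero
  then show ?case using I.zero_closed f.hom_zero by simp
  case (add p q)
  then have "p \<in> polys n" "q \<in> polys n" by (auto simp: poly_on_def)
  then show ?case
    using add I.a_closed f.hom_add[of "mvar i ^ k * p" "mvar i ^ k * q"] polys_mult[OF xS]
    by (simp add: distrib_left)
next
  case (mon e c)
  then have "e \<in> expos n" "k \<le> weight ({1..n} - {i}) e" by auto
  then show ?case
  proof (induction k arbitrary: e)
    case 0
    then show ?case by (simp add: mon_in_poly_on)
  next
    case (Suc k)
    have "weight ({1..n} - {i}) e \<noteq> 0" using Suc.prems(2) by simp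
    then obtain j where j: "j \<in> {1..n} - {i}" "cf e j \<noteq> 0" unfolding weight_def by (meson sum.neutral)
    define e' where "e' = e - mon j 1"
    have e: "e = mon j 1 + e'" unfolding e'_def using j
      by (intro expo_diff) (auto simp: lookup_single "when_def")
    have e'S: "e' \<in> expos n" using Suc.prems(1) e add_in_expos_iff by metis
    have "weight ({1..n} - {i}) e = 1 + weight ({1..n} - {i}) e'"
      using j by (subst e) (simp add: weight_add weight_single)
    then have "f (mvar i ^ k * mon e' c) \<in> ideal_power L edge_loc k"
      using Suc.IH[OF e'S] Suc.prems(2) by simp
    moreover have m: "mvar i * mvar j \<in> edge_symbolic n 1" using mvar_mult_in_edge_symbolic[of i n j 1] i j by simp
    then have "f (mvar i * mvar j) \<in> edge_loc" using f_in_ext edge_symbolic_polys by fastforce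
    ultimately have "f (mvar i ^ k * mon e' c) \<otimes>\<^bsub>L\<^esub> f (mvar i * mvar j) \<in> ideal_power L edge_loc (Suc k)"
      by (simp add: ideal_prod.prod)
    also have "f (mvar i ^ k * mon e' c) \<otimes>\<^bsub>L\<^esub> f (mvar i * mvar j)
      = f ((mvar i ^ k * mon e' c) * (mvar i * mvar j))"
    proof -
      have "mvar i ^ k * mon e' c \<in> (polys n :: 'k mpoly set)"
        using polys_mult[OF polys_power[OF mvar_in[OF i]] mon_in_poly_on[OF e'S]] .
      moreover have "mvar i * mvar j \<in> (polys n :: 'k mpoly set)" using polys_mult i j mvar_in by blast
      ultimately show ?thesis using f.hom_mult by simp
    qed
    also have "(mvar i ^ k * mon e' c) * (mvar i * mvar j) = mvar i ^ Suc k * mon e c"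
      by (subst e) (simp add: mvar_def algebra_simps mult_single)
    finally show ?case .
  qed
qed

text \<open>
  At the prime of the \<open>i\<close>-th axis the power of the edge ideal agrees with the power of that prime, because the
  former is contained in the latter, which is primary, and \<open>x\<^sub>i\<^sup>k\<close> multiplies the latter into the former.
\<close>
lemma symbolic_power_edge_loc: "symbolic_power L edge_loc k = ext (edge_symbolic n k)"
proof -
  have "x \<in> symbolic_power L edge_loc k \<longleftrightarrow> x \<in> ext (edge_symbolic n k)" if x: "x \<in> carrier L" for x
  proof -
    have pw: "ideal (ideal_power L edge_loc k) L" by (rule L.ideal_power_ideal[OF edge_loc_ideal])
    have 1: "x \<in> symbolic_power L edge_loc k \<longleftrightarrow>
      (\<forall>i\<in>{1..n}. \<exists>u\<in>carrier L - axis_prime i. u \<otimes>\<^bsub>L\<^esub> x \<in> ideal_power L edge_loc k)"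
      unfolding symbolic_power_def assoc_primes_edge_loc using x
      by (simp add: contract_extend_loc[OF axis_prime_is_prime(1) pw])
    obtain t q where q: "t \<in> origin_units n" "q \<in> polys n" "f t \<otimes>\<^bsub>L\<^esub> x = f q" using f_frac[OF x] by auto
    have tS: "t \<in> polys n" using q(1) origin_units_polys by blast
    have "(\<exists>u\<in>carrier L - axis_prime i. u \<otimes>\<^bsub>L\<^esub> x \<in> ideal_power L edge_loc k) \<longleftrightarrow> x \<in> ext (axis_power n i k)"
      if i: "i \<in> {1..n}" for i
    proof
      assume "\<exists>u\<in>carrier L - axis_prime i. u \<otimes>\<^bsub>L\<^esub> x \<in> ideal_power L edge_loc k"
      then obtain u where u: "u \<in> carrier L" "u \<notin> axis_prime i" "u \<otimes>\<^bsub>L\<^esub> x \<in> ext (axis_power n i k)"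
        using power_subset_ext_axis[OF i] by blast
      obtain s p where p: "s \<in> origin_units n" "p \<in> polys n" "f s \<otimes>\<^bsub>L\<^esub> u = f p" using f_frac[OF u(1)] by auto
      have sS: "s \<in> polys n" using p(1) origin_units_polys by blast
      have "f (s * t) \<otimes>\<^bsub>L\<^esub> (u \<otimes>\<^bsub>L\<^esub> x) = (f s \<otimes>\<^bsub>L\<^esub> u) \<otimes>\<^bsub>L\<^esub> (f t \<otimes>\<^bsub>L\<^esub> x)"
        using f.hom_mult[of s t] sS tS u(1) x by (simp add: L.m_ac)
      also have "\<dots> = f (p * q)" unfolding p(3) q(3) using f.hom_mult[of p q] p(2) q(2) by simp
      finally have "p * q \<in> axis_power n i k"
        using ext_coord_power_iff[of "u \<otimes>\<^bsub>L\<^esub> x" "s * t" "p * q" "{1..n} - {i}" k] u x U_mult[OF p(1) q(1)]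
          polys_mult[OF p(2) q(2)] by auto
      moreover have "p \<notin> axis_power n i 1" using ext_coord_power_iff[OF u(1) p, of "{1..n} - {i}" 1] u(2) by auto
      ultimately have "q \<in> axis_power n i k" using coord_power_primary p(2) q(2) by blast
      then show "x \<in> ext (axis_power n i k)" using x q by (intro extI)
    next
      assume "x \<in> ext (axis_power n i k)"
      then have "q \<in> axis_power n i k" using ext_coord_power_iff[OF x q, of "{1..n} - {i}" k] by auto
      then have m: "f (mvar i ^ k * q) \<in> ideal_power L edge_loc k" by (rule axis_times_power_mem[OF i])
      have xS: "(mvar i ^ k :: 'k mpoly) \<in> polys n" using polys_power mvar_in[OF i] by blast
      let ?u = "f (mvar i ^ k)"
      have "f (mvar i ^ k * q) = f t \<otimes>\<^bsub>L\<^esub> (?u \<otimes>\<^bsub>L\<^esub> x)"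
        using f.hom_mult[of "mvar i ^ k" q] xS q(2) x tS by (simp add: q(3)[symmetric] L.m_lcomm)
      then have "?u \<otimes>\<^bsub>L\<^esub> x \<in> ideal_power L edge_loc k"
        using unit_cancel_ideal[OF pw q(1), of "?u \<otimes>\<^bsub>L\<^esub> x"] m xS x by simp
      moreover have "mvar i ^ k \<notin> (axis_power n i 1 :: 'k mpoly set)"
        using i by (subst mvar_power_in_coord_power) auto
      then have "?u \<notin> axis_prime i" using axis_prime_is_prime(2)[OF xS] by blast
      ultimately show "\<exists>u\<in>carrier L - axis_prime i. u \<otimes>\<^bsub>L\<^esub> x \<in> ideal_power L edge_loc k"
        using xS by (intro bexI[of _ ?u]) auto
    qed
    then show ?thesis using 1 ext_edge_symbolic[OF x] by blast
  qed
  then show ?thesis unfolding symbolic_power_def ext_def by blast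
qed

lemma height_axis_prime:
  assumes i: "i \<in> {1..n}"
  shows "prime_height L (axis_prime i) = enat (n - 1)"
proof (rule antisym)
  have origin_ideal: "primeideal (ext (origin_ideal n)) L" using coord_power_ext_prime(1)[of "{1..n}"] zero_sub[OF coord_power_ideal] by auto
  have lt: "axis_prime i \<subset> ext (origin_ideal n)" using i zero_sub[OF coord_power_ideal] by (intro coord_power_ext_strict) auto
  show "prime_height L (axis_prime i) \<le> enat (n - 1)"
    unfolding prime_height_def
  proof (rule Sup_least, clarsimp)
    fix k Ps assume Ps: "prime_chain L Ps" "length Ps = Suc k" "last Ps = axis_prime i"
    have "P' \<subset> ext (origin_ideal n)" if "P' \<in> set Ps" for P'
    proof -
      have "P' \<subseteq> last Ps"
        using that Ps(1) unfolding prime_chain_def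
        by (induction Ps rule: rev_induct) (auto simp: sorted_wrt_append)
      then show ?thesis using lt Ps(3) by blast
    qed
    then have "prime_chain L (Ps @ [ext (origin_ideal n)])"
      using Ps origin_ideal unfolding prime_chain_def by (auto simp: sorted_wrt_append)
    then show "k \<le> n - 1" using chain_length[of "Ps @ [ext (origin_ideal n)]"] Ps(2) by simp
  qed
  \<comment> \<open>the lower bound: adjoin the variables other than \<open>x\<^sub>i\<close> one at a time\<close>
  define bs where "bs = sorted_list_of_set ({1..n} - {i})"
  have bs: "distinct bs" "set bs = {1..n} - {i}" by (auto simp: bs_def)
  have len: "length bs = n - 1" using i by (simp add: bs_def)
  define Ps where "Ps = map (\<lambda>j. ext (coord_power n (set (take j bs)) 1)) [0..<n]"
  have sub: "set (take j bs) \<subseteq> {1..n}" for j using set_take_subset[of j bs] bs(2) by auto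
  have "prime_chain L Ps"
    unfolding prime_chain_def
  proof
    show "\<forall>P\<in>set Ps. primeideal P L"
      using coord_power_ext_prime(1)[OF sub zero_sub[OF coord_power_ideal]] by (auto simp: Ps_def)
    show "sorted_wrt (\<subset>) Ps"
      unfolding sorted_wrt_iff_nth_less
    proof (intro allI impI)
      fix a b assume ab: "a < b" "b < length Ps"
      then have b: "b \<le> length bs" using len by (simp add: Ps_def)
      have "take b bs ! a \<in> set (take b bs)" using ab b by (intro nth_mem) simp
      then have "bs ! a \<in> set (take b bs)" using ab by simp
      moreover have "bs ! a \<notin> set (take a bs)"
        using bs(1) ab b by (auto simp: in_set_conv_nth nth_eq_iff_index_eq)
      moreover have "set (take a bs) \<subseteq> set (take b bs)" using ab by (intro set_take_subset_set_take) simp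
      ultimately have "set (take a bs) \<subset> set (take b bs)" by blast
      then have "ext (coord_power n (set (take a bs)) 1) \<subset> ext (coord_power n (set (take b bs)) 1)"
        using sub zero_sub[OF coord_power_ideal] by (intro coord_power_ext_strict)
      then show "Ps ! a \<subset> Ps ! b" using ab by (simp add: Ps_def)
    qed
  qed
  moreover have "length Ps = Suc (n - 1)" using n_pos by (simp add: Ps_def)
  moreover have "last Ps = axis_prime i"
    using n_pos bs(2) len by (simp add: Ps_def last_map)
  ultimately show "enat (n - 1) \<le> prime_height L (axis_prime i)"
    unfolding prime_height_def by (intro Sup_upper) blast
qed

text \<open>Every prime over the edge ideal contains the prime of an axis.\<close>
lemma height_edge_loc: "ideal_height L edge_loc = enat (n - 1)"
  unfolding ideal_height_def
proof (rule antisym)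
  have "1 \<in> {1..n}" using n_pos by simp
  then have "enat (n - 1) \<in> {prime_height L P |P. primeideal P L \<and> edge_loc \<subseteq> P}"
    using height_axis_prime[of 1] axis_prime_is_prime(1)[of 1] edge_loc_axis_prime[of 1] by force
  then show "Inf {prime_height L P |P. primeideal P L \<and> edge_loc \<subseteq> P} \<le> enat (n - 1)" by (rule Inf_lower)
  show "enat (n - 1) \<le> Inf {prime_height L P |P. primeideal P L \<and> edge_loc \<subseteq> P}"
  proof (rule Inf_greatest, clarify)
    fix P assume P: "primeideal P L" "edge_loc \<subseteq> P"
    have "f p \<in> P" if "p \<in> edge_symbolic n 1" for p using f_in_ext[OF that] P(2) that edge_symbolic_polys by auto
    then have "edge_symbolic n 1 \<subseteq> contraction P" using edge_symbolic_polys by blast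
    then obtain i where i: "i \<in> {1..n}" "axis_power n i 1 \<subseteq> contraction P"
      using prime_contains_axis[OF contraction_prime(1)[OF P(1)] n_pos] by blast
    have "axis_prime i \<subseteq> P"
    proof
      fix x assume "x \<in> axis_prime i"
      then obtain s a where a: "x \<in> carrier L" "s \<in> origin_units n" "a \<in> axis_power n i 1" "f s \<otimes>\<^bsub>L\<^esub> x = f a"
        by (auto simp: ext_def)
      then show "x \<in> P" using i(2) unit_cancel_ideal[OF primeideal.axioms(1)[OF P(1)] a(2,1)] by auto
    qed
    then show "enat (n - 1) \<le> prime_height L P"
      using prime_height_mono[OF P(1)] height_axis_prime[OF i(1)] by metis
  qed
qed

lemma f_power: "p \<in> polys n \<Longrightarrow> f (p ^ N) = f p [^]\<^bsub>L\<^esub> N"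
proof (induction N)
  case (Suc N)
  then show ?case using f.hom_mult[of "p ^ N" p] polys_power[of p n N] by (simp add: mult.commute)
qed (use f.hom_one in simp)

lemma edge_loc_set_theoretic_ci: "set_theoretic_ci L edge_loc"
proof -
  define fs where "fs = map (\<lambda>d. f (esym n d)) [2..<Suc n]"
  have eS: "esym n d \<in> (polys n :: 'k mpoly set)" if "2 \<le> d" for d using esym_in_edge_symbolic[OF that] edge_symbolic_polys by blast
  have e_edge_loc: "f (esym n d) \<in> edge_loc" if "2 \<le> d" for d using f_in_ext[OF esym_in_edge_symbolic[OF that]] eS[OF that] by simp
  have fs_edge_loc: "set fs \<subseteq> edge_loc" unfolding fs_def using e_edge_loc by auto
  have fsc: "set fs \<subseteq> carrier L" using fs_edge_loc edge_loc_carr by blast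
  interpret G: ideal "genideal L (set fs)" L by (rule L.genideal_ideal[OF fsc])
  have sub: "genideal L (set fs) \<subseteq> edge_loc" by (rule L.genideal_minimal[OF edge_loc_ideal fs_edge_loc])
  have "edge_symbolic n 1 \<subseteq> (origin_ideal n :: 'k mpoly set)"
    using edge_symbolic_iff[OF n_pos, of _ 1] coord_power_mono_set[of "{1..n}" "{1..n} - {1}" n 1] n_pos by fastforce
  then have aam: "edge_loc \<subseteq> the_max_ideal L" unfolding L_local(2) by (rule ext_mono)
  have "ideal_radical L edge_loc \<subseteq> ideal_radical L (genideal L (set fs))"
  proof
    fix r assume "r \<in> ideal_radical L edge_loc"
    then obtain k where r: "r \<in> carrier L" "r [^]\<^bsub>L\<^esub> (k::nat) \<in> edge_loc" by (auto simp: ideal_radical_def)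
    then obtain s p where p: "s \<in> origin_units n" "p \<in> edge_symbolic n 1" "f s \<otimes>\<^bsub>L\<^esub> (r [^]\<^bsub>L\<^esub> k) = f p" by (auto simp: ext_def)
    have pS: "p \<in> polys n" and sS: "s \<in> polys n" using p edge_symbolic_polys origin_units_polys by blast+
    have "esym n d \<in> contraction (genideal L (set fs))" if "2 \<le> d" "d \<le> n" for d
    proof -
      have "f (esym n d) \<in> set fs" unfolding fs_def using that by (auto simp del: upt_Suc)
      then show ?thesis using L.genideal_self[OF fsc] eS[OF that(1)] by blast
    qed
    then have "p \<in> poly_radical n (contraction (genideal L (set fs)))"
      using edge_symbolic_subset_rad[OF n_pos contraction_ideal[OF G.is_ideal]] p(2) by blast
    then obtain N where N: "f (p ^ N) \<in> genideal L (set fs)" by (auto simp: poly_radical_def)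
    have "f (p ^ N) = (f s \<otimes>\<^bsub>L\<^esub> (r [^]\<^bsub>L\<^esub> k)) [^]\<^bsub>L\<^esub> N" using f_power[OF pS] p(3) by simp
    also have "\<dots> = f (s ^ N) \<otimes>\<^bsub>L\<^esub> (r [^]\<^bsub>L\<^esub> (k * N))"
      using r(1) sS f_power[OF sS] by (simp add: L.nat_pow_distrib L.nat_pow_pow)
    finally have "f (s ^ N) \<otimes>\<^bsub>L\<^esub> (r [^]\<^bsub>L\<^esub> (k * N)) \<in> genideal L (set fs)" using N by simp
    moreover have "s ^ N \<in> origin_units n" using p(1) U_mult U_one by (induction N) auto
    ultimately have "r [^]\<^bsub>L\<^esub> (k * N) \<in> genideal L (set fs)"
      using unit_cancel_ideal[OF G.is_ideal] r(1) by blast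
    then show "r \<in> ideal_radical L (genideal L (set fs))" using r(1) by (auto simp: ideal_radical_def)
  qed
  moreover have "ideal_radical L (genideal L (set fs)) \<subseteq> ideal_radical L edge_loc"
    using sub by (auto simp: ideal_radical_def)
  moreover have "length fs = n - 1" unfolding fs_def length_map length_upt by linarith
  then have "ideal_height L edge_loc = enat (length fs)" using height_edge_loc by simp
  ultimately show ?thesis unfolding set_theoretic_ci_def
    using L_local(1) fs_edge_loc aam by (intro conjI exI[of _ fs]) auto
qed

end

section \<open>The symbolic Rees algebra\<close>

text \<open>The coefficient of \<open>t\<^sup>k\<close>, where \<open>t\<close> is the variable with index 0.\<close>
lift_definition slice :: "nat \<Rightarrow> ('k::field) mpoly \<Rightarrow> 'k mpoly"
  is "\<lambda>k p e. if cf e 0 = 0 then p (e + mon 0 k) else 0"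
proof -
  fix k and p :: "expo \<Rightarrow> 'k" assume fin: "finite {e. p e \<noteq> 0}"
  have "inj_on (\<lambda>e :: expo. e + mon 0 k) UNIV" by (rule inj_onI) simp
  then have "finite ((\<lambda>e. e + mon 0 k) -` {e. p e \<noteq> 0})" by (rule finite_vimageI[OF fin])
  then show "finite {e. (if cf e 0 = 0 then p (e + mon 0 k) else 0) \<noteq> 0}"
    by (rule rev_finite_subset) auto
qed

lemma cf_slice: "cf (slice k p) e = (if cf e 0 = 0 then cf p (e + mon 0 k) else 0)"
  by transfer simp

lemma slice_add: "slice k (p + q) = slice k p + slice k q"
  by (rule poly_mapping_eqI) (simp add: cf_slice lookup_add)

lemma slice_zero [simp]: "slice k 0 = 0"
  by (rule poly_mapping_eqI) (simp add: cf_slice)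

lemma slice_sum: "slice k (sum g I) = (\<Sum>i\<in>I. slice k (g i))"
  by (induction I rule: infinite_finite_induct) (auto simp: slice_add)

lemma slice_mon: "slice k (mon e c) = (if cf e 0 = k then mon (e - mon 0 k) c else 0)"
proof (rule poly_mapping_eqI)
  fix g
  have "cf g 0 = 0 \<and> e = g + mon 0 k \<longleftrightarrow> cf e 0 = k \<and> e - mon 0 k = g"
  proof
    assume "cf g 0 = 0 \<and> e = g + mon 0 k"
    then show "cf e 0 = k \<and> e - mon 0 k = g" by (simp add: lookup_add)
  next
    assume h: "cf e 0 = k \<and> e - mon 0 k = g"
    then have "e = mon 0 k + (e - mon 0 k)"
      by (intro expo_diff) (auto simp: lookup_single "when_def")
    moreover have "cf g 0 = 0" using h by (auto simp: lookup_minus)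
    ultimately show "cf g 0 = 0 \<and> e = g + mon 0 k" using h by (simp add: add.commute)
  qed
  then show "cf (slice k (mon e c)) g = cf (if cf e 0 = k then mon (e - mon 0 k) c else 0) g"
    by (auto simp: cf_slice lookup_single "when_def")
qed

lemma slice_mult: "slice k (p * q) = (\<Sum>i\<le>k. slice i p * slice (k - i) q)"
proof -
  have "p \<in> poly_on UNIV" "q \<in> poly_on UNIV" by (auto simp: poly_on_def)
  then show ?thesis
  proof (induction rule: poly_on_induct)
    case (mon e c)
    from mon.prems show ?case
    proof (induction rule: poly_on_induct)
      case (mon g d)
      have "(\<Sum>i\<le>k. slice i (mon e c) * slice (k - i) (mon g d)) =
        (\<Sum>i\<le>k. if i = cf e 0 then mon (e - mon 0 i) c * slice (k - i) (mon g d) else 0)"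
        by (intro sum.cong refl) (auto simp: slice_mon)
      also have "\<dots> = (if cf e 0 \<le> k then mon (e - mon 0 (cf e 0)) c * slice (k - cf e 0) (mon g d) else 0)"
        by simp
      also have "\<dots> = slice k (mon e c * mon g d)"
      proof (cases "cf e 0 + cf g 0 = k")
        case True
        have e: "e = mon 0 (cf e 0) + (e - mon 0 (cf e 0))" "g = mon 0 (cf g 0) + (g - mon 0 (cf g 0))"
          by (rule expo_diff; auto simp: lookup_single "when_def")+
        have "e + g = (e - mon 0 (cf e 0)) + (g - mon 0 (cf g 0)) + (mon 0 (cf e 0) + mon 0 (cf g 0))"
          by (subst e(1), subst e(2)) (simp only: ac_simps)
        also have "mon 0 (cf e 0) + mon 0 (cf g 0) = mon 0 k" using True by (simp flip: single_add)
        finally have "e + g - mon 0 k = (e - mon 0 (cf e 0)) + (g - mon 0 (cf g 0))" by simp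
        moreover have "k - cf e 0 = cf g 0" "cf e 0 \<le> k" using True by auto
        ultimately show ?thesis using True by (simp add: slice_mon mult_single lookup_add)
      next
        case False
        then show ?thesis by (auto simp: slice_mon mult_single lookup_add)
      qed
      finally show ?case by simp
    qed (simp_all add: slice_add distrib_left sum.distrib)
  qed (simp_all add: slice_add distrib_right sum.distrib)
qed

lemma slice_one: "slice k (1 :: ('k::field) mpoly) = (if k = 0 then 1 else 0)"
  using slice_mon[of k 0 "1::'k"] by simp

lemma slice_in_edge_symbolic:
  assumes "p \<in> poly_on (rees_expos n)"
  shows "slice k p \<in> edge_symbolic n k"
  unfolding edge_symbolic_def poly_on_def
proof (rule CollectI, rule subsetI)
  fix e assume "e \<in> supp (slice k p)"
  then have e: "cf e 0 = 0" "e + mon 0 k \<in> supp p" by (auto simp: in_keys_iff cf_slice split: if_splits)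
  then have r: "e + mon 0 k \<in> rees_expos n" using assms by (auto dest: poly_onD)
  have "supp e \<subseteq> supp (e + mon 0 k)" by (auto simp: in_keys_iff lookup_add)
  then have "supp e \<subseteq> {0..n}" "0 \<notin> supp e" using r e(1) by (auto simp: rees_expos_def in_keys_iff)
  then have "x \<in> {1..n}" if "x \<in> supp e" for x
    using that by (cases x) (auto simp: One_nat_def)
  then have "supp e \<subseteq> {1..n}" by blast
  moreover have "k \<le> weight ({1..n} - {i}) e" if "i \<in> {1..n}" for i
  proof -
    have "cf (e + mon 0 k) 0 \<le> weight ({1..n} - {i}) (e + mon 0 k)" using r that by (simp add: rees_expos_def)
    then show ?thesis using e(1) by (simp add: lookup_add weight_add weight_single)
  qed
  ultimately show "e \<in> {e \<in> expos n. \<forall>i\<in>{1..n}. k \<le> weight ({1..n} - {i}) e}" by (simp add: expos_def)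
qed

lemma slice_bounded: "\<exists>N. \<forall>k>N. slice k p = 0"
proof -
  obtain N where N: "\<And>e. e \<in> supp p \<Longrightarrow> cf e 0 \<le> N"
    using finite_nat_set_iff_bounded_le[of "(\<lambda>e. cf e 0) ` supp p"] by auto
  have "slice k p = 0" if "k > N" for k
  proof (rule poly_mapping_eqI)
    fix e
    have "e + mon 0 k \<notin> supp p" using N[of "e + mon 0 k"] that by (auto simp: lookup_add)
    then show "cf (slice k p) e = cf 0 e" by (simp add: cf_slice in_keys_iff)
  qed
  then show ?thesis by blast
qed

lemma edge_symbolic_times_t:
  assumes "q \<in> edge_symbolic n k"
  shows "mon (mon 0 k) 1 * q \<in> poly_on (rees_expos n)"
    "slice j (mon (mon 0 k) 1 * q) = (if j = k then q else 0)"
proof -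
  have "mon (mon 0 k) 1 * q \<in> poly_on (rees_expos n) \<and>
    slice j (mon (mon 0 k) 1 * q) = (if j = k then q else 0)"
    using assms unfolding edge_symbolic_def
  proof (induction rule: poly_on_induct)
    case zero
    then show ?case by simp
  next
    case (add p q)
    then show ?case by (auto simp: distrib_left slice_add intro: add_in_poly_on)
  next
    case (mon e c)
    then have e: "supp e \<subseteq> {1..n}" "\<And>i. i \<in> {1..n} \<Longrightarrow> k \<le> weight ({1..n} - {i}) e"
      by (auto simp: expos_def)
    then have "0 \<notin> supp e" by auto
    then have e0: "cf e 0 = 0" by (simp add: in_keys_iff)
    have "supp (mon 0 k + e) \<subseteq> {0..n}"
      using Poly_Mapping.keys_add[of "mon 0 k" e] e(1) by (fastforce split: if_splits)
    then have "mon 0 k + e \<in> rees_expos n"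
      using e(2) e0 by (simp add: rees_expos_def lookup_add weight_add weight_single)
    then show ?case using e0 by (auto simp: mult_single slice_mon lookup_add intro: mon_in_poly_on)
  qed
  then show "mon (mon 0 k) 1 * q \<in> poly_on (rees_expos n)"
    "slice j (mon (mon 0 k) 1 * q) = (if j = k then q else 0)" by auto
qed

lemma (in ideal) finsum_mem:
  assumes "finite A" "\<And>i. i \<in> A \<Longrightarrow> g i \<in> I"
  shows "finsum R g A \<in> I"
  using assms
proof (induction A)
  case empty
  then show ?case by (simp add: zero_closed)
next
  case (insert x A)
  then have "finsum R g (insert x A) = g x \<oplus> finsum R g A"
    by (intro finsum_insert) (auto intro: Icarr)
  then show ?case using insert a_closed by simp
qed

context origin_local_ring
begin

abbreviation rees_alg :: "('b, nat \<Rightarrow> 'b) up_ring" where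
  "rees_alg \<equiv> symbolic_rees_algebra L edge_loc"

lemma ext_edge_symbolic_ideal: "ideal (ext (edge_symbolic n k)) L"
  by (rule ext_ideal[OF edge_symbolic_ideal])

lemma ext_edge_symbolic_0: "ext (edge_symbolic n 0) = carrier L"
proof -
  have "x \<in> ext (polys n)" if "x \<in> carrier L" for x using f_frac[OF that] that by (auto intro: extI)
  then show ?thesis unfolding edge_symbolic_0 by (auto simp: ext_def)
qed

lemma rees_alg_carrier: "carrier rees_alg = {g \<in> up L. \<forall>k. g k \<in> ext (edge_symbolic n k)}"
  unfolding symbolic_rees_algebra_def symbolic_power_edge_loc by (auto simp: UP_def)

lemma rees_alg_cring: "cring rees_alg"
proof -
  interpret UP_cring L "UP L" by unfold_locales
  have sub: "carrier rees_alg \<subseteq> carrier (UP L)" by (auto simp: symbolic_rees_algebra_def)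
  have memI: "g \<in> carrier rees_alg"
    if "g \<in> carrier (UP L)" "\<And>k. UnivPoly.coeff (UP L) g k \<in> ext (edge_symbolic n k)" for g
    using that unfolding symbolic_rees_algebra_def symbolic_power_edge_loc by simp
  have memD: "UnivPoly.coeff (UP L) g k \<in> ext (edge_symbolic n k)" if "g \<in> carrier rees_alg" for g k
    using that unfolding symbolic_rees_algebra_def symbolic_power_edge_loc by simp
  interpret E: ideal "ext (edge_symbolic n k)" L for k by (rule ext_edge_symbolic_ideal)
  have "subring (carrier rees_alg) (UP L)"
  proof (rule P.subringI[OF sub])
    show "\<one>\<^bsub>UP L\<^esub> \<in> carrier rees_alg"
      by (rule memI) (auto simp: ext_edge_symbolic_0 E.zero_closed)
    show "\<ominus>\<^bsub>UP L\<^esub> g \<in> carrier rees_alg" if "g \<in> carrier rees_alg" for g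
      using that sub memD[OF that] by (intro memI) (auto simp: subset_iff)
    show "g \<oplus>\<^bsub>UP L\<^esub> h \<in> carrier rees_alg" if "g \<in> carrier rees_alg" "h \<in> carrier rees_alg" for g h
      using that sub memD[OF that(1)] memD[OF that(2)] by (intro memI) (auto simp: subset_iff)
    show "g \<otimes>\<^bsub>UP L\<^esub> h \<in> carrier rees_alg" if gh: "g \<in> carrier rees_alg" "h \<in> carrier rees_alg" for g h
    proof (rule memI)
      have c: "g \<in> carrier (UP L)" "h \<in> carrier (UP L)" using gh sub by auto
      then show "g \<otimes>\<^bsub>UP L\<^esub> h \<in> carrier (UP L)" by simp
      fix k
      have "UnivPoly.coeff (UP L) g i \<otimes>\<^bsub>L\<^esub> UnivPoly.coeff (UP L) h (k - i) \<in> ext (edge_symbolic n k)"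
        if "i \<in> {..k}" for i
        by (rule ext_mult[OF _ _ _ memD[OF gh(1)] memD[OF gh(2)]])
          (use edge_symbolic_polys edge_symbolic_mult[of _ n i _ "k - i"] that in auto)
      then show "UnivPoly.coeff (UP L) (g \<otimes>\<^bsub>UP L\<^esub> h) k \<in> ext (edge_symbolic n k)"
        unfolding coeff_mult[OF c] by (intro E.finsum_mem) auto
    qed
  qed
  then have "subcring (carrier rees_alg) (UP L)" by (rule P.subcringI')
  then have "cring ((UP L)\<lparr>carrier := carrier rees_alg\<rparr>)" using P.subcring_iff[OF sub] by simp
  moreover have "(UP L)\<lparr>carrier := carrier rees_alg\<rparr> = rees_alg" by (simp add: symbolic_rees_algebra_def)
  ultimately show ?thesis by simp
qed

definition rees_map :: "'k mpoly \<Rightarrow> nat \<Rightarrow> 'b" where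
  "rees_map p = (\<lambda>k. f (slice k p))"

lemma f_sum: "finite I \<Longrightarrow> (\<And>i. i \<in> I \<Longrightarrow> g i \<in> polys n) \<Longrightarrow> f (sum g I) = finsum L (\<lambda>i. f (g i)) I"
proof (induction I rule: finite_induct)
  case empty
  then show ?case using f.hom_zero by simp
next
  case (insert x I)
  then show ?case using f.hom_add[of "g x" "sum g I"] sum_in_poly_on[of I g "expos n"]
    by (subst L.finsum_insert) auto
qed

lemma slice_polys: "p \<in> poly_on (rees_expos n) \<Longrightarrow> slice k p \<in> polys n"
  using slice_in_edge_symbolic edge_symbolic_polys by blast

lemma rees_map_closed:
  assumes "p \<in> poly_on (rees_expos n)"
  shows "rees_map p \<in> carrier rees_alg"
proof -
  obtain N where N: "\<And>k. k > N \<Longrightarrow> slice k p = 0" using slice_bounded by blast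
  then have "bound \<zero>\<^bsub>L\<^esub> N (rees_map p)" using f.hom_zero by (auto simp: bound_def rees_map_def)
  moreover have "rees_map p k \<in> ext (edge_symbolic n k)" for k
    unfolding rees_map_def using f_in_ext[OF slice_in_edge_symbolic[OF assms]] slice_polys[OF assms] by simp
  ultimately show ?thesis unfolding rees_alg_carrier up_def
    using slice_polys[OF assms] by (auto simp: rees_map_def)
qed

lemma rees_alg_up: "g \<in> carrier rees_alg \<Longrightarrow> g \<in> up L"
  by (simp add: rees_alg_carrier)

lemma rees_map_hom: "rees_map \<in> ring_hom (mon_ring (rees_expos n)) rees_alg"
proof (rule ring_hom_memI)
  fix p q :: "'k mpoly"
  assume "p \<in> carrier (mon_ring (rees_expos n))" "q \<in> carrier (mon_ring (rees_expos n))"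
  then have p: "p \<in> poly_on (rees_expos n)" and q: "q \<in> poly_on (rees_expos n)" by auto
  note up = rees_alg_up[OF rees_map_closed[OF p]] rees_alg_up[OF rees_map_closed[OF q]]
  have "rees_map p \<oplus>\<^bsub>rees_alg\<^esub> rees_map q = (\<lambda>i. rees_map p i \<oplus>\<^bsub>L\<^esub> rees_map q i)"
    using up by (simp add: symbolic_rees_algebra_def UP_def)
  then show "rees_map (p \<oplus>\<^bsub>mon_ring (rees_expos n)\<^esub> q) = rees_map p \<oplus>\<^bsub>rees_alg\<^esub> rees_map q"
    using f.hom_add slice_polys[OF p] slice_polys[OF q] by (simp add: rees_map_def slice_add)
  have "rees_map p \<otimes>\<^bsub>rees_alg\<^esub> rees_map q = (\<lambda>k. \<Oplus>\<^bsub>L\<^esub>i\<in>{..k}. rees_map p i \<otimes>\<^bsub>L\<^esub> rees_map q (k - i))"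
    using up by (simp add: symbolic_rees_algebra_def UP_def)
  also have "\<dots> = rees_map (p * q)"
  proof
    fix k
    have "rees_map (p * q) k = (\<Oplus>\<^bsub>L\<^esub>i\<in>{..k}. f (slice i p * slice (k - i) q))"
      unfolding rees_map_def slice_mult using slice_polys[OF p] slice_polys[OF q] by (intro f_sum polys_mult) auto
    also have "\<dots> = (\<Oplus>\<^bsub>L\<^esub>i\<in>{..k}. rees_map p i \<otimes>\<^bsub>L\<^esub> rees_map q (k - i))"
      unfolding rees_map_def using f.hom_mult slice_polys[OF p] slice_polys[OF q]
      by (intro L.finsum_cong') auto
    finally show "(\<Oplus>\<^bsub>L\<^esub>i\<in>{..k}. rees_map p i \<otimes>\<^bsub>L\<^esub> rees_map q (k - i)) = rees_map (p * q) k" by simp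
  qed
  finally show "rees_map (p \<otimes>\<^bsub>mon_ring (rees_expos n)\<^esub> q) = rees_map p \<otimes>\<^bsub>rees_alg\<^esub> rees_map q" by simp
next
  show "rees_map \<one>\<^bsub>mon_ring (rees_expos n)\<^esub> = \<one>\<^bsub>rees_alg\<^esub>"
    using f.hom_one f.hom_zero by (auto simp: rees_map_def slice_one symbolic_rees_algebra_def UP_def)
qed (simp add: rees_map_closed)

lemma smult_UP:
  "\<lbrakk>a \<in> carrier L; b \<in> up L\<rbrakk> \<Longrightarrow> a \<odot>\<^bsub>UP L\<^esub> b = (\<lambda>k. a \<otimes>\<^bsub>L\<^esub> b k)"
  by (simp add: UP_def)

lemma origin_units_prod: "finite I \<Longrightarrow> (\<And>i. i \<in> I \<Longrightarrow> s i \<in> origin_units n) \<Longrightarrow> (prod s I :: 'k mpoly) \<in> origin_units n"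
  by (induction I rule: finite_induct) (use U_mult U_one in auto)

text \<open>
  An element of the symbolic Rees algebra has finitely many coefficients. Multiplying it by a common
  denominator, which is a unit in degree 0, makes all its coefficients images of polynomials in
  \<open>edge_symbolic n k\<close>, and these assemble to an element of the monoid algebra.
\<close>
lemma rees_alg_noetherian: "noetherian_ring rees_alg"
proof (rule noetherian_transfer[OF mon_ring_noetherian[OF dickson_monoid_rees] rees_alg_cring rees_map_hom])
  interpret UP_cring L "UP L" by unfold_locales
  interpret E: ideal "ext (edge_symbolic n k)" L for k by (rule ext_edge_symbolic_ideal)
  have constI: "UnivPoly.monom (UP L) a 0 \<in> carrier rees_alg" if "a \<in> carrier L" for a
    unfolding symbolic_rees_algebra_def symbolic_power_edge_loc
    using that by (auto simp: ext_edge_symbolic_0 E.zero_closed)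
  have mult: "g \<otimes>\<^bsub>rees_alg\<^esub> h = g \<otimes>\<^bsub>UP L\<^esub> h" and one: "\<one>\<^bsub>rees_alg\<^esub> = \<one>\<^bsub>UP L\<^esub>" for g h
    by (simp_all add: symbolic_rees_algebra_def)
  fix b assume b: "b \<in> carrier rees_alg"
  have bP: "b \<in> carrier (UP L)" using b by (simp add: symbolic_rees_algebra_def)
  have bE: "b k \<in> ext (edge_symbolic n k)" for k using b unfolding rees_alg_carrier by blast
  then have bL: "b k \<in> carrier L" for k by (rule E.Icarr)
  have "\<forall>k. \<exists>s p. s \<in> origin_units n \<and> p \<in> edge_symbolic n k \<and> f s \<otimes>\<^bsub>L\<^esub> b k = f p"
    using bE unfolding ext_def by blast
  from choice[OF this] obtain s
    where "\<forall>k. \<exists>p. s k \<in> origin_units n \<and> p \<in> edge_symbolic n k \<and> f (s k) \<otimes>\<^bsub>L\<^esub> b k = f p" by blast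
  from choice[OF this] obtain p
    where sp: "\<And>k. s k \<in> origin_units n" "\<And>k. p k \<in> edge_symbolic n k" "\<And>k. f (s k) \<otimes>\<^bsub>L\<^esub> b k = f (p k)"
    by blast
  obtain N where N: "\<And>k. k > N \<Longrightarrow> b k = \<zero>\<^bsub>L\<^esub>"
    using rees_alg_up[OF b] unfolding up_def bound_def by blast
  \<comment> \<open>a common denominator of the coefficients\<close>
  define d where "d = (\<Prod>k\<in>{..N}. s k)"
  have d: "d \<in> origin_units n" unfolding d_def by (rule origin_units_prod) (use sp in auto)
  have dS: "d \<in> polys n" using d origin_units_polys by blast
  define q where "q k = (if k \<le> N then (\<Prod>j\<in>{..N} - {k}. s j) * p k else 0)" for k
  have q: "q k \<in> edge_symbolic n k" "f d \<otimes>\<^bsub>L\<^esub> b k = f (q k)" for k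
  proof -
    have r: "(\<Prod>j\<in>{..N} - {k}. s j) \<in> polys n" using origin_units_prod[of "{..N} - {k}" s] sp(1) origin_units_polys by blast
    have pS: "p k \<in> polys n" and sS: "s k \<in> polys n" using sp edge_symbolic_polys origin_units_polys by blast+
    show "q k \<in> edge_symbolic n k"
      using edge_symbolic_mult[of "p k" n k "\<Prod>j\<in>{..N} - {k}. s j" 0] sp(2)[of k] r edge_symbolic_ideal[of n k]
      by (auto simp: q_def edge_symbolic_0 mult.commute poly_ideal_iff)
    show "f d \<otimes>\<^bsub>L\<^esub> b k = f (q k)"
    proof (cases "k \<le> N")
      case True
      then have "d = (\<Prod>j\<in>{..N} - {k}. s j) * s k" unfolding d_def by (subst prod.remove[of _ k]) auto
      then have "f d \<otimes>\<^bsub>L\<^esub> b k = f (\<Prod>j\<in>{..N} - {k}. s j) \<otimes>\<^bsub>L\<^esub> f (p k)"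
        using f.hom_mult[of _ "s k"] r sS bL sp(3)[of k] by (simp add: L.m_assoc)
      then show ?thesis using True f.hom_mult r pS by (simp add: q_def)
    next
      case False
      then show ?thesis using N[of k] f.hom_zero dS by (simp add: q_def)
    qed
  qed
  define a where "a = (\<Sum>k\<in>{..N}. mon (mon 0 k) 1 * q k)"
  have a: "a \<in> poly_on (rees_expos n)"
    unfolding a_def using edge_symbolic_times_t(1)[OF q(1)] by (intro sum_in_poly_on)
  have "slice k a = q k" for k
    unfolding a_def slice_sum edge_symbolic_times_t(2)[OF q(1)] by (auto simp: q_def)
  then have ra: "rees_map a = (\<lambda>k. f d \<otimes>\<^bsub>L\<^esub> b k)" by (simp add: rees_map_def q(2))
  obtain v where v: "v \<in> carrier L" "v \<otimes>\<^bsub>L\<^esub> f d = \<one>\<^bsub>L\<^esub>" "f d \<otimes>\<^bsub>L\<^esub> v = \<one>\<^bsub>L\<^esub>"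
    using f_units[OF d] by (auto simp: Units_def)
  have fd: "f d \<in> carrier L" using dS by simp
  let ?u = "UnivPoly.monom (UP L) (f d) 0" and ?v = "UnivPoly.monom (UP L) v 0"
  have "?v \<otimes>\<^bsub>UP L\<^esub> ?u = \<one>\<^bsub>UP L\<^esub>" "?u \<otimes>\<^bsub>UP L\<^esub> ?v = \<one>\<^bsub>UP L\<^esub>"
    using monom_mult[OF v(1) fd, of 0 0] monom_mult[OF fd v(1), of 0 0] v monom_one by simp_all
  then have uv: "?v \<otimes>\<^bsub>rees_alg\<^esub> ?u = \<one>\<^bsub>rees_alg\<^esub>" "?u \<otimes>\<^bsub>rees_alg\<^esub> ?v = \<one>\<^bsub>rees_alg\<^esub>" by (simp_all only: mult one)
  have "?u \<in> Units rees_alg"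
    unfolding Units_def mem_Collect_eq
    by (intro conjI bexI[of _ ?v] constI fd v(1) uv)
  moreover have "?u \<otimes>\<^bsub>rees_alg\<^esub> b = rees_map a"
  proof -
    have "?u \<otimes>\<^bsub>rees_alg\<^esub> b = f d \<odot>\<^bsub>UP L\<^esub> b" using monom_mult_is_smult[OF fd bP] mult by simp
    also have "\<dots> = (\<lambda>k. f d \<otimes>\<^bsub>L\<^esub> b k)" by (rule smult_UP[OF fd rees_alg_up[OF b]])
    finally show ?thesis using ra by simp
  qed
  ultimately show "\<exists>u\<in>Units rees_alg. \<exists>a\<in>carrier (mon_ring (rees_expos n)). u \<otimes>\<^bsub>rees_alg\<^esub> b = rees_map a"
    using a by auto
qed

lemma quotient_cohen_macaulay:
  assumes k: "k > 0"
  shows "cohen_macaulay_local (L Quot ext (edge_symbolic n k))"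
proof -
  interpret Q: fraction_map "mon_ring (expos n)" "origin_units n" "edge_symbolic n k" "L Quot ext (edge_symbolic n k)"
    "\<lambda>r. ext (edge_symbolic n k) +>\<^bsub>L\<^esub> f r"
    by (rule fraction_map_quotient[OF edge_symbolic_ideal zero_sub[OF edge_symbolic_ideal]])
  interpret Q: origin_quotient n "edge_symbolic n k" "L Quot ext (edge_symbolic n k)" "\<lambda>r. ext (edge_symbolic n k) +>\<^bsub>L\<^esub> f r"
  proof unfold_locales
    have "1 \<in> {1..n}" using n_pos by simp
    then have "(edge_symbolic n k :: 'k mpoly set) \<subseteq> axis_power n 1 k" using edge_symbolic_iff[OF n_pos] by blast
    also have "\<dots> \<subseteq> coord_power n {1..n} k" by (rule coord_power_mono_set) auto
    also have "\<dots> \<subseteq> origin_ideal n" unfolding coord_power_def using k by (intro poly_on_mono) auto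
    finally show "(edge_symbolic n k :: 'k mpoly set) \<subseteq> origin_ideal n" .
  qed (use n_pos edge_symbolic_saturated in auto)
  show ?thesis by (rule Q.cohen_macaulay[OF refl k])
qed

end

section \<open>Symbolic powers of the edge ideal of a complete graph\<close>

theorem mainTheorem4:
  fixes n :: nat
    and S :: "((nat \<Rightarrow>\<^sub>0 nat) \<Rightarrow>\<^sub>0 'k::field) ring"
    and R :: "(((nat \<Rightarrow>\<^sub>0 nat) \<Rightarrow>\<^sub>0 'k) \<times> ((nat \<Rightarrow>\<^sub>0 nat) \<Rightarrow>\<^sub>0 'k)) set ring"
  assumes "infinite (UNIV :: 'k set)"
    and "n > 0"
    and "S = poly_ring_upto n"
    and "\<mm> = vars_ideal n"
    and "R = localize_at S \<mm>"
    and "\<aa> = extend_loc S \<mm> (edge_ideal n (complete_graph_edges n))"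
  shows "(unmixed R \<aa> \<and> (\<forall>k\<ge>1. cohen_macaulay_local (R Quot (symbolic_power R \<aa> k)))) \<and>
         noetherian_ring (symbolic_rees_algebra R \<aa>) \<and>
         set_theoretic_ci R \<aa>"
proof -
  let ?S = "mon_ring (expos n) :: 'k mpoly ring"
  have S: "S = ?S" and m: "\<mm> = origin_ideal n" by (simp_all add: assms poly_ring_upto_eq vars_ideal_eq)
  have R: "R = localize_at ?S (origin_ideal n)" by (simp add: assms(5) S m)
  interpret fraction_map ?S "origin_units n" "{0}" R "to_loc ?S (origin_ideal n)"
    using to_loc_fraction_map[OF coord_power_prime[of n "{1..n}"]] unfolding R origin_units_eq by simp
  interpret origin_local_ring n R "to_loc ?S (origin_ideal n)"
  proof unfold_locales
    show "{0} \<subseteq> (origin_ideal n :: 'k mpoly set)" using coord_power_ideal[of n "{1..n}" 1] unfolding poly_ideal_iff by blast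
    show "p \<in> {0}" if "u \<in> origin_units n" "p \<in> polys n" "u * p \<in> {0}" for u p :: "'k mpoly"
      using that by (auto simp: origin_units_def)
  qed (rule assms(2))
  have a: "\<aa> = edge_loc"
    unfolding assms(6) extend_loc_def S m edge_ideal_eq[OF assms(2)]
    using genideal_image[OF edge_symbolic_ideal] unfolding R .
  have "unmixed R edge_loc"
    unfolding unmixed_def assoc_primes_edge_loc using height_axis_prime by auto
  moreover have "cohen_macaulay_local (R Quot symbolic_power R edge_loc k)" if "k \<ge> 1" for k
    unfolding symbolic_power_edge_loc using that by (intro quotient_cohen_macaulay) simp
  ultimately show ?thesis
    unfolding a using rees_alg_noetherian edge_loc_set_theoretic_ci by blast
qed

end
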